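(* Let $T>0$, $d\in\mathbb{N}$, and let $(\boldsymbol{b},\boldsymbol{a},\boldsymbol{\gamma}):[0,T]\times\mathcal{P}(\mathbb{R}^d)\times\mathbb{R}^d\to\mathbb{R}^d\times\mathbb{R}^{d\times d}\times\mathbb{R}^{d\times d}$ be measurable. Suppose $(\Omega,\mathbb{G}=(\mathcal{G}_t)_{t\in[0,T]},\mathbb{P})$ is a filtered probability space supporting a $d$-dimensional $\mathbb{G}$-Brownian motion $\boldsymbol{B}$ and a continuous $\mathbb{G}$-adapted $\mathcal{P}(\mathbb{R}^d)$-valued process $(\mu_t)_{t\in[0,T]}$ satisfying the SPDE $$\mathrm{d}\langle\mu_t,\varphi\rangle=\big\langle\mu_t,L^{\boldsymbol{b},\boldsymbol{a}}_{t,\mu_t}\varphi\big\rangle\,\mathrm{d}t+\big\langle\mu_t,(\nabla\varphi)^\top\boldsymbol{\gamma}(t,\mu_t,\cdot)\big\rangle\,\mathrm{d}\boldsymbol{B}_t,\quad t\in[0,T],\ \varphi\in C_c^\infty(\mathbb{R}^d),$$ and the integrability condition $$\mathbb{E}\bigg[\int_0^T\big\|\boldsymbol{b}(t,\mu_t,\cdot)\big\|_{L_1(\mu_t)}+\big\|\boldsymbol{a}(t,\mu_t,\cdot)\big\|_{L_1(\mu_t)}+\big\|\boldsymbol{\gamma}(t,\mu_t,\cdot)\big\|_{L_1(\mu_t)}^2\,\mathrm{d}t\bigg]<\infty.$$ Let $P_t:=\mathcal{L}(\mu_t)$ for $t\in[0,T]$. Then $(P_t)_{t\in[0,T]}$ satisfies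 the Fokker-Planck equation: for all $t\in[0,T]$, $k\in\mathbb{N}$, $f\in C_c^2(\mathbb{R}^k)$ and $\boldsymbol{\varphi}=(\varphi_1,\ldots,\varphi_k)\in(C_c^\infty(\mathbb{R}^d))^k$, $$\int_{\mathcal{P}(\mathbb{R}^d)}f(\langle m,\boldsymbol{\varphi}\rangle)\,(P_t-P_0)(\mathrm{d}m)=\int_0^t\int_{\mathcal{P}(\mathbb{R}^d)}\bigg[\sum_{i=1}^k\partial_if(\langle m,\boldsymbol{\varphi}\rangle)\big\langle m,L^{\boldsymbol{b},\boldsymbol{a}}_{s,m}\varphi_i\big\rangle+\frac12\sum_{i,j=1}^k\partial_{ij}f(\langle m,\boldsymbol{\varphi}\rangle)\big\langle m,(\nabla\varphi_i)^\top\boldsymbol{\gamma}(s,m,\cdot)\big\rangle\cdot\big\langle m,(\nabla\varphi_j)^\top\boldsymbol{\gamma}(s,m,\cdot)\big\rangle\bigg]P_s(\mathrm{d}m)\,\mathrm{d}s.$$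
   Context: For a Polish space $E$, $\mathcal{P}(E)$ is the space of Borel probability measures on $E$ with the topology of weak convergence and its Borel $\sigma$-algebra. $\langle m,\varphi\rangle=\int\varphi\,\mathrm{d}m$ (componentwise for vector-valued $\varphi$), $\langle m,\boldsymbol{\varphi}\rangle=(\langle m,\varphi_1\rangle,\ldots,\langle m,\varphi_k\rangle)$. $|\cdot|$ is the Euclidean norm of vectors and Frobenius norm of matrices; $\|f\|_{L_1(m)}=\int|f|\,\mathrm{d}m$; $S:R=\mathrm{Tr}[SR^\top]$. $L^{\boldsymbol{b},\boldsymbol{a}}_{t,m}\varphi:=\boldsymbol{b}(t,m,\cdot)\cdot\nabla\varphi+\frac12\boldsymbol{a}(t,m,\cdot):\nabla^2\varphi$. The SPDE is understood in integrated form, for each $\varphi\in C_c^\infty(\mathbb{R}^d)$. $\mathcal{L}(\mu_t)$ is the law of $\mu_t$. *)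

theory Defs
  imports "HOL-Probability.Probability"
begin

section \<open>The space of probability measures\<close>

text \<open>The sets in the generating family with \<open>U = UNIV\<close> make the topological space
  equal to the set of all Borel probability measures.\<close>

definition weak_topology :: "'a::topological_space measure topology" where
  "weak_topology = topology_generated_by
     {{m \<in> space (prob_algebra borel). (\<integral>x. f x \<partial>m) \<in> U} | (f :: 'a \<Rightarrow> real) (U :: real set).
        continuous_on UNIV f \<and> bounded (range f) \<and> open U}"

definition weak_borel :: "'a::topological_space measure measure" where
  "weak_borel = sigma (topspace weak_topology) {U. openin weak_topology U}"


section \<open>Test functions and differential operators\<close>

definition partial :: "'n::finite \<Rightarrow> (real^'n \<Rightarrow> real) \<Rightarrow> real^'n \<Rightarrow> real" where
  "partial i f x = frechet_derivative f (at x) (axis i 1)"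

primrec Ck :: "nat \<Rightarrow> (real^'n::finite \<Rightarrow> real) \<Rightarrow> bool" where
  "Ck 0 f \<longleftrightarrow> continuous_on UNIV f"
| "Ck (Suc k) f \<longleftrightarrow> (\<forall>x. f differentiable (at x)) \<and> (\<forall>i. Ck k (partial i f))"

definition compact_support :: "(real^'n::finite \<Rightarrow> real) \<Rightarrow> bool" where
  "compact_support f \<longleftrightarrow> compact (closure {x. f x \<noteq> 0})"

definition Cc2 :: "(real^'n::finite \<Rightarrow> real) set" where
  "Cc2 = {f. Ck 2 f \<and> compact_support f}"

definition Cc_infinity :: "(real^'n::finite \<Rightarrow> real) set" where
  "Cc_infinity = {f. (\<forall>k. Ck k f) \<and> compact_support f}"

definition grad :: "(real^'n::finite \<Rightarrow> real) \<Rightarrow> real^'n \<Rightarrow> real^'n" where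
  "grad f x = (\<chi> i. partial i f x)"

definition hess :: "(real^'n::finite \<Rightarrow> real) \<Rightarrow> real^'n \<Rightarrow> real^'n^'n" where
  "hess f x = (\<chi> i j. partial i (partial j f) x)"

definition frob_inner :: "real^'n^'n \<Rightarrow> real^'n^'n \<Rightarrow> real" where
  "frob_inner S R = trace (S ** transpose R)"

text \<open>Coefficients are curried functions of time, measure and space. The vector
  \<open>grad \<phi> x v* \<gamma> s m x\<close> used below is the row vector \<open>(\<nabla>\<phi>)\<^sup>T \<gamma>\<close>.\<close>

definition generator ::
  "(real \<Rightarrow> (real^'d::finite) measure \<Rightarrow> real^'d \<Rightarrow> real^'d) \<Rightarrow>
   (real \<Rightarrow> (real^'d) measure \<Rightarrow> real^'d \<Rightarrow> real^'d^'d) \<Rightarrow>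
   real \<Rightarrow> (real^'d) measure \<Rightarrow> (real^'d \<Rightarrow> real) \<Rightarrow> real^'d \<Rightarrow> real" where
  "generator b a t m \<phi> x =
     b t m x \<bullet> grad \<phi> x + 1 / 2 * frob_inner (a t m x) (hess \<phi> x)"

definition pairing :: "(real^'d) measure \<Rightarrow> ('k::finite \<Rightarrow> real^'d \<Rightarrow> real) \<Rightarrow> real^'k" where
  "pairing m \<phi> = (\<chi> i. \<integral>x. \<phi> i x \<partial>m)"

definition fp_integrand ::
  "(real \<Rightarrow> (real^'d::finite) measure \<Rightarrow> real^'d \<Rightarrow> real^'d) \<Rightarrow>
   (real \<Rightarrow> (real^'d) measure \<Rightarrow> real^'d \<Rightarrow> real^'d^'d) \<Rightarrow>
   (real \<Rightarrow> (real^'d) measure \<Rightarrow> real^'d \<Rightarrow> real^'d^'d) \<Rightarrow>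
   (real^'k::finite \<Rightarrow> real) \<Rightarrow> ('k \<Rightarrow> real^'d \<Rightarrow> real) \<Rightarrow>
   real \<Rightarrow> (real^'d) measure \<Rightarrow> real" where
  "fp_integrand b a \<gamma> f \<phi> s m =
     (\<Sum>i\<in>UNIV. partial i f (pairing m \<phi>) * (\<integral>x. generator b a s m (\<phi> i) x \<partial>m))
   + 1 / 2 * (\<Sum>i\<in>UNIV. \<Sum>j\<in>UNIV. partial i (partial j f) (pairing m \<phi>) *
       ((\<integral>x. grad (\<phi> i) x v* \<gamma> s m x \<partial>m) \<bullet> (\<integral>x. grad (\<phi> j) x v* \<gamma> s m x \<partial>m)))"


section \<open>Filtrations, Brownian motion and the Ito integral\<close>

text \<open>No completeness or right-continuity is imposed on filtrations.\<close>

definition filtered_prob_space :: "'w measure \<Rightarrow> (real \<Rightarrow> 'w measure) \<Rightarrow> real \<Rightarrow> bool" where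
  "filtered_prob_space M G T \<longleftrightarrow> prob_space M \<and>
     (\<forall>t\<in>{0..T}. subalgebra M (G t)) \<and>
     (\<forall>t\<in>{0..T}. \<forall>s\<in>{0..t}. sets (G s) \<subseteq> sets (G t))"

definition brownian_motion ::
  "'w measure \<Rightarrow> (real \<Rightarrow> 'w measure) \<Rightarrow> real \<Rightarrow> (real \<Rightarrow> 'w \<Rightarrow> real^'d::finite) \<Rightarrow> bool" where
  "brownian_motion M G T B \<longleftrightarrow>
     (\<forall>t\<in>{0..T}. B t \<in> borel_measurable (G t)) \<and>
     (AE \<omega> in M. B 0 \<omega> = 0) \<and>
     (AE \<omega> in M. continuous_on {0..T} (\<lambda>t. B t \<omega>)) \<and>
     (\<forall>s t. 0 \<le> s \<and> s < t \<and> t \<le> T \<longrightarrow>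
        prob_space.indep_set M (sets (G s))
          (sets (vimage_algebra (space M) (\<lambda>\<omega>. B t \<omega> - B s \<omega>) borel)) \<and>
        prob_space.indep_vars M (\<lambda>_. borel) (\<lambda>i \<omega>. B t \<omega> $ i - B s \<omega> $ i) (UNIV :: 'd set) \<and>
        (\<forall>i. distributed M lborel (\<lambda>\<omega>. B t \<omega> $ i - B s \<omega> $ i)
               (normal_density 0 (sqrt (t - s)))))"

definition continuous_adapted ::
  "'w measure \<Rightarrow> (real \<Rightarrow> 'w measure) \<Rightarrow> real \<Rightarrow> (real \<Rightarrow> 'w \<Rightarrow> 'a::topological_space measure) \<Rightarrow> bool"
where
  "continuous_adapted M G T \<mu> \<longleftrightarrow>
     (\<forall>t\<in>{0..T}. \<mu> t \<in> G t \<rightarrow>\<^sub>M weak_borel) \<and>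
     (\<forall>\<omega>\<in>space M. continuous_map (top_of_set {0..T}) weak_topology (\<lambda>t. \<mu> t \<omega>))"

definition progressive ::
  "(real \<Rightarrow> 'w measure) \<Rightarrow> real \<Rightarrow> (real \<Rightarrow> 'w \<Rightarrow> real^'d::finite) \<Rightarrow> bool" where
  "progressive G T H \<longleftrightarrow>
     (\<forall>t\<in>{0..T}. (\<lambda>(s, \<omega>). H s \<omega>) \<in> borel_measurable (restrict_space borel {0..t} \<Otimes>\<^sub>M G t))"

text \<open>A simple process equals \<open>\<xi> i\<close> on the time interval \<open>{\<tau> i<..\<tau> (Suc i)}\<close> for each \<open>i < n\<close>.\<close>

definition simple_data ::
  "(real \<Rightarrow> 'w measure) \<Rightarrow> real \<Rightarrow> nat \<Rightarrow> (nat \<Rightarrow> real) \<Rightarrow> (nat \<Rightarrow> 'w \<Rightarrow> real^'d::finite) \<Rightarrow> bool" where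
  "simple_data G T n \<tau> \<xi> \<longleftrightarrow>
     (\<forall>i\<le>n. \<tau> i \<in> {0..T}) \<and> (\<forall>i<n. \<tau> i \<le> \<tau> (Suc i)) \<and>
     (\<forall>i<n. \<xi> i \<in> borel_measurable (G (\<tau> i)) \<and> bounded (\<xi> i ` space (G (\<tau> i))))"

definition simple_process ::
  "nat \<Rightarrow> (nat \<Rightarrow> real) \<Rightarrow> (nat \<Rightarrow> 'w \<Rightarrow> real^'d::finite) \<Rightarrow> real \<Rightarrow> 'w \<Rightarrow> real^'d" where
  "simple_process n \<tau> \<xi> t \<omega> = (\<Sum>i<n. indicator {\<tau> i<..\<tau> (Suc i)} t *\<^sub>R \<xi> i \<omega>)"

definition simple_integral ::
  "(real \<Rightarrow> 'w \<Rightarrow> real^'d::finite) \<Rightarrow> nat \<Rightarrow> (nat \<Rightarrow> real) \<Rightarrow> (nat \<Rightarrow> 'w \<Rightarrow> real^'d) \<Rightarrow> real \<Rightarrow> 'w \<Rightarrow> real"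
where
  "simple_integral B n \<tau> \<xi> t \<omega> =
     (\<Sum>i<n. \<xi> i \<omega> \<bullet> (B (min (\<tau> (Suc i)) t) \<omega> - B (min (\<tau> i) t) \<omega>))"

text \<open>The square-integrable theory: \<open>I\<close> is a continuous version of the Ito integral process
  \<open>t \<mapsto> \<integral>\<^sub>0\<^sup>t H \<bullet> dB\<close> on \<open>[0,T]\<close> of a progressively measurable \<open>H \<in> L\<^sup>2(dt \<otimes> P)\<close>, i.e. the
  \<open>L\<^sup>2\<close>-limit of the elementary integrals of simple processes converging to \<open>H\<close> in
  \<open>L\<^sup>2(dt \<otimes> P)\<close>. Such an approximating sequence exists for every such \<open>H\<close>, and by the Ito isometry
  \<open>I\<close> does not depend on the sequence, up to indistinguishability.\<close>

definition has_ito_integral ::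
  "'w measure \<Rightarrow> (real \<Rightarrow> 'w measure) \<Rightarrow> real \<Rightarrow> (real \<Rightarrow> 'w \<Rightarrow> real^'d::finite) \<Rightarrow>
   (real \<Rightarrow> 'w \<Rightarrow> real^'d) \<Rightarrow> (real \<Rightarrow> 'w \<Rightarrow> real) \<Rightarrow> bool" where
  "has_ito_integral M G T B H I \<longleftrightarrow>
     progressive G T H \<and>
     (\<integral>\<^sup>+ \<omega>. (\<integral>\<^sup>+ s\<in>{0..T}. ennreal ((norm (H s \<omega>))\<^sup>2) \<partial>lborel) \<partial>M) < \<infinity> \<and>
     (\<forall>t\<in>{0..T}. I t \<in> borel_measurable M) \<and>
     (AE \<omega> in M. continuous_on {0..T} (\<lambda>t. I t \<omega>)) \<and>
     (\<exists>N \<tau> \<xi>. (\<forall>n. simple_data G T (N n) (\<tau> n) (\<xi> n)) \<and>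
        (\<lambda>n. \<integral>\<^sup>+ \<omega>. (\<integral>\<^sup>+ s\<in>{0..T}.
            ennreal ((norm (simple_process (N n) (\<tau> n) (\<xi> n) s \<omega> - H s \<omega>))\<^sup>2) \<partial>lborel) \<partial>M)
          \<longlonglongrightarrow> 0 \<and>
        (\<forall>t\<in>{0..T}.
          (\<lambda>n. \<integral>\<^sup>+ \<omega>. ennreal ((simple_integral B (N n) (\<tau> n) (\<xi> n) t \<omega> - I t \<omega>)\<^sup>2) \<partial>M)
            \<longlonglongrightarrow> 0))"


section \<open>The SPDE\<close>

text \<open>Integrated form. Under the integrability condition
  \<open>E \<integral>\<^sub>0\<^sup>T \<parallel>\<gamma>(t,\<mu>\<^sub>t,\<cdot>)\<parallel>\<^sup>2 dt < \<infinity>\<close> (with the \<open>L\<^sub>1(\<mu>\<^sub>t)\<close> norm) the integrand of the stochastic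
  integral is square integrable, so the square-integrable Ito integral applies.\<close>

definition solves_spde ::
  "(real \<Rightarrow> (real^'d::finite) measure \<Rightarrow> real^'d \<Rightarrow> real^'d) \<Rightarrow>
   (real \<Rightarrow> (real^'d) measure \<Rightarrow> real^'d \<Rightarrow> real^'d^'d) \<Rightarrow>
   (real \<Rightarrow> (real^'d) measure \<Rightarrow> real^'d \<Rightarrow> real^'d^'d) \<Rightarrow>
   'w measure \<Rightarrow> (real \<Rightarrow> 'w measure) \<Rightarrow> real \<Rightarrow> (real \<Rightarrow> 'w \<Rightarrow> real^'d) \<Rightarrow>
   (real \<Rightarrow> 'w \<Rightarrow> (real^'d) measure) \<Rightarrow> bool" where
  "solves_spde b a \<gamma> M G T B \<mu> \<longleftrightarrow>
     (\<forall>\<phi>\<in>Cc_infinity. \<exists>I.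
        has_ito_integral M G T B (\<lambda>s \<omega>. \<integral>x. grad \<phi> x v* \<gamma> s (\<mu> s \<omega>) x \<partial>\<mu> s \<omega>) I \<and>
        (AE \<omega> in M. \<forall>t\<in>{0..T}.
           (\<integral>x. \<phi> x \<partial>\<mu> t \<omega>) = (\<integral>x. \<phi> x \<partial>\<mu> 0 \<omega>)
             + (LINT s:{0..t}|lborel. (\<integral>x. generator b a s (\<mu> s \<omega>) \<phi> x \<partial>\<mu> s \<omega>))
             + I t \<omega>))"

end

theory Submission
  imports Defs
begin

text \<open>
  Write \<open>X = \<langle>\<mu>, \<phi>\<rangle>\<close>, and let \<open>A\<close> and \<open>I\<close> be its drift and its Ito integral. Along the equidistant
  partition of \<open>[0,t]\<close>, each increment \<open>f(X + \<Delta>I + \<Delta>A) - f(X)\<close> is split at \<open>f(X + \<Delta>I)\<close>. The drift is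
  only integrable, so the first part is compared with \<open>\<nabla>f(X) \<cdot> \<Delta>A\<close> to first order: the error is at
  most \<open>\<integral>|\<beta>| ds\<close> over the interval times a bounded oscillation, and vanishes by dominated convergence
  and path continuity. In the second order expansion of \<open>f(X + \<Delta>I) - f(X)\<close> the linear term has mean
  zero and the quadratic term is evaluated by the Ito isometry, both because \<open>X\<close> is adapted; the
  remainder is at most \<open>\<epsilon>|\<Delta>I|\<^sup>2 + K|\<Delta>I|\<^sup>2 1{|\<Delta>I| > \<delta>}\<close>, so a Lindeberg property of the
  increments of Ito integrals suffices. Covariations follow by polarization from the SPDE for the
  test functions \<open>\<phi>\<^sub>i + \<phi>\<^sub>j\<close>, which avoids a common refinement of two approximating sequences.

  Joint measurability of the coefficients along the path rests on the fact that the Borel sets of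
  the weak topology are generated by the evaluations \<open>m \<mapsto> m(O)\<close>: the sets \<open>{m. m(O) > q}\<close>, with \<open>q\<close>
  rational and \<open>O\<close> a finite union of members of a countable base, form a countable subbasis.
\<close>

section \<open>The space of probability measures\<close>

text \<open>Only expectations are claimed, and the derivatives of \<open>f\<close> are bounded, so
  every limit is taken under the expectation and the stochastic integral enters through its first
  two moments against bounded weights \<open>Z\<close> known at the left end of an interval. These
  weights become the derivatives of \<open>f\<close> at the left end point.

  The integrability condition makes the stochastic integrand square integrable and gives nothing
  beyond that, so a remainder estimate by fourth moments of \<open>I\<close> itself is out of reach.
  Fourth moments do exist for simple integrands, and the Lindeberg property carries what they say
  over to the limit.

  A second obstacle is the default value 0 of a Bochner integral. The integrals of the coefficients
  over space are additive in the test function only where the coefficients are integrable. This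
  holds at almost every pair of time and path, so the identities between drifts and between
  stochastic integrands hold almost everywhere.

  Laws come last: an integral against \<open>P s\<close> is an expectation at time \<open>s\<close>,
  and Fubini separates time from the path.\<close>

abbreviation prob_borel :: "'a::topological_space measure measure" where
  "prob_borel \<equiv> prob_algebra borel"

lemma prob_borelD:
  assumes "m \<in> space prob_borel"
  shows "prob_space m" "sets m = sets borel" "space m = UNIV"
  using assms sets_eq_imp_space_eq[of m borel] by (auto simp: space_prob_algebra)

lemma integrable_bounded_continuous:
  fixes f :: "'a::topological_space \<Rightarrow> real"
  assumes "m \<in> space prob_borel" "continuous_on UNIV f" "bounded (range f)"
  shows "integrable m f"
proof -
  interpret prob_space m using prob_borelD(1)[OF assms(1)] .
  obtain C where "\<And>x. norm (f x) \<le> C" using assms(3) by (auto simp: bounded_iff)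
  moreover have "f \<in> borel_measurable m"
    using borel_measurable_continuous_onI[OF assms(2)] measurable_cong_sets[OF prob_borelD(2)[OF assms(1)] refl]
    by blast
  ultimately show ?thesis by (intro integrable_const_bound[of _ C]) auto
qed

text \<open>Open sets form an intersection-stable generator, so it is enough that the measure of an
  open set depends measurably on the parameter. That measure is a limit of integrals of bounded
  continuous functions, by dominated convergence.\<close>

lemma measurable_prob_borelI:
  fixes K :: "'b \<Rightarrow> 'a::metric_space measure"
  assumes space: "\<And>x. x \<in> space N \<Longrightarrow> K x \<in> space prob_borel"
    and meas: "\<And>f :: 'a \<Rightarrow> real. continuous_on UNIV f \<Longrightarrow> bounded (range f) \<Longrightarrow>
      (\<lambda>x. \<integral>y. f y \<partial>K x) \<in> borel_measurable N"
  shows "K \<in> N \<rightarrow>\<^sub>M prob_borel"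
proof (rule measurable_prob_algebra_generated[where \<Omega>=UNIV and G="Collect open"])
  show "sets (borel :: 'a measure) = sigma_sets UNIV (Collect open)"
    by (rule sets_borel)
  show "Int_stable (Collect open)" by (auto simp: Int_stable_def)
  show "prob_space (K x)" "sets (K x) = sets borel" if "x \<in> space N" for x
    using prob_borelD[OF space[OF that]] by auto
  fix U :: "'a set" assume "U \<in> Collect open"
  then have U: "open U" by simp
  show "(\<lambda>x. emeasure (K x) U) \<in> borel_measurable N"
  \<comment> \<open>\<open>infdist\<close> to the empty set is 0 by convention, so the approximation
    used for the other open sets would give 0 instead of 1 here.\<close>
  proof (cases "U = UNIV")
    case True
    have "emeasure (K x) U = 1" if "x \<in> space N" for x
      using True prob_space.emeasure_space_1 prob_borelD[OF space[OF that]] by metis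
    then show ?thesis by (subst measurable_cong[where g="\<lambda>_. 1"]) auto
  next
    case False
    \<comment> \<open>Continuous approximations of the indicator from below: 0 off \<open>U\<close>,
      and eventually 1 at each point of \<open>U\<close>, because its distance to the closed
      complement is positive.\<close>
    define f where "f n x = min 1 (real n * infdist x (- U))" for n x
    have cont: "continuous_on UNIV (f n)" for n
      unfolding f_def by (intro continuous_intros)
    have bdd: "bounded (range (f n))" for n
      by (rule boundedI[of _ 1]) (auto simp: f_def infdist_nonneg)
    have lim: "(\<lambda>n. f n x) \<longlonglongrightarrow> indicator U x" for x
    proof (cases "x \<in> U")
      case True
      have "infdist x (- U) > 0"
        using True False U in_closed_iff_infdist_zero[of "- U" x] infdist_nonneg[of x "- U"]
        by (auto simp: order_less_le)
      then obtain n0 :: nat where "1 < real n0 * infdist x (- U)"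
        using reals_Archimedean3 by blast
      moreover have "real n * infdist x (- U) \<ge> real n0 * infdist x (- U)" if "n \<ge> n0" for n
        using that by (intro mult_right_mono) (auto simp: infdist_nonneg)
      ultimately have "eventually (\<lambda>n. f n x = 1) sequentially"
        unfolding eventually_sequentially f_def by (intro exI[of _ n0]) force
      then show ?thesis using True by (simp add: tendsto_eventually)
    next
      case False
      then show ?thesis by (auto simp: f_def)
    qed
    have conv: "(\<lambda>n. \<integral>y. f n y \<partial>K x) \<longlonglongrightarrow> measure (K x) U" if x: "x \<in> space N" for x
    proof -
      interpret prob_space "K x" using prob_borelD[OF space[OF x]] by auto
      have [measurable_cong]: "sets (K x) = sets borel" using prob_borelD[OF space[OF x]] by auto
      have [measurable]: "f n \<in> borel_measurable borel" for n
        using cont by (rule borel_measurable_continuous_onI)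
      have [measurable]: "U \<in> sets borel" using U by auto
      have "(\<lambda>n. \<integral>y. f n y \<partial>K x) \<longlonglongrightarrow> (\<integral>y. indicator U y \<partial>K x)"
        by (rule integral_dominated_convergence[where w="\<lambda>_. 1"])
           (use lim infdist_nonneg in \<open>auto simp: f_def[symmetric]\<close>, simp add: f_def infdist_nonneg)
      then show ?thesis by (simp add: prob_borelD[OF space[OF x]])
    qed
    have "(\<lambda>x. measure (K x) U) \<in> borel_measurable N"
      by (rule borel_measurable_LIMSEQ_real[OF conv meas[OF cont bdd]])
    then have "(\<lambda>x. ennreal (measure (K x) U)) \<in> borel_measurable N" by simp
    then show ?thesis
      by (rule measurable_cong[THEN iffD2, rotated])
         (metis finite_measure.emeasure_eq_measure prob_borelD(1) prob_space_def space)
  qed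
qed auto

section \<open>The weak topology and a countable basis for it\<close>

lemma openin_weak_topology_Basis:
  fixes f :: "'a::topological_space \<Rightarrow> real"
  assumes "continuous_on UNIV f" "bounded (range f)" "open U"
  shows "openin weak_topology {m \<in> space prob_borel. (\<integral>x. f x \<partial>m) \<in> U}"
  unfolding weak_topology_def by (rule topology_generated_by_Basis) (use assms in blast)

lemma topspace_weak_topology: "topspace weak_topology = space prob_borel"
proof -
  have "\<exists>(f :: 'a \<Rightarrow> real) (U :: real set). space prob_borel = {m \<in> space prob_borel. (\<integral>x. f x \<partial>m) \<in> U} \<and>
        continuous_on UNIV f \<and> bounded (range f) \<and> open U"
    by (intro exI[of _ "\<lambda>_. 0"] exI[of _ UNIV]) (auto simp: image_constant_conv)
  then have "space prob_borel \<in> {{m \<in> space prob_borel. (\<integral>x. f x \<partial>m) \<in> U} | (f :: 'a \<Rightarrow> real) (U :: real set).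
        continuous_on UNIV f \<and> bounded (range f) \<and> open U}" by blast
  then show ?thesis unfolding weak_topology_def topology_generated_by_topspace by auto
qed

lemma space_weak_borel: "space weak_borel = space prob_borel"
  unfolding weak_borel_def topspace_weak_topology[symmetric]
  by (rule space_measure_of) (auto dest: openin_subset)

lemma sets_weak_borel: "sets weak_borel = sigma_sets (space prob_borel) {U. openin weak_topology U}"
  unfolding weak_borel_def topspace_weak_topology[symmetric]
  by (rule sets_measure_of) (auto dest: openin_subset)

lemma borel_measurable_integral_continuous:
  fixes f :: "'a::topological_space \<Rightarrow> real"
  assumes "continuous_on UNIV f" "bounded (range f)"
  shows "(\<lambda>m. \<integral>x. f x \<partial>m) \<in> borel_measurable weak_borel"
proof (rule borel_measurableI)
  fix S :: "real set" assume "open S"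
  then have "openin weak_topology {m \<in> space prob_borel. (\<integral>x. f x \<partial>m) \<in> S}"
    by (rule openin_weak_topology_Basis[OF assms])
  then show "(\<lambda>m. \<integral>x. f x \<partial>m) -` S \<inter> space weak_borel \<in> sets weak_borel"
    unfolding sets_weak_borel space_weak_borel
    by (intro sigma_sets.Basic) (simp add: vimage_def Int_def conj_commute)
qed

text \<open>\<open>O'\<close> is a countable union of basic sets; the finite partial unions increase
  to it, and continuity from below does the rest. This replaces evaluations at arbitrary open sets
  by countably many evaluations.\<close>

lemma open_inner_measure_basis:
  fixes O' :: "'a::topological_space set"
  assumes B: "topological_basis B" "countable B" and O': "open O'"
    and m: "m \<in> space prob_borel" and c: "c < measure m O'"
  obtains F where "finite F" "F \<subseteq> B" "\<Union>F \<subseteq> O'" "c < measure m (\<Union>F)"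
proof -
  interpret prob_space m using prob_borelD(1)[OF m] .
  note sets_m = prob_borelD(2)[OF m]
  obtain B' where B': "B' \<subseteq> B" "\<Union>B' = O'" using B O' by (meson topological_basis_def)
  have B'_open: "open b" if "b \<in> B'" for b using that B' B by (metis subsetD topological_basis_open)
  show ?thesis
  proof (cases "B' = {}")
    case True
    then show ?thesis using c B' by (intro that[of "{}"]) auto
  next
    case False
    have cB: "countable B'" using B' B countable_subset by blast
    define A where "A n = (\<Union>i\<in>{..n}. from_nat_into B' i)" for n :: nat
    have A_O: "(\<Union>n. A n) = O'"
    proof -
      have "(\<Union>n. A n) = \<Union>(range (from_nat_into B'))" unfolding A_def by blast
      then show ?thesis using range_from_nat_into[OF False cB] B'(2) by simp
    qed
    have "open (A n)" for n
      unfolding A_def using B'_open from_nat_into[OF False] by blast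
    then have "range A \<subseteq> sets m" by (auto simp: sets_m)
    moreover have "incseq A" unfolding incseq_def A_def by (intro allI impI UN_mono) auto
    ultimately have "(\<lambda>n. measure m (A n)) \<longlonglongrightarrow> measure m (\<Union>n. A n)"
      by (intro finite_Lim_measure_incseq)
    then have "eventually (\<lambda>n. c < measure m (A n)) sequentially"
      using c A_O by (intro order_tendstoD(1)) auto
    then obtain n where "c < measure m (A n)" by (auto simp: eventually_sequentially)
    then show ?thesis
      using from_nat_into[OF False] B' A_O
      by (intro that[of "from_nat_into B' ` {..n}"]) (auto simp: A_def)
  qed
qed

text \<open>Integrating this lower sum expresses \<open>\<integral>g\<close> through the measures of the open sets \<open>{g > k/n}\<close>.\<close>

lemma lower_layer_sum:
  fixes x :: real
  assumes "0 \<le> x" "x \<le> real K" "n > 0"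
  defines "h \<equiv> (\<Sum>k\<in>{1..n * K}. indicator {real k / real n <..} x) / real n :: real"
  shows "h \<le> x" "x - 1 / real n \<le> h"
proof -
  \<comment> \<open>The layers are strict, so the count runs over \<open>k \<ge> 1\<close> with
    \<open>k < n * x\<close>, which gives the ceiling minus 1; \<open>nat\<close> turns this into 0
    for \<open>x = 0\<close>.\<close>
  define j where "j = nat (\<lceil>real n * x\<rceil> - 1)"
  have nx: "real k / real n < x \<longleftrightarrow> real k < real n * x" for k
    using assms by (simp add: field_simps)
  have "{k \<in> {1..n * K}. real k / real n < x} = {1..j}"
  proof (intro set_eqI iffI)
    fix k assume "k \<in> {k \<in> {1..n * K}. real k / real n < x}"
    then have "k \<ge> 1" "real k < real n * x" by (auto simp: nx)
    then show "k \<in> {1..j}" unfolding j_def by (auto simp: le_nat_iff) linarith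
  next
    fix k assume k: "k \<in> {1..j}"
    then have "int k < \<lceil>real n * x\<rceil>" unfolding j_def by auto
    then have "real k < real n * x" by linarith
    moreover have "real n * x \<le> real n * real K" using assms by (intro mult_left_mono) auto
    ultimately have "real k < real n * real K" by linarith
    then have "real k < real (n * K)" by simp
    then have "k \<le> n * K" by linarith
    then show "k \<in> {k \<in> {1..n * K}. real k / real n < x}"
      using k \<open>real k < real n * x\<close> by (auto simp: nx)
  qed
  moreover have "(\<Sum>k\<in>{1..n * K}. indicator {real k / real n <..} x :: real)
      = real (card {k \<in> {1..n * K}. real k / real n < x})"
    by (simp add: indicator_def sum.If_cases Int_def)
  ultimately have h: "h = real j / real n" unfolding h_def by simp
  have "real j \<le> real n * x"
  proof (cases "\<lceil>real n * x\<rceil> \<ge> 1")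
    case True
    then have "real j = of_int \<lceil>real n * x\<rceil> - 1" unfolding j_def by simp
    then show ?thesis by linarith
  next
    case False
    then show ?thesis unfolding j_def using assms by simp
  qed
  then show "h \<le> x" unfolding h using assms by (simp add: field_simps)
  have "real n * x \<le> real j + 1" unfolding j_def by linarith
  then have "x \<le> (real j + 1) / real n" using assms by (simp add: pos_le_divide_eq mult.commute)
  then show "x - 1 / real n \<le> h" unfolding h by (simp add: add_divide_distrib)
qed

definition weak_subbasis :: "'a::topological_space set set \<Rightarrow> 'a measure set set" where
  "weak_subbasis B =
    (\<lambda>(F, q). {m \<in> space prob_borel. real_of_rat q < measure m (\<Union>F)}) ` ({F. finite F \<and> F \<subseteq> B} \<times> UNIV)"

text \<open>Intersecting with \<open>space prob_borel\<close> makes the empty family yield the whole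
  space instead of \<open>UNIV\<close>.\<close>

definition weak_basis :: "'a::topological_space set set \<Rightarrow> 'a measure set set" where
  "weak_basis B = (\<lambda>\<V>. space prob_borel \<inter> \<Inter>\<V>) ` {\<V>. finite \<V> \<and> \<V> \<subseteq> weak_subbasis B}"

lemma countable_weak_basis:
  assumes "countable B"
  shows "countable (weak_basis B)"
  unfolding weak_basis_def weak_subbasis_def
  by (intro countable_image countable_Collect_finite_subset countable_SIGMA assms) auto

lemma weak_basis_Int:
  assumes "V \<in> weak_basis B" "W \<in> weak_basis B"
  shows "V \<inter> W \<in> weak_basis B"
proof -
  obtain \<V> \<W> where "finite \<V>" "\<V> \<subseteq> weak_subbasis B" "V = space prob_borel \<inter> \<Inter>\<V>"
    "finite \<W>" "\<W> \<subseteq> weak_subbasis B" "W = space prob_borel \<inter> \<Inter>\<W>"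
    using assms by (auto simp: weak_basis_def)
  then show ?thesis unfolding weak_basis_def by (intro image_eqI[of _ _ "\<V> \<union> \<W>"]) auto
qed

lemma weak_basis_sets:
  assumes B: "topological_basis B" and V: "V \<in> weak_basis B"
  shows "V \<in> sets prob_borel"
proof -
  obtain \<V> where \<V>: "finite \<V>" "\<V> \<subseteq> weak_subbasis B" "V = space prob_borel \<inter> \<Inter>\<V>"
    using V by (auto simp: weak_basis_def)
  have "W \<in> sets prob_borel" if W: "W \<in> \<V>" for W
  proof -
    obtain F q where F: "finite F" "F \<subseteq> B" "W = {m \<in> space prob_borel. real_of_rat q < measure m (\<Union>F)}"
      using W \<V> by (auto simp: weak_subbasis_def)
    have "open (\<Union>F)" using F B by (meson open_Union subsetD topological_basis_open)
    then have [measurable]: "\<Union>F \<in> sets borel" by simp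
    show ?thesis unfolding F(3) by measurable
  qed
  with \<V>(1) have "space prob_borel \<inter> \<Inter>\<V> \<in> sets prob_borel"
  proof (induction \<V>)
    case (insert W \<W>)
    have "space prob_borel \<inter> \<Inter>(insert W \<W>) = W \<inter> (space prob_borel \<inter> \<Inter>\<W>)" by auto
    then show ?case using insert by auto
  qed auto
  then show ?thesis unfolding \<V>(3) .
qed

text \<open>After a shift to \<open>g \<ge> 0\<close>, the integral is up to \<open>1 / n\<close> a
  finite sum of evaluations at the open sets \<open>O' k\<close>. Each evaluation is bounded below,
  near \<open>m0\<close>, by a rational slightly smaller than its value at \<open>m0\<close>. Open
  sets control integrals from below only; the other side comes from applying the result to
  \<open>- f\<close>.\<close>

lemma weak_basis_superlevel:
  fixes f :: "'a::topological_space \<Rightarrow> real"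
  assumes B: "topological_basis B" "countable B"
    and f: "continuous_on UNIV f" "bounded (range f)"
    and m0: "m0 \<in> space prob_borel" and c: "c < (\<integral>x. f x \<partial>m0)"
  obtains V where "V \<in> weak_basis B" "m0 \<in> V" "\<And>m. m \<in> V \<Longrightarrow> c < (\<integral>x. f x \<partial>m)"
proof -
  obtain C where C: "\<And>x. norm (f x) \<le> C" using f(2) by (auto simp: bounded_iff)
  define g where "g x = f x + C" for x
  have C0: "C \<ge> 0" using C[of undefined] norm_ge_zero order_trans by blast
  obtain K where "2 * C \<le> real K" using real_arch_simple by blast
  then have g: "0 \<le> g x" "g x \<le> real K" for x using C[of x] by (auto simp: g_def)
  have int_g: "(\<integral>x. g x \<partial>m) = (\<integral>x. f x \<partial>m) + C" "integrable m g" if m: "m \<in> space prob_borel" for m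
  proof -
    interpret prob_space m using prob_borelD(1)[OF m] .
    show "(\<integral>x. g x \<partial>m) = (\<integral>x. f x \<partial>m) + C" "integrable m g"
      unfolding g_def using integrable_bounded_continuous[OF m f] by (auto simp: prob_space)
  qed
  have "c + C < (\<integral>x. g x \<partial>m0)" using c int_g[OF m0] by simp
  \<comment> \<open>The discretization error fits into the gap between the integral of
    \<open>g\<close> and \<open>c + C\<close>, so the lower sum still exceeds
    \<open>c + C\<close>.\<close>
  then obtain n where n: "n > 0" "1 / real n < ((\<integral>x. g x \<partial>m0) - (c + C))"
    using nat_approx_posE[of "(\<integral>x. g x \<partial>m0) - (c + C)"] by (metis diff_gt_0_iff_gt zero_less_Suc)
  define O' where "O' k = {x. real k / real n < g x}" for k
  have op: "open (O' k)" for k unfolding O'_def g_def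
    using f(1) by (intro open_Collect_less continuous_intros)
  define h where "h x = (\<Sum>k\<in>{1..n * K}. indicator {real k / real n <..} (g x)) / real n" for x
  have h: "h x \<le> g x" "g x - 1 / real n \<le> h x" for x
    using lower_layer_sum[OF g n(1), of x] unfolding h_def by auto
  have h_eq: "h x = (\<Sum>k\<in>{1..n * K}. indicator (O' k) x) / real n" for x
    unfolding h_def O'_def by (simp add: indicator_def)
  have int_h: "(\<integral>x. h x \<partial>m) = (\<Sum>k\<in>{1..n * K}. measure m (O' k)) / real n" "integrable m h"
    if m: "m \<in> space prob_borel" for m
  proof -
    interpret prob_space m using prob_borelD(1)[OF m] .
    have [simp]: "O' k \<in> sets m" for k using op prob_borelD(2)[OF m] by auto
    show "(\<integral>x. h x \<partial>m) = (\<Sum>k\<in>{1..n * K}. measure m (O' k)) / real n" "integrable m h"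
      unfolding h_eq using prob_borelD(3)[OF m] by (auto simp: emeasure_eq_measure)
  qed
  interpret m0: prob_space m0 using prob_borelD(1)[OF m0] .
  have "(\<integral>x. g x - 1 / real n \<partial>m0) \<le> (\<integral>x. h x \<partial>m0)"
    using h int_g[OF m0] int_h[OF m0] by (intro integral_mono) auto
  then have "c + C < (\<integral>x. h x \<partial>m0)"
    using n int_g[OF m0] by (simp add: m0.prob_space)
  then have "real n * (c + C) < (\<Sum>k\<in>{1..n * K}. measure m0 (O' k))"
    unfolding int_h[OF m0] using n by (simp add: field_simps)
  \<comment> \<open>The slack of the lower sum, distributed over its \<open>n * K\<close> layers.
    The additional 1 keeps the total loss strictly below the slack and the denominator positive when
    \<open>n * K\<close> is 0.\<close>
  define e where "e = ((\<Sum>k\<in>{1..n * K}. measure m0 (O' k)) - real n * (c + C)) / real (n * K + 1)"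
  have e: "e > 0" unfolding e_def using \<open>real n * (c + C) < _\<close> by (intro divide_pos_pos) (auto simp only: of_nat_0_less_iff diff_gt_0_iff_gt)
  have "\<exists>F q. finite F \<and> F \<subseteq> B \<and> \<Union>F \<subseteq> O' k \<and> real_of_rat q < measure m0 (\<Union>F)
      \<and> measure m0 (O' k) - e < real_of_rat q" for k
  proof -
    obtain F where F: "finite F" "F \<subseteq> B" "\<Union>F \<subseteq> O' k" "measure m0 (O' k) - e < measure m0 (\<Union>F)"
      using open_inner_measure_basis[OF B op m0, of "measure m0 (O' k) - e" k] e by auto
    then show ?thesis using of_rat_dense[OF F(4)] by blast
  qed
  then obtain F q where F: "\<And>k. finite (F k)" "\<And>k. F k \<subseteq> B" "\<And>k. \<Union>(F k) \<subseteq> O' k"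
    and q: "\<And>k. real_of_rat (q k) < measure m0 (\<Union>(F k))" "\<And>k. measure m0 (O' k) - e < real_of_rat (q k)"
    by metis
  define \<V> where "\<V> = (\<lambda>k. {m \<in> space prob_borel. real_of_rat (q k) < measure m (\<Union>(F k))}) ` {1..n * K}"
  show ?thesis
  proof
    show "space prob_borel \<inter> \<Inter>\<V> \<in> weak_basis B"
    proof -
      have "{m \<in> space prob_borel. real_of_rat (q k) < measure m (\<Union>(F k))} \<in> weak_subbasis B" for k
        unfolding weak_subbasis_def by (rule image_eqI[of _ _ "(F k, q k)"]) (use F in simp_all)
      then have "finite \<V>" "\<V> \<subseteq> weak_subbasis B" unfolding \<V>_def by auto
      then show ?thesis unfolding weak_basis_def by blast
    qed
    show "m0 \<in> space prob_borel \<inter> \<Inter>\<V>" using m0 q by (auto simp: \<V>_def)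
    fix m assume m: "m \<in> space prob_borel \<inter> \<Inter>\<V>"
    then have mp: "m \<in> space prob_borel" by auto
    interpret prob_space m using prob_borelD(1)[OF mp] .
    have *: "measure m0 (O' k) - e \<le> measure m (O' k)" if "k \<in> {1..n * K}" for k
    proof -
      have "real_of_rat (q k) < measure m (\<Union>(F k))" using m that by (auto simp: \<V>_def)
      also have "\<dots> \<le> measure m (O' k)"
        using F(3)[of k] op[of k] prob_borelD(2)[OF mp] by (intro finite_measure_mono) auto
      finally show ?thesis using q(2)[of k] by simp
    qed
    have "real n * (c + C) < (\<Sum>k\<in>{1..n * K}. measure m0 (O' k)) - real (n * K) * e"
    proof -
      have "real (n * K) * e < real (n * K + 1) * e" using e by simp
      also have "\<dots> = (\<Sum>k\<in>{1..n * K}. measure m0 (O' k)) - real n * (c + C)"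
        unfolding e_def by (simp del: of_nat_Suc of_nat_add)
      finally show ?thesis by linarith
    qed
    also have "\<dots> = (\<Sum>k\<in>{1..n * K}. measure m0 (O' k) - e)" by (simp add: sum_subtractf)
    also have "\<dots> \<le> (\<Sum>k\<in>{1..n * K}. measure m (O' k))" using * by (intro sum_mono)
    finally have "c + C < (\<integral>x. h x \<partial>m)" unfolding int_h[OF mp] using n by (simp add: field_simps)
    also have "\<dots> \<le> (\<integral>x. g x \<partial>m)" using h int_g[OF mp] int_h[OF mp] by (intro integral_mono) auto
    finally show "c < (\<integral>x. f x \<partial>m)" using int_g[OF mp] by simp
  qed
qed

text \<open>Induction over the generation of the topology. At a subbasic set, an interval of radius
  \<open>e\<close> around the integral of \<open>f\<close> is cut out by one superlevel set for
  \<open>f\<close> and one for \<open>- f\<close>.\<close>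

lemma weak_basis_nhds:
  assumes B: "topological_basis B" "countable B"
    and U: "openin weak_topology U" and m: "m \<in> U"
  shows "\<exists>V\<in>weak_basis B. m \<in> V \<and> V \<subseteq> U"
proof -
  have "generate_topology_on {{m \<in> space prob_borel. (\<integral>x. f x \<partial>m) \<in> U} | (f :: 'a \<Rightarrow> real) (U :: real set).
        continuous_on UNIV f \<and> bounded (range f) \<and> open U} U"
    using U unfolding weak_topology_def openin_topology_generated_by_iff .
  then show ?thesis using m
  proof (induction arbitrary: m rule: generate_topology_on.induct)
    case (Int a b)
    then obtain V W where "V \<in> weak_basis B" "m \<in> V" "V \<subseteq> a" "W \<in> weak_basis B" "m \<in> W" "W \<subseteq> b"
      by (meson IntD1 IntD2)
    then show ?case by (intro bexI[of _ "V \<inter> W"] weak_basis_Int) auto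
  next
    case (UN K)
    then show ?case by (meson Sup_upper UnionE order_trans)
  next
    case (Basis s)
    then obtain f :: "'a \<Rightarrow> real" and W where s: "s = {m \<in> space prob_borel. (\<integral>x. f x \<partial>m) \<in> W}"
      and f: "continuous_on UNIV f" "bounded (range f)" and W: "open W" by blast
    have m: "m \<in> space prob_borel" "(\<integral>x. f x \<partial>m) \<in> W" using Basis s by auto
    obtain e where e: "e > 0" "\<And>y. dist y (\<integral>x. f x \<partial>m) < e \<Longrightarrow> y \<in> W"
      using W m(2) by (meson open_dist)
    have f': "continuous_on UNIV (\<lambda>x. - f x)" "bounded (range (\<lambda>x. - f x))"
      using f by (auto intro!: continuous_intros simp: bounded_iff)
    obtain V1 where V1: "V1 \<in> weak_basis B" "m \<in> V1" "\<And>m'. m' \<in> V1 \<Longrightarrow> (\<integral>x. f x \<partial>m) - e < (\<integral>x. f x \<partial>m')"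
      using weak_basis_superlevel[OF B f m(1), of "(\<integral>x. f x \<partial>m) - e"] e by auto
    obtain V2 where V2: "V2 \<in> weak_basis B" "m \<in> V2" "\<And>m'. m' \<in> V2 \<Longrightarrow> (\<integral>x. - f x \<partial>m) - e < (\<integral>x. - f x \<partial>m')"
      using weak_basis_superlevel[OF B f' m(1), of "(\<integral>x. - f x \<partial>m) - e"] e by auto
    have "V1 \<inter> V2 \<subseteq> s"
    proof
      fix m' assume m': "m' \<in> V1 \<inter> V2"
      then have "dist (\<integral>x. f x \<partial>m') (\<integral>x. f x \<partial>m) < e"
        using V1(3)[of m'] V2(3)[of m'] by (auto simp: dist_real_def)
      moreover have "m' \<in> space prob_borel" using m' V1(1) by (auto simp: weak_basis_def)
      ultimately show "m' \<in> s" using e(2) s by auto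
    qed
    then show ?case using V1 V2 by (intro bexI[of _ "V1 \<inter> V2"] weak_basis_Int) auto
  qed auto
qed

text \<open>An open set is the union of the members of the basis that it contains, and countability
  of the basis makes this union measurable. Conversely, the identity is measurable into
  \<open>prob_borel\<close> because integrals of bounded continuous functions are measurable on
  \<open>weak_borel\<close>.\<close>

theorem sets_weak_borel_eq_prob_algebra:
  "sets (weak_borel :: 'a::{metric_space, second_countable_topology} measure measure) = sets prob_borel"
proof (intro antisym)
  obtain B :: "'a set set" where B: "countable B" "topological_basis B"
    using ex_countable_basis by blast
  have "U \<in> sets prob_borel" if U: "openin weak_topology U" for U :: "'a measure set"
  proof -
    have "U = \<Union>{V \<in> weak_basis B. V \<subseteq> U}" using weak_basis_nhds[OF B(2,1) U] by blast
    moreover have "\<Union>{V \<in> weak_basis B. V \<subseteq> U} \<in> sets prob_borel"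
      using countable_weak_basis[OF B(1)] weak_basis_sets[OF B(2)]
      by (intro sets.countable_Union) (auto intro: countable_subset)
    ultimately show ?thesis by simp
  qed
  then show "sets (weak_borel :: 'a measure measure) \<subseteq> sets prob_borel"
    unfolding sets_weak_borel by (intro sets.sigma_sets_subset) auto
  have "(\<lambda>m. m) \<in> weak_borel \<rightarrow>\<^sub>M (prob_borel :: 'a measure measure)"
    by (rule measurable_prob_borelI) (auto simp: space_weak_borel intro: borel_measurable_integral_continuous)
  then show "sets prob_borel \<subseteq> sets (weak_borel :: 'a measure measure)"
    by (auto dest!: measurable_sets simp: space_weak_borel dest: sets.sets_into_space
        intro: sets.Int_space_eq2[symmetric])
qed

section \<open>Joint measurability of kernels and of continuous processes\<close>

lemma measurable_weak_borel_eq: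
  "N \<rightarrow>\<^sub>M (weak_borel :: 'a::{metric_space, second_countable_topology} measure measure) = N \<rightarrow>\<^sub>M prob_borel"
  by (rule measurable_cong_sets[OF refl sets_weak_borel_eq_prob_algebra])

text \<open>The dependence of the integrand on the parameter is absorbed into the kernel:
  \<open>L x\<close> is pushed forward along \<open>y \<mapsto> (x, y)\<close> to a kernel on the
  product, where the integrand is fixed.\<close>

lemma integral_measurable_subprob_algebra_pair:
  fixes f :: "'a \<Rightarrow> 'b \<Rightarrow> 'c::{banach, second_countable_topology}"
  assumes f[measurable]: "(\<lambda>(x, y). f x y) \<in> borel_measurable (M \<Otimes>\<^sub>M N)"
    and L[measurable]: "L \<in> M \<rightarrow>\<^sub>M subprob_algebra N"
  shows "(\<lambda>x. \<integral>y. f x y \<partial>L x) \<in> borel_measurable M"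
proof -
  note integral_measurable_subprob_algebra[measurable] measurable_distr2[measurable]
  have "(\<lambda>x. integral\<^sup>L (distr (L x) (M \<Otimes>\<^sub>M N) (\<lambda>y. (x, y))) (\<lambda>(x, y). f x y)) \<in> borel_measurable M"
    by measurable
  then show ?thesis
    by (rule measurable_cong[THEN iffD1, rotated]) (simp add: integral_distr)
qed

text \<open>Nothing is known about a process outside \<open>{0..T}\<close>. Freezing time at the end
  points extends it to all reals, so that measurability can be stated on \<open>borel\<close> and
  \<open>lborel\<close>. The same map later restricts partitions to a subinterval.\<close>

abbreviation clip :: "real \<Rightarrow> real \<Rightarrow> real \<Rightarrow> real" where
  "clip u v x \<equiv> max u (min v x)"

text \<open>Rounding time down to the grid of mesh \<open>1 / n\<close> leaves countably many
  measurable functions of \<omega>, and path continuity gives the limit. Clipping comes after the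
  rounding, so all times used lie in \<open>{0..T}\<close>.\<close>

lemma continuous_process_measurable:
  fixes g :: "real \<Rightarrow> 'w \<Rightarrow> 'b::metric_space"
  assumes T: "0 \<le> T" and meas: "\<And>s. s \<in> {0..T} \<Longrightarrow> g s \<in> borel_measurable M"
    and cont: "\<And>\<omega>. \<omega> \<in> space M \<Longrightarrow> continuous_on {0..T} (\<lambda>s. g s \<omega>)"
  shows "(\<lambda>(s, \<omega>). g (clip 0 T s) \<omega>) \<in> borel_measurable (borel \<Otimes>\<^sub>M M)"
proof -
  define h where "h n x = g (clip 0 T (of_int \<lfloor>real n * fst x\<rfloor> / real n)) (snd x)" for n :: nat and x
  have meas_h: "h n \<in> borel_measurable (borel \<Otimes>\<^sub>M M)" for n
    unfolding h_def
  proof (rule measurable_compose_countable[where f="\<lambda>i x. g (clip 0 T (of_int i / real n)) (snd x)"])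
    show "(\<lambda>x. g (clip 0 T (of_int i / real n)) (snd x)) \<in> borel_measurable (borel \<Otimes>\<^sub>M M)" for i :: int
      using T by (intro measurable_compose[OF measurable_snd meas]) auto
    show "(\<lambda>x. \<lfloor>real n * fst x\<rfloor>) \<in> borel \<Otimes>\<^sub>M M \<rightarrow>\<^sub>M count_space UNIV" by measurable
  qed
  show ?thesis
  proof (rule borel_measurable_LIMSEQ_metric[OF meas_h])
    fix x :: "real \<times> 'w" assume x: "x \<in> space (borel \<Otimes>\<^sub>M M)"
    obtain s \<omega> where [simp]: "x = (s, \<omega>)" by force
    have \<omega>: "\<omega> \<in> space M" using x by (auto simp: space_pair_measure)
    have "(\<lambda>n. of_int \<lfloor>real n * s\<rfloor> / real n) \<longlonglongrightarrow> s"
    proof (rule tendsto_sandwich)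
      show "\<forall>\<^sub>F n in sequentially. s - 1 / real n \<le> of_int \<lfloor>real n * s\<rfloor> / real n"
        using eventually_gt_at_top[of 0]
      proof eventually_elim
        case (elim n)
        have "(real n * s - 1) / real n \<le> of_int \<lfloor>real n * s\<rfloor> / real n"
          by (intro divide_right_mono) linarith+
        then show ?case using elim by (simp add: diff_divide_distrib)
      qed
      show "\<forall>\<^sub>F n in sequentially. of_int \<lfloor>real n * s\<rfloor> / real n \<le> s"
        using eventually_gt_at_top[of 0]
        by eventually_elim (simp add: pos_divide_le_eq mult.commute)
      show "(\<lambda>n. s - 1 / real n) \<longlonglongrightarrow> s"
        using tendsto_diff[OF tendsto_const[of s] lim_1_over_n] by simp
    qed auto
    then have lim: "(\<lambda>n. clip 0 T (of_int \<lfloor>real n * s\<rfloor> / real n)) \<longlonglongrightarrow> clip 0 T s"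
      by (intro tendsto_max tendsto_min tendsto_const)
    show "(\<lambda>n. h n x) \<longlonglongrightarrow> (\<lambda>(s, \<omega>). g (clip 0 T s) \<omega>) x"
      unfolding h_def using T
      by (simp, intro continuous_on_tendsto_compose[OF cont[OF \<omega>] lim]) auto
  qed
qed

lemma continuous_map_integral:
  fixes f :: "'a::topological_space \<Rightarrow> real"
  assumes "continuous_on UNIV f" "bounded (range f)"
  shows "continuous_map weak_topology euclideanreal (\<lambda>m. \<integral>x. f x \<partial>m)"
  unfolding continuous_map_def topspace_weak_topology
  using openin_weak_topology_Basis[OF assms] by auto

lemma continuous_adapted_integral:
  fixes f :: "'a::topological_space \<Rightarrow> real"
  assumes \<mu>: "continuous_adapted M G T \<mu>"
    and f: "continuous_on UNIV f" "bounded (range f)"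
  shows "t \<in> {0..T} \<Longrightarrow> (\<lambda>\<omega>. \<integral>x. f x \<partial>\<mu> t \<omega>) \<in> borel_measurable (G t)"
    and "\<omega> \<in> space M \<Longrightarrow> continuous_on {0..T} (\<lambda>t. \<integral>x. f x \<partial>\<mu> t \<omega>)"
proof -
  show "t \<in> {0..T} \<Longrightarrow> (\<lambda>\<omega>. \<integral>x. f x \<partial>\<mu> t \<omega>) \<in> borel_measurable (G t)"
    using \<mu> unfolding continuous_adapted_def
    by (auto intro: measurable_compose[OF _ borel_measurable_integral_continuous[OF f]])
  assume "\<omega> \<in> space M"
  then have "continuous_map (top_of_set {0..T}) weak_topology (\<lambda>t. \<mu> t \<omega>)"
    using \<mu> by (auto simp: continuous_adapted_def)
  from continuous_map_compose[OF this continuous_map_integral[OF f]]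
  show "continuous_on {0..T} (\<lambda>t. \<integral>x. f x \<partial>\<mu> t \<omega>)" by (simp add: o_def)
qed

text \<open>Kernel measurability reduces to the real processes obtained by integrating one bounded
  continuous \<open>f\<close>; these are continuous in time and measurable in \<omega>.\<close>

lemma continuous_adapted_jointly_measurable:
  fixes \<mu> :: "real \<Rightarrow> 'w \<Rightarrow> 'a::{metric_space, second_countable_topology} measure"
  assumes T: "0 \<le> T" and \<mu>: "continuous_adapted M G T \<mu>"
    and G: "\<And>t. t \<in> {0..T} \<Longrightarrow> subalgebra M (G t)"
  shows "(\<lambda>(s, \<omega>). \<mu> (clip 0 T s) \<omega>) \<in> borel \<Otimes>\<^sub>M M \<rightarrow>\<^sub>M prob_borel"
proof (rule measurable_prob_borelI)
  fix x :: "real \<times> 'w" assume "x \<in> space (borel \<Otimes>\<^sub>M M)"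
  moreover have "\<mu> s \<omega> \<in> space prob_borel" if "s \<in> {0..T}" "\<omega> \<in> space M" for s \<omega>
    using \<mu> G[OF that(1)] that
    by (auto simp: continuous_adapted_def space_weak_borel[symmetric] subalgebra_def
        dest!: bspec[of _ _ s] intro: measurable_space)
  ultimately show "(case x of (s, \<omega>) \<Rightarrow> \<mu> (clip 0 T s) \<omega>) \<in> space prob_borel"
    using T by (auto simp: space_pair_measure)
next
  fix f :: "'a \<Rightarrow> real" assume f: "continuous_on UNIV f" "bounded (range f)"
  have "(\<lambda>(s, \<omega>). \<integral>y. f y \<partial>\<mu> (clip 0 T s) \<omega>) \<in> borel_measurable (borel \<Otimes>\<^sub>M M)"
  proof (rule continuous_process_measurable[OF T])
    fix s assume s: "s \<in> {0..T}"
    show "(\<lambda>\<omega>. \<integral>y. f y \<partial>\<mu> s \<omega>) \<in> borel_measurable M"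
      by (rule measurable_from_subalg[OF G[OF s] continuous_adapted_integral(1)[OF \<mu> f s]])
  qed (rule continuous_adapted_integral(2)[OF \<mu> f])
  then show "(\<lambda>x. \<integral>y. f y \<partial>(case x of (s, \<omega>) \<Rightarrow> \<mu> (clip 0 T s) \<omega>)) \<in> borel_measurable (borel \<Otimes>\<^sub>M M)"
    by (simp add: case_prod_unfold)
qed

section \<open>Increments of Brownian motion\<close>

lemma borel_measurable_vec_nth_compose[measurable (raw)]:
  fixes f :: "'a \<Rightarrow> real^'n::finite"
  assumes "f \<in> borel_measurable N"
  shows "(\<lambda>x. f x $ i) \<in> borel_measurable N"
  by (rule measurable_compose[OF assms borel_measurable_continuous_onI]) (intro continuous_intros)

lemma integrable_mult_square_integrable:
  fixes f g :: "'a \<Rightarrow> real"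
  assumes [measurable]: "f \<in> borel_measurable N" "g \<in> borel_measurable N"
    and "integrable N (\<lambda>x. (f x)\<^sup>2)" "integrable N (\<lambda>x. (g x)\<^sup>2)"
  shows "integrable N (\<lambda>x. f x * g x)"
proof (rule Bochner_Integration.integrable_bound)
  show "integrable N (\<lambda>x. (f x)\<^sup>2 + (g x)\<^sup>2)" using assms by simp
  have "\<bar>a * b\<bar> \<le> a\<^sup>2 + b\<^sup>2" for a b :: real
  proof -
    have "2 * \<bar>a * b\<bar> \<le> a\<^sup>2 + b\<^sup>2"
      using sum_squares_bound[of "\<bar>a\<bar>" "\<bar>b\<bar>"] by (simp add: abs_mult)
    then show ?thesis by (smt (verit) abs_ge_zero)
  qed
  then show "AE x in N. norm (f x * g x) \<le> norm ((f x)\<^sup>2 + (g x)\<^sup>2)" by auto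
qed simp

lemma integrable_add_squared:
  fixes f g :: "'a \<Rightarrow> real"
  assumes [measurable]: "f \<in> borel_measurable N" "g \<in> borel_measurable N"
    and "integrable N (\<lambda>x. (f x)\<^sup>2)" "integrable N (\<lambda>x. (g x)\<^sup>2)"
  shows "integrable N (\<lambda>x. (f x + g x)\<^sup>2)"
  using integrable_mult_square_integrable[OF assms] assms by (simp add: power2_sum mult.assoc)

lemma integrable_mult_bounded:
  fixes f g :: "'a \<Rightarrow> real"
  assumes [measurable]: "f \<in> borel_measurable N" "integrable N g" and "\<And>x. x \<in> space N \<Longrightarrow> \<bar>f x\<bar> \<le> C"
  shows "integrable N (\<lambda>x. f x * g x)"
proof (rule Bochner_Integration.integrable_bound)
  show "integrable N (\<lambda>x. C * g x)" using assms by simp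
  have "\<bar>f x * g x\<bar> \<le> \<bar>C * g x\<bar>" if "x \<in> space N" for x
    unfolding abs_mult using assms(3)[OF that] by (intro mult_right_mono) auto
  then show "AE x in N. norm (f x * g x) \<le> norm (C * g x)" by auto
  show "(\<lambda>x. f x * g x) \<in> borel_measurable N" using assms by measurable
qed

lemma has_bochner_integral_pair_mult:
  fixes g h :: "_ \<Rightarrow> real"
  assumes "pair_sigma_finite M1 M2" and g: "integrable M1 g" and h: "integrable M2 h"
  shows "has_bochner_integral (M1 \<Otimes>\<^sub>M M2) (\<lambda>(x, y). g x * h y) ((\<integral>x. g x \<partial>M1) * (\<integral>y. h y \<partial>M2))"
proof -
  interpret pair_sigma_finite M1 M2 by fact
  have [measurable]: "g \<in> borel_measurable M1" "h \<in> borel_measurable M2" using g h by auto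
  have "integrable (M1 \<Otimes>\<^sub>M M2) (\<lambda>(x, y). g x * h y)"
    by (rule Fubini_integrable) (use g h in \<open>auto simp: abs_mult\<close>)
  moreover from integral_fst'[OF this]
  have "(\<integral>z. (case z of (x, y) \<Rightarrow> g x * h y) \<partial>(M1 \<Otimes>\<^sub>M M2)) = (\<integral>x. g x \<partial>M1) * (\<integral>y. h y \<partial>M2)"
    by simp
  ultimately show ?thesis by (simp add: has_bochner_integral_iff)
qed

text \<open>Cauchy-Schwarz twice: once for the sum, once for the sum of the squares.\<close>

lemma sum_power4_le:
  fixes x :: "'a \<Rightarrow> real"
  assumes "finite A"
  shows "(\<Sum>i\<in>A. x i) ^ 4 \<le> real (card A) ^ 3 * (\<Sum>i\<in>A. x i ^ 4)"
proof -
  have "(\<Sum>i\<in>A. x i) ^ 4 = ((\<Sum>i\<in>A. x i)\<^sup>2)\<^sup>2" by (simp flip: power_mult)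
  also have "\<dots> \<le> ((\<Sum>i\<in>A. (x i)\<^sup>2) * real (card A))\<^sup>2"
    using sum_squared_le_sum_of_squares[of x A] by (intro power_mono) (auto intro: sum_nonneg)
  also have "\<dots> = (\<Sum>i\<in>A. (x i)\<^sup>2)\<^sup>2 * (real (card A))\<^sup>2" by (simp add: power_mult_distrib)
  also have "\<dots> \<le> ((\<Sum>i\<in>A. ((x i)\<^sup>2)\<^sup>2) * real (card A)) * (real (card A))\<^sup>2"
    using sum_squared_le_sum_of_squares[of "\<lambda>i. (x i)\<^sup>2" A] by (intro mult_right_mono) auto
  also have "\<dots> = real (card A) ^ 3 * (\<Sum>i\<in>A. x i ^ 4)"
    by (simp add: power3_eq_cube power2_eq_square power4_eq_xxxx mult_ac)
  finally show ?thesis .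
qed

section \<open>Independence and moments of Brownian increments\<close>

locale filtered_brownian = prob_space M for M :: "'w measure" +
  fixes G :: "real \<Rightarrow> 'w measure" and T :: real and B :: "real \<Rightarrow> 'w \<Rightarrow> real^'d::finite"
  assumes T_pos: "0 < T"
    and filtered: "filtered_prob_space M G T"
    and brownian: "brownian_motion M G T B"
begin

lemma subalgebra_G: "t \<in> {0..T} \<Longrightarrow> subalgebra M (G t)"
  using filtered by (auto simp: filtered_prob_space_def)

lemma space_G: "t \<in> {0..T} \<Longrightarrow> space (G t) = space M"
  using subalgebra_G by (auto simp: subalgebra_def)

lemma measurable_G_M: "t \<in> {0..T} \<Longrightarrow> f \<in> G t \<rightarrow>\<^sub>M N \<Longrightarrow> f \<in> M \<rightarrow>\<^sub>M N"
  using measurable_from_subalg[OF subalgebra_G] .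

lemma measurable_G_mono:
  assumes "0 \<le> s" "s \<le> t" "t \<le> T" "f \<in> G s \<rightarrow>\<^sub>M N"
  shows "f \<in> G t \<rightarrow>\<^sub>M N"
proof (rule measurable_from_subalg[OF _ assms(4)])
  show "subalgebra (G t) (G s)"
    using filtered assms space_G[of s] space_G[of t] unfolding subalgebra_def filtered_prob_space_def by auto
qed

lemma B_measurable: "t \<in> {0..T} \<Longrightarrow> B t \<in> borel_measurable (G t)"
  using brownian by (auto simp: brownian_motion_def)

lemma B_measurable_M[measurable]: "t \<in> {0..T} \<Longrightarrow> B t \<in> borel_measurable M"
  using B_measurable measurable_G_M by blast

text \<open>The hypothesis on \<open>B\<close> is independence of \<open>G s\<close> from the
  \<sigma>-algebra of the increment. \<open>Y\<close> generates a part of the former, and a Borel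
  function of the increment a part of the latter.\<close>

lemma indep_var_increment:
  fixes g :: "real^'d \<Rightarrow> real"
  assumes st: "0 \<le> s" "s < t" "t \<le> T" and Y: "Y \<in> borel_measurable (G s)" and g: "g \<in> borel_measurable borel"
  shows "indep_var borel Y borel (\<lambda>\<omega>. g (B t \<omega> - B s \<omega>))"
  unfolding indep_var_eq
proof (intro conjI indep_setI)
  have [measurable]: "B t \<in> borel_measurable M" "B s \<in> borel_measurable M" "g \<in> borel_measurable borel"
    using st g by auto
  show YM: "random_variable borel Y" using measurable_G_M[OF _ Y] st by auto
  show gM: "random_variable borel (\<lambda>\<omega>. g (B t \<omega> - B s \<omega>))" by measurable
  show "sigma_sets (space M) {Y -` A \<inter> space M |A. A \<in> sets borel} \<subseteq> events"
    using YM by (intro sets.sigma_sets_subset) (auto intro: measurable_sets)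
  show "sigma_sets (space M) {(\<lambda>\<omega>. g (B t \<omega> - B s \<omega>)) -` A \<inter> space M |A. A \<in> sets borel} \<subseteq> events"
    using gM by (intro sets.sigma_sets_subset) (auto intro: measurable_sets)
  let ?V = "vimage_algebra (space M) (\<lambda>\<omega>. B t \<omega> - B s \<omega>) borel"
  have "sigma_sets (space M) {Y -` A \<inter> space M |A. A \<in> sets borel} \<subseteq> sets (G s)"
    using measurable_sets[OF Y] space_G[of s] st
    by (subst space_G[symmetric, of s], simp, intro sets.sigma_sets_subset) auto
  moreover have "sigma_sets (space M) {(\<lambda>\<omega>. g (B t \<omega> - B s \<omega>)) -` A \<inter> space M |A. A \<in> sets borel} \<subseteq> sets ?V"
  proof -
    have "(\<lambda>\<omega>. g (B t \<omega> - B s \<omega>)) -` A \<inter> space M \<in> sets ?V" if "A \<in> sets borel" for A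
    proof -
      have "(\<lambda>\<omega>. g (B t \<omega> - B s \<omega>)) -` A \<inter> space M = (\<lambda>\<omega>. B t \<omega> - B s \<omega>) -` (g -` A) \<inter> space M" by auto
      moreover have "g -` A \<in> sets borel" using measurable_sets[OF g that] by simp
      ultimately show ?thesis by (simp add: in_vimage_algebra)
    qed
    then have "sigma_sets (space ?V) {(\<lambda>\<omega>. g (B t \<omega> - B s \<omega>)) -` A \<inter> space M |A. A \<in> sets borel} \<subseteq> sets ?V"
      by (intro sets.sigma_sets_subset) auto
    then show ?thesis by simp
  qed
  moreover have "indep_set (sets (G s)) (sets ?V)"
    using brownian st unfolding brownian_motion_def by blast
  ultimately show "prob (a \<inter> c) = prob a * prob c"
    if "a \<in> sigma_sets (space M) {Y -` A \<inter> space M |A. A \<in> sets borel}"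
      "c \<in> sigma_sets (space M) {(\<lambda>\<omega>. g (B t \<omega> - B s \<omega>)) -` A \<inter> space M |A. A \<in> sets borel}" for a c
    using that by (blast intro: indep_setD)
qed

lemma increment_normal:
  assumes "0 \<le> s" "s < t" "t \<le> T"
  shows "distributed M lborel (\<lambda>\<omega>. B t \<omega> $ p - B s \<omega> $ p) (normal_density 0 (sqrt (t - s)))"
  using brownian assms unfolding brownian_motion_def by blast

lemma increment_moment_even:
  assumes "0 \<le> s" "s < t" "t \<le> T"
  shows "has_bochner_integral M (\<lambda>\<omega>. (B t \<omega> $ p - B s \<omega> $ p) ^ (2 * k)) (fact (2 * k) / ((2 / (t - s)) ^ k * fact k))"
  using normal_moment_even[of "sqrt (t - s)" 0 k] assms
    distributed_integrable[OF increment_normal[OF assms], of "\<lambda>x. x ^ (2 * k)" p]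
    distributed_integral[OF increment_normal[OF assms], of "\<lambda>x. x ^ (2 * k)" p]
  by (auto simp: has_bochner_integral_iff)

lemma increment_moment_1:
  assumes "0 \<le> s" "s < t" "t \<le> T"
  shows "has_bochner_integral M (\<lambda>\<omega>. B t \<omega> $ p - B s \<omega> $ p) 0"
  using normal_moment_nz_1[of "sqrt (t - s)" 0] assms
    distributed_integrable[OF increment_normal[OF assms], of "\<lambda>x. x" p]
    distributed_integral[OF increment_normal[OF assms], of "\<lambda>x. x" p]
  by (auto simp: has_bochner_integral_iff)

lemma increment_moment_4:
  assumes "0 \<le> s" "s \<le> t" "t \<le> T"
  shows "has_bochner_integral M (\<lambda>\<omega>. (B t \<omega> $ p - B s \<omega> $ p) ^ 4) (3 * (t - s)\<^sup>2)"
proof (cases "s = t")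
  case False
  then have "fact (2 * 2) / ((2 / (t - s)) ^ 2 * fact 2) = 3 * (t - s)\<^sup>2"
    by (simp add: fact_numeral power_divide)
  then show ?thesis using False increment_moment_even[of s t p 2] assms by simp
qed (auto simp: has_bochner_integral_iff)

lemma increment_covariance:
  assumes st: "0 \<le> s" "s < t" "t \<le> T"
  shows "has_bochner_integral M (\<lambda>\<omega>. (B t \<omega> $ p - B s \<omega> $ p) * (B t \<omega> $ q - B s \<omega> $ q)) (if p = q then t - s else 0)"
proof (cases "p = q")
  case True
  have "fact (2 * 1) / ((2 / (t - s)) ^ 1 * fact 1) = t - s" by (simp add: fact_numeral)
  with increment_moment_even[OF st, of p 1]
  have "has_bochner_integral M (\<lambda>\<omega>. (B t \<omega> $ p - B s \<omega> $ p) ^ (2 * 1)) (t - s)" by (simp only:)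
  then show ?thesis using True by (simp add: power2_eq_square)
next
  case False
  have "indep_vars (\<lambda>_. borel) (\<lambda>i \<omega>. B t \<omega> $ i - B s \<omega> $ i) UNIV"
    using brownian st unfolding brownian_motion_def by blast
  then have ind: "indep_vars (\<lambda>_. borel) (\<lambda>i \<omega>. B t \<omega> $ i - B s \<omega> $ i) {p, q}"
    by (rule indep_vars_subset) auto
  have int: "integrable M (\<lambda>\<omega>. B t \<omega> $ i - B s \<omega> $ i)" "(\<integral>\<omega>. B t \<omega> $ i - B s \<omega> $ i \<partial>M) = 0" for i
    using increment_moment_1[OF st, of i] by (auto simp: has_bochner_integral_iff)
  show ?thesis using indep_vars_lebesgue_integral[OF _ ind] indep_vars_integrable[OF _ ind] False int
    by (simp add: has_bochner_integral_iff)
qed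

lemma integral_increment:
  assumes st: "0 \<le> s" "s \<le> t" "t \<le> T" and Y: "Y \<in> borel_measurable (G s)" "integrable M Y"
  shows "has_bochner_integral M (\<lambda>\<omega>. Y \<omega> * (B t \<omega> $ p - B s \<omega> $ p)) 0"
\<comment> \<open>The Brownian hypotheses speak of \<open>s < t\<close>, but clipping a partition
  produces empty intervals. On these the increment vanishes identically.\<close>
proof (cases "s = t")
  case False
  then have st': "s < t" using st by simp
  have ind: "indep_var borel Y borel (\<lambda>\<omega>. (B t \<omega> - B s \<omega>) $ p)"
    using st st' Y by (intro indep_var_increment) auto
  show ?thesis
    using indep_var_lebesgue_integral[OF ind] indep_var_integrable[OF ind] Y increment_moment_1[of s t p] st st'
    by (simp add: has_bochner_integral_iff)
qed (auto simp: has_bochner_integral_iff)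

lemma integral_increment_product:
  assumes st: "0 \<le> s" "s \<le> t" "t \<le> T" and Y: "Y \<in> borel_measurable (G s)" "integrable M Y"
  shows "has_bochner_integral M (\<lambda>\<omega>. Y \<omega> * ((B t \<omega> $ p - B s \<omega> $ p) * (B t \<omega> $ q - B s \<omega> $ q)))
    (if p = q then (t - s) * (\<integral>\<omega>. Y \<omega> \<partial>M) else 0)"
proof (cases "s = t")
  case False
  then have st': "s < t" using st by simp
  have ind: "indep_var borel Y borel (\<lambda>\<omega>. (B t \<omega> - B s \<omega>) $ p * (B t \<omega> - B s \<omega>) $ q)"
    using st st' Y by (intro indep_var_increment) auto
  show ?thesis
    using indep_var_lebesgue_integral[OF ind] indep_var_integrable[OF ind] Y increment_covariance[of s t p q] st st'
    by (auto simp: has_bochner_integral_iff)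
qed (auto simp: has_bochner_integral_iff)

lemma integral_inner_increment:
  assumes st: "0 \<le> s" "s \<le> t" "t \<le> T" and Y: "Y \<in> borel_measurable (G s)" "integrable M Y"
  shows "has_bochner_integral M (\<lambda>\<omega>. Y \<omega> \<bullet> (B t \<omega> - B s \<omega>)) 0"
proof -
  have "has_bochner_integral M (\<lambda>\<omega>. Y \<omega> $ p * (B t \<omega> $ p - B s \<omega> $ p)) 0" for p
  proof (rule integral_increment[OF st])
    show "(\<lambda>\<omega>. Y \<omega> $ p) \<in> borel_measurable (G s)" using Y(1) by measurable
    show "integrable M (\<lambda>\<omega>. Y \<omega> $ p)"
      using integrable_inner_left[OF Y(2), of "axis p 1"] by (simp add: inner_axis)
  qed
  then have "has_bochner_integral M (\<lambda>\<omega>. \<Sum>p\<in>UNIV. Y \<omega> $ p * (B t \<omega> $ p - B s \<omega> $ p)) (\<Sum>p\<in>(UNIV::'d set). 0)"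
    by (intro has_bochner_integral_sum) auto
  then show ?thesis by (simp add: inner_vec_def)
qed

text \<open>In coordinates the square is a double sum of which only the diagonal survives, since
  distinct coordinates of the increment are uncorrelated. The bounded weight \<open>Z\<close> from
  the past is carried along because the isometry will be tested against second derivatives of
  \<open>f\<close> at the left end point.\<close>

lemma integral_inner_increment_squared:
  assumes st: "0 \<le> s" "s \<le> t" "t \<le> T" and Y: "Y \<in> borel_measurable (G s)" "\<And>\<omega>. \<omega> \<in> space M \<Longrightarrow> norm (Y \<omega>) \<le> K"
    and Z: "Z \<in> borel_measurable (G s)" "\<And>\<omega>. \<omega> \<in> space M \<Longrightarrow> \<bar>Z \<omega>\<bar> \<le> C"
  shows "has_bochner_integral M (\<lambda>\<omega>. Z \<omega> * (Y \<omega> \<bullet> (B t \<omega> - B s \<omega>))\<^sup>2) ((t - s) * (\<integral>\<omega>. Z \<omega> * (norm (Y \<omega>))\<^sup>2 \<partial>M))"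
proof -
  note [measurable] = Y(1) Z(1)
  have comp: "\<bar>Y \<omega> $ p\<bar> \<le> K" if "\<omega> \<in> space M" for \<omega> p
    using Y(2)[OF that] component_le_norm_cart[of "Y \<omega>" p] by linarith
  have s: "s \<in> {0..T}" using st by auto
  have meas: "(\<lambda>\<omega>. Z \<omega> * Y \<omega> $ p * Y \<omega> $ q) \<in> borel_measurable (G s)" for p q by measurable
  have int: "integrable M (\<lambda>\<omega>. Z \<omega> * Y \<omega> $ p * Y \<omega> $ q)" for p q
  proof (rule integrable_const_bound[of _ "C * K * K"])
    show "AE \<omega> in M. norm (Z \<omega> * Y \<omega> $ p * Y \<omega> $ q) \<le> C * K * K"
    proof (rule AE_I2)
      fix \<omega> assume w: "\<omega> \<in> space M"
      then have "0 \<le> C" "0 \<le> K" using Z(2)[OF w] Y(2)[OF w] norm_ge_zero[of "Y \<omega>"] by linarith+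
      then show "norm (Z \<omega> * Y \<omega> $ p * Y \<omega> $ q) \<le> C * K * K"
        using Z(2)[OF w] comp[OF w] by (auto simp: abs_mult intro!: mult_mono)
    qed
  qed (rule measurable_G_M[OF s meas])
  have "has_bochner_integral M (\<lambda>\<omega>. \<Sum>p\<in>UNIV. \<Sum>q\<in>UNIV. Z \<omega> * Y \<omega> $ p * Y \<omega> $ q * ((B t \<omega> $ p - B s \<omega> $ p) * (B t \<omega> $ q - B s \<omega> $ q)))
     (\<Sum>p\<in>UNIV. \<Sum>q\<in>UNIV. if p = q then (t - s) * (\<integral>\<omega>. Z \<omega> * Y \<omega> $ p * Y \<omega> $ q \<partial>M) else 0)"
    by (intro has_bochner_integral_sum integral_increment_product st meas int)
  moreover have "(\<Sum>p\<in>UNIV. \<Sum>q\<in>UNIV. if p = q then (t - s) * (\<integral>\<omega>. Z \<omega> * Y \<omega> $ p * Y \<omega> $ q \<partial>M) else 0)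
     = (t - s) * (\<integral>\<omega>. (\<Sum>p\<in>UNIV. Z \<omega> * Y \<omega> $ p * Y \<omega> $ p) \<partial>M)"
    using int by (simp add: sum_distrib_left)
  moreover have "(\<Sum>p\<in>UNIV. Z \<omega> * Y \<omega> $ p * Y \<omega> $ p) = Z \<omega> * (norm (Y \<omega>))\<^sup>2" for \<omega>
    unfolding power2_norm_eq_inner inner_vec_def by (simp add: sum_distrib_left mult.assoc)
  moreover have "(\<Sum>p\<in>UNIV. \<Sum>q\<in>UNIV. Z \<omega> * Y \<omega> $ p * Y \<omega> $ q * ((B t \<omega> $ p - B s \<omega> $ p) * (B t \<omega> $ q - B s \<omega> $ q)))
     = Z \<omega> * (Y \<omega> \<bullet> (B t \<omega> - B s \<omega>))\<^sup>2" for \<omega>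
    unfolding power2_eq_square inner_vec_def sum_product by (simp add: sum_distrib_left mult_ac)
  ultimately show ?thesis by simp
qed

end

section \<open>Integrals of simple processes\<close>

text \<open>The simple process restricted to \<open>{u<..v}\<close>. The coefficient is reset to \<open>0\<close> on degenerate
  intervals because clipping may move \<open>\<tau> i\<close> to the left, where \<open>\<xi> i\<close> need not be measurable.\<close>

definition clip_coeff :: "(nat \<Rightarrow> real) \<Rightarrow> (nat \<Rightarrow> 'w \<Rightarrow> 'b::zero) \<Rightarrow> real \<Rightarrow> real \<Rightarrow> nat \<Rightarrow> 'w \<Rightarrow> 'b" where
  "clip_coeff \<tau> \<xi> u v i \<omega> = (if clip u v (\<tau> i) < clip u v (\<tau> (Suc i)) then \<xi> i \<omega> else 0)"

lemma simple_data_SucD: "simple_data G T (Suc n) \<tau> \<xi> \<Longrightarrow> simple_data G T n \<tau> \<xi>"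
  by (auto simp: simple_data_def)

lemma simple_data_mono:
  assumes "simple_data G T n \<tau> \<xi>" "i \<le> j" "j \<le> n"
  shows "\<tau> i \<le> \<tau> j"
  using assms(2,3)
proof (induction rule: dec_induct)
  case (step k)
  then have "\<tau> k \<le> \<tau> (Suc k)" using assms(1) by (auto simp: simple_data_def)
  then show ?case using step by auto
qed simp

text \<open>Clipping both end points intersects the interval with \<open>{u<..v}\<close>. The
  intersection is empty exactly when the clipped points coincide, and there
  \<open>clip_coeff\<close> is 0.\<close>

lemma simple_process_clip:
  assumes "simple_data G T n \<tau> \<xi>" "u \<le> v"
  shows "simple_process n (\<lambda>i. clip u v (\<tau> i)) (clip_coeff \<tau> \<xi> u v) s \<omega>
     = indicator {u<..v} s *\<^sub>R simple_process n \<tau> \<xi> s \<omega>"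
  unfolding simple_process_def scaleR_sum_right
proof (rule sum.cong[OF refl])
  fix i assume "i \<in> {..<n}"
  then have "\<tau> i \<le> \<tau> (Suc i)" using assms(1) by (auto simp: simple_data_def)
  then show "indicat_real {clip u v (\<tau> i)<..clip u v (\<tau> (Suc i))} s *\<^sub>R clip_coeff \<tau> \<xi> u v i \<omega> =
         indicat_real {u<..v} s *\<^sub>R indicat_real {\<tau> i<..\<tau> (Suc i)} s *\<^sub>R \<xi> i \<omega>"
    using assms(2) by (auto simp: clip_coeff_def indicator_def max_def min_def split: if_splits)
qed

text \<open>The intervals are disjoint, so at each time at most one summand is nonzero and no cross
  terms arise.\<close>

lemma norm_simple_process_squared:
  assumes "simple_data G T n \<tau> \<xi>"
  shows "(norm (simple_process n \<tau> \<xi> s \<omega>))\<^sup>2 = (\<Sum>i<n. indicator {\<tau> i<..\<tau> (Suc i)} s * (norm (\<xi> i \<omega>))\<^sup>2)"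
  using assms
proof (induction n)
  case (Suc n)
  have IH: "(norm (simple_process n \<tau> \<xi> s \<omega>))\<^sup>2 = (\<Sum>i<n. indicator {\<tau> i<..\<tau> (Suc i)} s * (norm (\<xi> i \<omega>))\<^sup>2)"
    using Suc simple_data_SucD by blast
  show ?case
  proof (cases "s \<in> {\<tau> n<..\<tau> (Suc n)}")
    case True
    have "s \<notin> {\<tau> i<..\<tau> (Suc i)}" if "i < n" for i
      using simple_data_mono[OF Suc.prems, of "Suc i" n] that True by auto
    then show ?thesis using True by (simp add: simple_process_def)
  next
    case False
    then show ?thesis using IH by (simp add: simple_process_def)
  qed
qed (simp add: simple_process_def)

section \<open>Clipping, isometry and fourth moments of simple integrals\<close>

context filtered_brownian
begin

lemma simple_data_clip:
  assumes D: "simple_data G T n \<tau> \<xi>" and uv: "0 \<le> u" "u \<le> v" "v \<le> T"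
  shows "simple_data G T n (\<lambda>i. clip u v (\<tau> i)) (clip_coeff \<tau> \<xi> u v)"
  unfolding simple_data_def
proof (intro conjI allI impI)
  fix i
  show "i \<le> n \<Longrightarrow> clip u v (\<tau> i) \<in> {0..T}" using uv by auto
  assume i: "i < n"
  have \<tau>: "\<tau> i \<in> {0..T}" "\<tau> i \<le> \<tau> (Suc i)" and meas: "\<xi> i \<in> borel_measurable (G (\<tau> i))"
    and bdd: "bounded (\<xi> i ` space (G (\<tau> i)))"
    using D i by (auto simp: simple_data_def)
  show "clip u v (\<tau> i) \<le> clip u v (\<tau> (Suc i))" using \<tau>(2) by auto
  show "clip_coeff \<tau> \<xi> u v i \<in> borel_measurable (G (clip u v (\<tau> i)))"
  proof (cases "clip u v (\<tau> i) < clip u v (\<tau> (Suc i))")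
    case True
    \<comment> \<open>A nondegenerate clipped interval starts before \<open>v\<close>, so its left
      end point has not been moved to the left and \<open>\<xi> i\<close> is known there.\<close>
    then have "\<tau> i \<le> clip u v (\<tau> i)" using uv by auto
    then have "\<xi> i \<in> borel_measurable (G (clip u v (\<tau> i)))"
      using \<tau> uv by (intro measurable_G_mono[OF _ _ _ meas]) auto
    moreover have "clip_coeff \<tau> \<xi> u v i = \<xi> i" using True by (simp only: clip_coeff_def fun_eq_iff if_True simp_thms)
    ultimately show ?thesis by (simp only:)
  next
    case False
    then have "clip_coeff \<tau> \<xi> u v i = (\<lambda>_. 0)" by (simp only: clip_coeff_def fun_eq_iff if_False simp_thms)
    then show ?thesis by (simp only: borel_measurable_const)
  qed
  have "clip_coeff \<tau> \<xi> u v i ` space (G (clip u v (\<tau> i))) \<subseteq> insert 0 (\<xi> i ` space (G (\<tau> i)))"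
    using space_G[of "clip u v (\<tau> i)"] space_G[of "\<tau> i"] uv \<tau> by (auto simp: clip_coeff_def)
  then show "bounded (clip_coeff \<tau> \<xi> u v i ` space (G (clip u v (\<tau> i))))"
    using bdd by (meson bounded_insert bounded_subset)
qed

lemma simple_integral_T:
  assumes D: "simple_data G T n \<tau> \<xi>"
  shows "simple_integral B n \<tau> \<xi> T \<omega> = (\<Sum>i<n. \<xi> i \<omega> \<bullet> (B (\<tau> (Suc i)) \<omega> - B (\<tau> i) \<omega>))"
  unfolding simple_integral_def
proof (rule sum.cong[OF refl])
  fix i assume "i \<in> {..<n}"
  then have "\<tau> i \<in> {0..T}" "\<tau> (Suc i) \<in> {0..T}" using D by (auto simp: simple_data_def)
  then show "\<xi> i \<omega> \<bullet> (B (min (\<tau> (Suc i)) T) \<omega> - B (min (\<tau> i) T) \<omega>) = \<xi> i \<omega> \<bullet> (B (\<tau> (Suc i)) \<omega> - B (\<tau> i) \<omega>)"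
    by (simp add: min_def)
qed

text \<open>An increment over \<open>{u..v}\<close> is again a simple integral up to
  \<open>T\<close>, with a partition that starts no earlier than \<open>u\<close>. Moments therefore
  have to be computed at time \<open>T\<close> only.\<close>

lemma simple_integral_increment:
  assumes D: "simple_data G T n \<tau> \<xi>" and uv: "0 \<le> u" "u \<le> v" "v \<le> T"
  shows "simple_integral B n \<tau> \<xi> v \<omega> - simple_integral B n \<tau> \<xi> u \<omega>
    = simple_integral B n (\<lambda>i. clip u v (\<tau> i)) (clip_coeff \<tau> \<xi> u v) T \<omega>"
  unfolding simple_integral_T[OF simple_data_clip[OF D uv]]
  unfolding simple_integral_def sum_subtractf[symmetric]
proof (rule sum.cong[OF refl])
  fix i assume "i \<in> {..<n}"
  then have \<tau>: "\<tau> i \<le> \<tau> (Suc i)" using D by (auto simp: simple_data_def)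
  have *: "B (min x v) \<omega> - B (min x u) \<omega> = B (clip u v x) \<omega> - B u \<omega>" for x
    using uv by (auto simp: max_def min_def)
  have "\<xi> i \<omega> \<bullet> (B (min (\<tau> (Suc i)) v) \<omega> - B (min (\<tau> i) v) \<omega>) - \<xi> i \<omega> \<bullet> (B (min (\<tau> (Suc i)) u) \<omega> - B (min (\<tau> i) u) \<omega>)
    = \<xi> i \<omega> \<bullet> ((B (min (\<tau> (Suc i)) v) \<omega> - B (min (\<tau> (Suc i)) u) \<omega>) - (B (min (\<tau> i) v) \<omega> - B (min (\<tau> i) u) \<omega>))"
    by (simp add: inner_diff_right)
  also have "\<dots> = \<xi> i \<omega> \<bullet> (B (clip u v (\<tau> (Suc i))) \<omega> - B (clip u v (\<tau> i)) \<omega>)" unfolding * by simp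
  also have "\<dots> = clip_coeff \<tau> \<xi> u v i \<omega> \<bullet> (B (clip u v (\<tau> (Suc i))) \<omega> - B (clip u v (\<tau> i)) \<omega>)"
  proof (cases "clip u v (\<tau> i) < clip u v (\<tau> (Suc i))")
    case False
    then have "clip u v (\<tau> i) = clip u v (\<tau> (Suc i))" using \<tau> by auto
    then show ?thesis by simp
  qed (simp add: clip_coeff_def)
  finally show "\<xi> i \<omega> \<bullet> (B (min (\<tau> (Suc i)) v) \<omega> - B (min (\<tau> i) v) \<omega>) - \<xi> i \<omega> \<bullet> (B (min (\<tau> (Suc i)) u) \<omega> - B (min (\<tau> i) u) \<omega>)
    = clip_coeff \<tau> \<xi> u v i \<omega> \<bullet> (B (clip u v (\<tau> (Suc i))) \<omega> - B (clip u v (\<tau> i)) \<omega>)" .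
qed

lemma simple_integral_0:
  assumes D: "simple_data G T n \<tau> \<xi>"
  shows "simple_integral B n \<tau> \<xi> 0 \<omega> = 0"
  unfolding simple_integral_def
proof (rule sum.neutral, rule ballI)
  fix i assume "i \<in> {..<n}"
  then have "\<tau> i \<in> {0..T}" "\<tau> (Suc i) \<in> {0..T}" using D by (auto simp: simple_data_def)
  then show "\<xi> i \<omega> \<bullet> (B (min (\<tau> (Suc i)) 0) \<omega> - B (min (\<tau> i) 0) \<omega>) = 0" by (simp add: min_absorb2)
qed

lemma simple_data_bounded:
  assumes D: "simple_data G T n \<tau> \<xi>"
  shows "\<exists>K\<ge>0. \<forall>i<n. \<forall>\<omega>\<in>space M. norm (\<xi> i \<omega>) \<le> K"
proof -
  have "\<forall>i<n. \<exists>C. \<forall>\<omega>\<in>space M. norm (\<xi> i \<omega>) \<le> C"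
  proof (intro allI impI)
    fix i assume "i < n"
    then have "\<tau> i \<in> {0..T}" "bounded (\<xi> i ` space (G (\<tau> i)))" using D by (auto simp: simple_data_def)
    then show "\<exists>C. \<forall>\<omega>\<in>space M. norm (\<xi> i \<omega>) \<le> C" using space_G[of "\<tau> i"] by (auto simp: bounded_iff)
  qed
  then obtain C where C: "\<And>i \<omega>. i < n \<Longrightarrow> \<omega> \<in> space M \<Longrightarrow> norm (\<xi> i \<omega>) \<le> C i" by metis
  show ?thesis
  proof (intro exI[of _ "\<Sum>i<n. \<bar>C i\<bar>"] conjI allI impI ballI)
    fix i \<omega> assume "i < n" "\<omega> \<in> space M"
    then have "norm (\<xi> i \<omega>) \<le> C i" using C by auto
    also have "\<dots> \<le> \<bar>C i\<bar>" by simp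
    also have "\<dots> \<le> (\<Sum>i<n. \<bar>C i\<bar>)" using \<open>i < n\<close> by (intro member_le_sum) auto
    finally show "norm (\<xi> i \<omega>) \<le> (\<Sum>i<n. \<bar>C i\<bar>)" .
  qed (auto intro: sum_nonneg)
qed

lemma simple_data_measurable_M:
  assumes D: "simple_data G T n \<tau> \<xi>" and i: "i < n"
  shows "\<xi> i \<in> borel_measurable M"
proof (rule measurable_G_M)
  show "\<tau> i \<in> {0..T}" "\<xi> i \<in> borel_measurable (G (\<tau> i))" using D i by (auto simp: simple_data_def)
qed

text \<open>The value at \<open>T\<close> involves Brownian motion up to the last partition point
  only. This is what admits a partial sum as a weight from the past in the induction for the
  isometry.\<close>

lemma simple_integral_T_measurable:
  assumes "simple_data G T n \<tau> \<xi>"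
  shows "simple_integral B n \<tau> \<xi> T \<in> borel_measurable (G (\<tau> n))"
  using assms
proof (induction n)
  case (Suc n)
  note D = Suc.prems
  have D': "simple_data G T n \<tau> \<xi>" using D by (rule simple_data_SucD)
  have \<tau>: "0 \<le> \<tau> n" "\<tau> n \<le> \<tau> (Suc n)" "\<tau> (Suc n) \<le> T" using D by (auto simp: simple_data_def)
  have [measurable]: "simple_integral B n \<tau> \<xi> T \<in> borel_measurable (G (\<tau> (Suc n)))"
    using measurable_G_mono[OF \<tau> Suc.IH[OF D']] .
  have "\<xi> n \<in> borel_measurable (G (\<tau> n))" using D by (auto simp: simple_data_def)
  then have [measurable]: "\<xi> n \<in> borel_measurable (G (\<tau> (Suc n)))" using measurable_G_mono[OF \<tau>] by blast
  have [measurable]: "B (\<tau> (Suc n)) \<in> borel_measurable (G (\<tau> (Suc n)))" "B (\<tau> n) \<in> borel_measurable (G (\<tau> (Suc n)))"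
    using B_measurable[of "\<tau> (Suc n)"] measurable_G_mono[OF \<tau> B_measurable[of "\<tau> n"]] \<tau> by auto
  have "simple_integral B (Suc n) \<tau> \<xi> T = (\<lambda>\<omega>. simple_integral B n \<tau> \<xi> T \<omega> + \<xi> n \<omega> \<bullet> (B (\<tau> (Suc n)) \<omega> - B (\<tau> n) \<omega>))"
    using simple_integral_T[OF D] simple_integral_T[OF D'] by auto
  then show ?case by simp
qed (auto simp: simple_integral_def cong: measurable_cong)

text \<open>Clipping to \<open>{0..t}\<close> moves the last partition point to at most
  \<open>t\<close>, so the claim is a case of measurability at the last partition point.\<close>

lemma simple_integral_measurable:
  assumes D: "simple_data G T n \<tau> \<xi>" and t: "t \<in> {0..T}"
  shows "simple_integral B n \<tau> \<xi> t \<in> borel_measurable (G t)"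
proof -
  have t': "0 \<le> (0::real)" "0 \<le> t" "t \<le> T" using t by auto
  have "\<tau> n \<in> {0..T}" using D by (auto simp: simple_data_def)
  then have "simple_integral B n (\<lambda>i. clip 0 t (\<tau> i)) (clip_coeff \<tau> \<xi> 0 t) T \<in> borel_measurable (G t)"
    using t by (intro measurable_G_mono[OF _ _ _ simple_integral_T_measurable[OF simple_data_clip[OF D t']]]) auto
  then show ?thesis
    using simple_integral_increment[OF D t'] simple_integral_0[OF D] by (simp cong: measurable_cong)
qed

lemma simple_integral_T_mean:
  assumes D: "simple_data G T n \<tau> \<xi>" and Z: "Z \<in> borel_measurable (G (\<tau> 0))" "integrable M Z"
  shows "has_bochner_integral M (\<lambda>\<omega>. Z \<omega> * simple_integral B n \<tau> \<xi> T \<omega>) 0"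
proof -
  obtain K where K: "\<And>i \<omega>. i < n \<Longrightarrow> \<omega> \<in> space M \<Longrightarrow> norm (\<xi> i \<omega>) \<le> K"
    using simple_data_bounded[OF D] by auto
  have "has_bochner_integral M (\<lambda>\<omega>. (Z \<omega> *\<^sub>R \<xi> i \<omega>) \<bullet> (B (\<tau> (Suc i)) \<omega> - B (\<tau> i) \<omega>)) 0" if i: "i < n" for i
  proof (rule integral_inner_increment)
    have \<tau>: "0 \<le> \<tau> 0" "\<tau> 0 \<le> \<tau> i" "\<tau> i \<le> \<tau> (Suc i)" "\<tau> (Suc i) \<le> T"
      using D i simple_data_mono[OF D, of 0 i] by (auto simp: simple_data_def)
    then show "0 \<le> \<tau> i" "\<tau> i \<le> \<tau> (Suc i)" "\<tau> (Suc i) \<le> T" by auto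
    have [measurable]: "\<xi> i \<in> borel_measurable (G (\<tau> i))" using D i by (auto simp: simple_data_def)
    have [measurable]: "Z \<in> borel_measurable (G (\<tau> i))" using \<tau> by (intro measurable_G_mono[OF _ _ _ Z(1)]) auto
    show m: "(\<lambda>\<omega>. Z \<omega> *\<^sub>R \<xi> i \<omega>) \<in> borel_measurable (G (\<tau> i))" by measurable
    show "integrable M (\<lambda>\<omega>. Z \<omega> *\<^sub>R \<xi> i \<omega>)"
    proof (rule Bochner_Integration.integrable_bound)
      show "integrable M (\<lambda>\<omega>. K * Z \<omega>)" using Z by simp
      show "(\<lambda>\<omega>. Z \<omega> *\<^sub>R \<xi> i \<omega>) \<in> borel_measurable M" using measurable_G_M[OF _ m] \<tau> by auto
      have "norm (Z \<omega> *\<^sub>R \<xi> i \<omega>) \<le> norm (K * Z \<omega>)" if "\<omega> \<in> space M" for \<omega>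
      proof -
        have "norm (Z \<omega> *\<^sub>R \<xi> i \<omega>) \<le> \<bar>Z \<omega>\<bar> * K" using K[OF i that] by (simp add: mult_left_mono)
        also have "\<dots> \<le> norm (K * Z \<omega>)" by (simp add: abs_mult mult.commute mult_right_mono)
        finally show ?thesis .
      qed
      then show "AE \<omega> in M. norm (Z \<omega> *\<^sub>R \<xi> i \<omega>) \<le> norm (K * Z \<omega>)" by auto
    qed
  qed
  then have "has_bochner_integral M (\<lambda>\<omega>. \<Sum>i<n. (Z \<omega> *\<^sub>R \<xi> i \<omega>) \<bullet> (B (\<tau> (Suc i)) \<omega> - B (\<tau> i) \<omega>)) (\<Sum>i<n. 0)"
    by (intro has_bochner_integral_sum) auto
  then show ?thesis by (simp add: simple_integral_T[OF D] sum_distrib_left)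
qed

text \<open>Induction over the intervals. The partial sum is known at \<open>\<tau> n\<close>, so
  its product with the next increment has mean zero, and the square of that increment contributes
  the new summand. The weight \<open>Z\<close> is known at the first partition point and hence at
  all of them.\<close>

lemma simple_integral_T_isometry_sum:
  assumes "simple_data G T n \<tau> \<xi>"
    and Z: "Z \<in> borel_measurable (G (\<tau> 0))" "\<And>\<omega>. \<omega> \<in> space M \<Longrightarrow> \<bar>Z \<omega>\<bar> \<le> C"
  shows "integrable M (\<lambda>\<omega>. (simple_integral B n \<tau> \<xi> T \<omega>)\<^sup>2) \<and>
    has_bochner_integral M (\<lambda>\<omega>. Z \<omega> * (simple_integral B n \<tau> \<xi> T \<omega>)\<^sup>2)
      (\<Sum>i<n. (\<tau> (Suc i) - \<tau> i) * (\<integral>\<omega>. Z \<omega> * (norm (\<xi> i \<omega>))\<^sup>2 \<partial>M))"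
  using assms(1)
proof (induction n)
  case (Suc n)
  note D = Suc.prems
  have D': "simple_data G T n \<tau> \<xi>" using D by (rule simple_data_SucD)
  obtain K where "\<forall>i<Suc n. \<forall>\<omega>\<in>space M. norm (\<xi> i \<omega>) \<le> K"
    using simple_data_bounded[OF D] by auto
  then have K: "\<And>\<omega>. \<omega> \<in> space M \<Longrightarrow> norm (\<xi> n \<omega>) \<le> K" by simp
  have \<tau>: "0 \<le> \<tau> n" "\<tau> n \<le> \<tau> (Suc n)" "\<tau> (Suc n) \<le> T" and \<tau>0: "0 \<le> \<tau> 0" "\<tau> 0 \<le> \<tau> n"
    using D simple_data_mono[OF D, of 0 n] by (auto simp: simple_data_def)
  have \<xi>[measurable]: "\<xi> n \<in> borel_measurable (G (\<tau> n))" using D by (auto simp: simple_data_def)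
  have Zn[measurable]: "Z \<in> borel_measurable (G (\<tau> n))" using \<tau> \<tau>0 by (intro measurable_G_mono[OF _ _ _ Z(1)]) auto
  let ?S = "simple_integral B n \<tau> \<xi> T" and ?D = "\<lambda>\<omega>. \<xi> n \<omega> \<bullet> (B (\<tau> (Suc n)) \<omega> - B (\<tau> n) \<omega>)"
  have S[measurable]: "?S \<in> borel_measurable (G (\<tau> n))" using simple_integral_T_measurable[OF D'] .
  have G_M: "f \<in> borel_measurable (G (\<tau> n)) \<Longrightarrow> f \<in> borel_measurable M" for f :: "'w \<Rightarrow> 'c::topological_space"
    using measurable_G_M[of "\<tau> n"] \<tau> by auto
  have "B (\<tau> (Suc n)) \<in> borel_measurable M" "B (\<tau> n) \<in> borel_measurable M" using \<tau> by auto
  then have DM[measurable]: "?D \<in> borel_measurable M"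
    by (intro borel_measurable_inner borel_measurable_diff G_M[OF \<xi>])
  have IH: "integrable M (\<lambda>\<omega>. (?S \<omega>)\<^sup>2)" "has_bochner_integral M (\<lambda>\<omega>. Z \<omega> * (?S \<omega>)\<^sup>2)
      (\<Sum>i<n. (\<tau> (Suc i) - \<tau> i) * (\<integral>\<omega>. Z \<omega> * (norm (\<xi> i \<omega>))\<^sup>2 \<partial>M))" using Suc.IH[OF D'] by auto
  have step: "has_bochner_integral M (\<lambda>\<omega>. Z \<omega> * (?D \<omega>)\<^sup>2) ((\<tau> (Suc n) - \<tau> n) * (\<integral>\<omega>. Z \<omega> * (norm (\<xi> n \<omega>))\<^sup>2 \<partial>M))"
    by (rule integral_inner_increment_squared[OF \<tau> \<xi> K Zn Z(2)])
  have D2: "integrable M (\<lambda>\<omega>. (?D \<omega>)\<^sup>2)"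
    using integral_inner_increment_squared[OF \<tau> \<xi> K, of "\<lambda>_. 1" 1] by (auto simp: has_bochner_integral_iff)
  have "has_bochner_integral M (\<lambda>\<omega>. (2 * Z \<omega> * ?S \<omega>) *\<^sub>R \<xi> n \<omega> \<bullet> (B (\<tau> (Suc n)) \<omega> - B (\<tau> n) \<omega>)) 0"
  proof (rule integral_inner_increment[OF \<tau>])
    show m: "(\<lambda>\<omega>. (2 * Z \<omega> * ?S \<omega>) *\<^sub>R \<xi> n \<omega>) \<in> borel_measurable (G (\<tau> n))" by measurable
    have "integrable M ?S"
      using G_M[OF S] IH(1) by (rule square_integrable_imp_integrable)
    then show "integrable M (\<lambda>\<omega>. (2 * Z \<omega> * ?S \<omega>) *\<^sub>R \<xi> n \<omega>)"
    proof (rule Bochner_Integration.integrable_bound[OF integrable_mult_right[of "2 * C * K"]])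
      show "(\<lambda>\<omega>. (2 * Z \<omega> * ?S \<omega>) *\<^sub>R \<xi> n \<omega>) \<in> borel_measurable M" using G_M[OF m] .
      have "norm ((2 * Z \<omega> * ?S \<omega>) *\<^sub>R \<xi> n \<omega>) \<le> norm (2 * C * K * ?S \<omega>)" if w: "\<omega> \<in> space M" for \<omega>
      proof -
        have "0 \<le> C" "0 \<le> K" using Z(2)[OF w] K[OF w] norm_ge_zero[of "\<xi> n \<omega>"] by linarith+
        then have "\<bar>Z \<omega>\<bar> * norm (\<xi> n \<omega>) \<le> C * K" using Z(2)[OF w] K[OF w] by (intro mult_mono) auto
        then have "2 * \<bar>?S \<omega>\<bar> * (\<bar>Z \<omega>\<bar> * norm (\<xi> n \<omega>)) \<le> 2 * \<bar>?S \<omega>\<bar> * (C * K)" by (intro mult_left_mono) auto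
        then show ?thesis using \<open>0 \<le> C\<close> \<open>0 \<le> K\<close> by (simp add: abs_mult mult_ac)
      qed
      then show "AE \<omega> in M. norm ((2 * Z \<omega> * ?S \<omega>) *\<^sub>R \<xi> n \<omega>) \<le> norm (2 * C * K * ?S \<omega>)" by auto
    qed
  qed
  then have cross: "has_bochner_integral M (\<lambda>\<omega>. 2 * Z \<omega> * ?S \<omega> * ?D \<omega>) 0" by simp
  have eq: "simple_integral B (Suc n) \<tau> \<xi> T \<omega> = ?S \<omega> + ?D \<omega>" for \<omega>
    using simple_integral_T[OF D] simple_integral_T[OF D'] by simp
  have "has_bochner_integral M (\<lambda>\<omega>. Z \<omega> * (?S \<omega>)\<^sup>2 + 2 * Z \<omega> * ?S \<omega> * ?D \<omega> + Z \<omega> * (?D \<omega>)\<^sup>2)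
    ((\<Sum>i<n. (\<tau> (Suc i) - \<tau> i) * (\<integral>\<omega>. Z \<omega> * (norm (\<xi> i \<omega>))\<^sup>2 \<partial>M)) + 0
       + (\<tau> (Suc n) - \<tau> n) * (\<integral>\<omega>. Z \<omega> * (norm (\<xi> n \<omega>))\<^sup>2 \<partial>M))"
    by (intro has_bochner_integral_add IH cross step)
  moreover have "Z \<omega> * (?S \<omega>)\<^sup>2 + 2 * Z \<omega> * ?S \<omega> * ?D \<omega> + Z \<omega> * (?D \<omega>)\<^sup>2 = Z \<omega> * (?S \<omega> + ?D \<omega>)\<^sup>2" for \<omega>
    by (simp add: power2_eq_square algebra_simps)
  moreover have "integrable M (\<lambda>\<omega>. (?S \<omega> + ?D \<omega>)\<^sup>2)"
    by (rule integrable_add_squared[OF G_M[OF S] DM IH(1) D2])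
  ultimately show ?case unfolding eq by simp
qed (auto simp: simple_integral_def has_bochner_integral_iff)

abbreviation time_product :: "(real \<times> 'w) measure" where
  "time_product \<equiv> lborel \<Otimes>\<^sub>M M"

lemma pair_sigma_finite_time_product: "pair_sigma_finite lborel M"
  unfolding pair_sigma_finite_def
  using prob_space_axioms prob_space_imp_sigma_finite sigma_finite_lborel by blast

lemma simple_process_measurable:
  assumes D: "simple_data G T n \<tau> \<xi>"
  shows "(\<lambda>(s, \<omega>). simple_process n \<tau> \<xi> s \<omega>) \<in> borel_measurable time_product"
proof -
  have "(\<lambda>x. indicator {\<tau> i<..\<tau> (Suc i)} (fst x) *\<^sub>R \<xi> i (snd x)) \<in> borel_measurable time_product" if "i < n" for i
  proof -
    have [measurable]: "\<xi> i \<in> borel_measurable M" by (rule simple_data_measurable_M[OF D that])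
    show ?thesis by measurable
  qed
  then show ?thesis unfolding simple_process_def case_prod_unfold by (intro borel_measurable_sum) auto
qed

text \<open>The sum over the intervals becomes an integral over time and \<Omega>. In this form the
  isometry no longer mentions the partition and can pass to limits of simple processes.\<close>

lemma simple_integral_T_isometry:
  assumes D: "simple_data G T n \<tau> \<xi>"
    and Z: "Z \<in> borel_measurable (G (\<tau> 0))" "\<And>\<omega>. \<omega> \<in> space M \<Longrightarrow> \<bar>Z \<omega>\<bar> \<le> C"
  shows "integrable M (\<lambda>\<omega>. (simple_integral B n \<tau> \<xi> T \<omega>)\<^sup>2)"
    and "integrable M (\<lambda>\<omega>. Z \<omega> * (simple_integral B n \<tau> \<xi> T \<omega>)\<^sup>2)"
    and "has_bochner_integral time_product (\<lambda>(s, \<omega>). Z \<omega> * (norm (simple_process n \<tau> \<xi> s \<omega>))\<^sup>2)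
      (\<integral>\<omega>. Z \<omega> * (simple_integral B n \<tau> \<xi> T \<omega>)\<^sup>2 \<partial>M)"
proof -
  note iso = simple_integral_T_isometry_sum[OF assms]
  show "integrable M (\<lambda>\<omega>. (simple_integral B n \<tau> \<xi> T \<omega>)\<^sup>2)"
    "integrable M (\<lambda>\<omega>. Z \<omega> * (simple_integral B n \<tau> \<xi> T \<omega>)\<^sup>2)"
    using iso by (auto simp: has_bochner_integral_iff)
  obtain K where K: "\<And>i \<omega>. i < n \<Longrightarrow> \<omega> \<in> space M \<Longrightarrow> norm (\<xi> i \<omega>) \<le> K" "0 \<le> K"
    using simple_data_bounded[OF D] by auto
  have "has_bochner_integral time_product (\<lambda>(s, \<omega>). indicator {\<tau> i<..\<tau> (Suc i)} s * (Z \<omega> * (norm (\<xi> i \<omega>))\<^sup>2))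
      ((\<tau> (Suc i) - \<tau> i) * (\<integral>\<omega>. Z \<omega> * (norm (\<xi> i \<omega>))\<^sup>2 \<partial>M))" if i: "i < n" for i
  proof -
    have \<tau>: "\<tau> i \<in> {0..T}" "\<tau> i \<le> \<tau> (Suc i)" "\<tau> 0 \<in> {0..T}" using D i by (auto simp: simple_data_def)
    have [measurable]: "\<xi> i \<in> borel_measurable M" "Z \<in> borel_measurable M"
      using simple_data_measurable_M[OF D i] measurable_G_M[OF \<tau>(3) Z(1)] by auto
    have int: "integrable M (\<lambda>\<omega>. Z \<omega> * (norm (\<xi> i \<omega>))\<^sup>2)"
    proof (rule integrable_mult_bounded[where C=C])
      show "integrable M (\<lambda>\<omega>. (norm (\<xi> i \<omega>))\<^sup>2)"
        by (rule integrable_const_bound[of _ "K\<^sup>2"]) (use K(1)[OF i] in \<open>auto intro!: AE_I2 power_mono\<close>)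
    qed (use Z(2) in auto)
    have "integrable lborel (indicator {\<tau> i<..\<tau> (Suc i)} :: real \<Rightarrow> real)" using \<tau> by simp
    from has_bochner_integral_pair_mult[OF pair_sigma_finite_time_product this int]
    show ?thesis using \<tau>(2) by simp
  qed
  then have "has_bochner_integral time_product (\<lambda>x. \<Sum>i<n. (case x of (s, \<omega>) \<Rightarrow> indicator {\<tau> i<..\<tau> (Suc i)} s * (Z \<omega> * (norm (\<xi> i \<omega>))\<^sup>2)))
      (\<Sum>i<n. (\<tau> (Suc i) - \<tau> i) * (\<integral>\<omega>. Z \<omega> * (norm (\<xi> i \<omega>))\<^sup>2 \<partial>M))"
    by (intro has_bochner_integral_sum) auto
  moreover have "(\<Sum>i<n. (\<tau> (Suc i) - \<tau> i) * (\<integral>\<omega>. Z \<omega> * (norm (\<xi> i \<omega>))\<^sup>2 \<partial>M))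
      = (\<integral>\<omega>. Z \<omega> * (simple_integral B n \<tau> \<xi> T \<omega>)\<^sup>2 \<partial>M)"
    using iso by (auto simp: has_bochner_integral_iff)
  moreover have "(\<lambda>x. \<Sum>i<n. (case x of (s, \<omega>) \<Rightarrow> indicator {\<tau> i<..\<tau> (Suc i)} s * (Z \<omega> * (norm (\<xi> i \<omega>))\<^sup>2)))
     = (\<lambda>(s, \<omega>). Z \<omega> * (norm (simple_process n \<tau> \<xi> s \<omega>))\<^sup>2)"
    unfolding norm_simple_process_squared[OF D] sum_distrib_left
    by (auto simp: fun_eq_iff mult.left_commute intro!: sum.cong)
  ultimately show "has_bochner_integral time_product (\<lambda>(s, \<omega>). Z \<omega> * (norm (simple_process n \<tau> \<xi> s \<omega>))\<^sup>2)
      (\<integral>\<omega>. Z \<omega> * (simple_integral B n \<tau> \<xi> T \<omega>)\<^sup>2 \<partial>M)" by simp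
qed

text \<open>A crude bound is enough: the integral is at most \<open>K\<close> times the sum of the
  absolute values of \<open>n * CARD('d)\<close> coordinate increments, the power inequality costs
  the cube of that number, and each fourth moment is at most \<open>3 * h\<^sup>2\<close>. Here
  \<open>n\<close> belongs to the simple process and stays fixed while the interval shrinks, so the
  bound is of second order in the interval length.\<close>

lemma simple_integral_T_power4:
  assumes D: "simple_data G T n \<tau> \<xi>" and K: "\<And>i \<omega>. i < n \<Longrightarrow> \<omega> \<in> space M \<Longrightarrow> norm (\<xi> i \<omega>) \<le> K"
    and h: "\<And>i. i < n \<Longrightarrow> \<tau> (Suc i) - \<tau> i \<le> h"
  shows "integrable M (\<lambda>\<omega>. simple_integral B n \<tau> \<xi> T \<omega> ^ 4)"
    and "(\<integral>\<omega>. simple_integral B n \<tau> \<xi> T \<omega> ^ 4 \<partial>M) \<le> 3 * K ^ 4 * real (n * CARD('d)) ^ 4 * h\<^sup>2"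
proof -
  let ?S = "simple_integral B n \<tau> \<xi> T" and ?c = "K ^ 4 * real (n * CARD('d)) ^ 3"
  let ?d = "\<lambda>\<omega> x. case x of (i, p) \<Rightarrow> B (\<tau> (Suc i)) \<omega> $ p - B (\<tau> i) \<omega> $ p"
  let ?I = "{..<n} \<times> (UNIV :: 'd set)"
  have mom: "has_bochner_integral M (\<lambda>\<omega>. ?d \<omega> x ^ 4) (3 * (\<tau> (Suc (fst x)) - \<tau> (fst x))\<^sup>2)" if "x \<in> ?I" for x
    using increment_moment_4[of "\<tau> (fst x)" "\<tau> (Suc (fst x))" "snd x"] that D by (auto simp: simple_data_def)
  have "has_bochner_integral M (\<lambda>\<omega>. ?c * (\<Sum>x\<in>?I. ?d \<omega> x ^ 4)) (?c * (\<Sum>x\<in>?I. 3 * (\<tau> (Suc (fst x)) - \<tau> (fst x))\<^sup>2))"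
    by (intro has_bochner_integral_mult_right has_bochner_integral_sum mom)
  then have dom: "integrable M (\<lambda>\<omega>. ?c * (\<Sum>x\<in>?I. ?d \<omega> x ^ 4))"
    "(\<integral>\<omega>. ?c * (\<Sum>x\<in>?I. ?d \<omega> x ^ 4) \<partial>M) = ?c * (\<Sum>x\<in>?I. 3 * (\<tau> (Suc (fst x)) - \<tau> (fst x))\<^sup>2)"
    by (auto simp: has_bochner_integral_iff)
  have le: "?S \<omega> ^ 4 \<le> ?c * (\<Sum>x\<in>?I. ?d \<omega> x ^ 4)" if w: "\<omega> \<in> space M" for \<omega>
  proof (cases "n = 0")
    case False
    then have K0: "K \<ge> 0" using K[of 0 \<omega>] w norm_ge_zero order_trans by blast
    have "\<bar>?S \<omega>\<bar> \<le> (\<Sum>i<n. \<bar>\<xi> i \<omega> \<bullet> (B (\<tau> (Suc i)) \<omega> - B (\<tau> i) \<omega>)\<bar>)"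
      unfolding simple_integral_T[OF D] by (rule sum_abs)
    also have "\<dots> \<le> (\<Sum>i<n. K * (\<Sum>p\<in>UNIV. \<bar>?d \<omega> (i, p)\<bar>))"
    proof (rule sum_mono)
      fix i assume "i \<in> {..<n}"
      then have "norm (\<xi> i \<omega>) \<le> K" using K w by auto
      moreover have "norm (B (\<tau> (Suc i)) \<omega> - B (\<tau> i) \<omega>) \<le> (\<Sum>p\<in>UNIV. \<bar>?d \<omega> (i, p)\<bar>)"
        using norm_le_l1_cart[of "B (\<tau> (Suc i)) \<omega> - B (\<tau> i) \<omega>"] by simp
      ultimately show "\<bar>\<xi> i \<omega> \<bullet> (B (\<tau> (Suc i)) \<omega> - B (\<tau> i) \<omega>)\<bar> \<le> K * (\<Sum>p\<in>UNIV. \<bar>?d \<omega> (i, p)\<bar>)"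
        using K0 by (intro order_trans[OF Cauchy_Schwarz_ineq2] mult_mono) auto
    qed
    also have "\<dots> = K * (\<Sum>x\<in>?I. \<bar>?d \<omega> x\<bar>)"
      by (simp add: sum_distrib_left sum.cartesian_product case_prod_unfold)
    finally have "\<bar>?S \<omega>\<bar> ^ 4 \<le> (K * (\<Sum>x\<in>?I. \<bar>?d \<omega> x\<bar>)) ^ 4" by (intro power_mono) auto
    also have "\<dots> = K ^ 4 * (\<Sum>x\<in>?I. \<bar>?d \<omega> x\<bar>) ^ 4" by (rule power_mult_distrib)
    also have "\<dots> \<le> K ^ 4 * (real (card ?I) ^ 3 * (\<Sum>x\<in>?I. \<bar>?d \<omega> x\<bar> ^ 4))"
      using K0 by (intro mult_left_mono sum_power4_le) auto
    finally show ?thesis by (simp add: power_even_abs card_cartesian_product)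
  qed (auto simp: simple_integral_def)
  have meas: "?S \<in> borel_measurable M"
    using D by (intro measurable_G_M[OF _ simple_integral_T_measurable[OF D]]) (auto simp: simple_data_def)
  have 4: "\<bar>x ^ 4\<bar> = x ^ 4" for x :: real by simp
  show int: "integrable M (\<lambda>\<omega>. ?S \<omega> ^ 4)"
  proof (rule Bochner_Integration.integrable_bound[OF dom(1)])
    show "AE \<omega> in M. norm (?S \<omega> ^ 4) \<le> norm (?c * (\<Sum>x\<in>?I. ?d \<omega> x ^ 4))"
    proof (rule AE_I2)
      fix \<omega> assume "\<omega> \<in> space M"
      from le[OF this] show "norm (?S \<omega> ^ 4) \<le> norm (?c * (\<Sum>x\<in>?I. ?d \<omega> x ^ 4))"
        unfolding real_norm_def 4 by (rule order_trans) (rule abs_ge_self)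
    qed
  qed (use meas in measurable)
  have "(\<integral>\<omega>. ?S \<omega> ^ 4 \<partial>M) \<le> ?c * (\<Sum>x\<in>?I. 3 * (\<tau> (Suc (fst x)) - \<tau> (fst x))\<^sup>2)"
    unfolding dom(2)[symmetric] by (rule integral_mono[OF int dom(1) le])
  also have "\<dots> \<le> ?c * (\<Sum>x\<in>?I. 3 * h\<^sup>2)"
    using h D by (intro mult_left_mono sum_mono power_mono) (auto simp: simple_data_def)
  also have "\<dots> = 3 * K ^ 4 * real (n * CARD('d)) ^ 4 * h\<^sup>2"
    by (simp add: card_cartesian_product power_numeral_reduce mult_ac)
  finally show "(\<integral>\<omega>. ?S \<omega> ^ 4 \<partial>M) \<le> 3 * K ^ 4 * real (n * CARD('d)) ^ 4 * h\<^sup>2" .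
qed

lemma simple_integral_increment_mean:
  assumes D: "simple_data G T n \<tau> \<xi>" and uv: "0 \<le> u" "u \<le> v" "v \<le> T"
    and Z: "Z \<in> borel_measurable (G u)" "integrable M Z"
  shows "has_bochner_integral M (\<lambda>\<omega>. Z \<omega> * (simple_integral B n \<tau> \<xi> v \<omega> - simple_integral B n \<tau> \<xi> u \<omega>)) 0"
  unfolding simple_integral_increment[OF D uv]
  using uv by (intro simple_integral_T_mean[OF simple_data_clip[OF D uv]] measurable_G_mono[OF _ _ _ Z(1)] Z(2)) auto

lemma simple_integral_increment_isometry:
  assumes D: "simple_data G T n \<tau> \<xi>" and uv: "0 \<le> u" "u \<le> v" "v \<le> T"
    and Z: "Z \<in> borel_measurable (G u)" "\<And>\<omega>. \<omega> \<in> space M \<Longrightarrow> \<bar>Z \<omega>\<bar> \<le> C"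
  shows "integrable M (\<lambda>\<omega>. (simple_integral B n \<tau> \<xi> v \<omega> - simple_integral B n \<tau> \<xi> u \<omega>)\<^sup>2)"
    and "has_bochner_integral time_product (\<lambda>(s, \<omega>). indicator {u<..v} s * Z \<omega> * (norm (simple_process n \<tau> \<xi> s \<omega>))\<^sup>2)
      (\<integral>\<omega>. Z \<omega> * (simple_integral B n \<tau> \<xi> v \<omega> - simple_integral B n \<tau> \<xi> u \<omega>)\<^sup>2 \<partial>M)"
proof -
  have "Z \<in> borel_measurable (G (clip u v (\<tau> 0)))"
    using uv by (intro measurable_G_mono[OF _ _ _ Z(1)]) auto
  note iso = simple_integral_T_isometry[OF simple_data_clip[OF D uv] this Z(2)]
  show "integrable M (\<lambda>\<omega>. (simple_integral B n \<tau> \<xi> v \<omega> - simple_integral B n \<tau> \<xi> u \<omega>)\<^sup>2)"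
    unfolding simple_integral_increment[OF D uv] by (rule iso(1)) simp
  have "(\<lambda>(s, \<omega>). indicator {u<..v} s * Z \<omega> * (norm (simple_process n \<tau> \<xi> s \<omega>))\<^sup>2)
     = (\<lambda>(s, \<omega>). Z \<omega> * (norm (simple_process n (\<lambda>i. clip u v (\<tau> i)) (clip_coeff \<tau> \<xi> u v) s \<omega>))\<^sup>2)"
    unfolding simple_process_clip[OF D uv(2)] by (auto simp: fun_eq_iff indicator_def)
  then show "has_bochner_integral time_product (\<lambda>(s, \<omega>). indicator {u<..v} s * Z \<omega> * (norm (simple_process n \<tau> \<xi> s \<omega>))\<^sup>2)
      (\<integral>\<omega>. Z \<omega> * (simple_integral B n \<tau> \<xi> v \<omega> - simple_integral B n \<tau> \<xi> u \<omega>)\<^sup>2 \<partial>M)"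
    unfolding simple_integral_increment[OF D uv] using iso(3) by simp
qed

lemma simple_integral_increment_power4:
  assumes D: "simple_data G T n \<tau> \<xi>"
  shows "\<exists>C. \<forall>u v. 0 \<le> u \<and> u \<le> v \<and> v \<le> T \<longrightarrow>
    integrable M (\<lambda>\<omega>. (simple_integral B n \<tau> \<xi> v \<omega> - simple_integral B n \<tau> \<xi> u \<omega>) ^ 4) \<and>
    (\<integral>\<omega>. (simple_integral B n \<tau> \<xi> v \<omega> - simple_integral B n \<tau> \<xi> u \<omega>) ^ 4 \<partial>M) \<le> C * (v - u)\<^sup>2"
proof -
  obtain K where K: "\<And>i \<omega>. i < n \<Longrightarrow> \<omega> \<in> space M \<Longrightarrow> norm (\<xi> i \<omega>) \<le> K" "0 \<le> K"
    using simple_data_bounded[OF D] by auto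
  show ?thesis
  proof (intro exI[of _ "3 * K ^ 4 * real (n * CARD('d)) ^ 4"] allI impI)
    fix u v assume "0 \<le> u \<and> u \<le> v \<and> v \<le> T"
    then have uv: "0 \<le> u" "u \<le> v" "v \<le> T" by auto
    have K': "norm (clip_coeff \<tau> \<xi> u v i \<omega>) \<le> K" if "i < n" "\<omega> \<in> space M" for i \<omega>
      using K(1)[OF that] K(2) unfolding clip_coeff_def by (cases "clip u v (\<tau> i) < clip u v (\<tau> (Suc i))") (simp_all only: if_True if_False norm_zero)
    have h: "clip u v (\<tau> (Suc i)) - clip u v (\<tau> i) \<le> v - u" for i using uv by auto
    show "integrable M (\<lambda>\<omega>. (simple_integral B n \<tau> \<xi> v \<omega> - simple_integral B n \<tau> \<xi> u \<omega>) ^ 4) \<and>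
      (\<integral>\<omega>. (simple_integral B n \<tau> \<xi> v \<omega> - simple_integral B n \<tau> \<xi> u \<omega>) ^ 4 \<partial>M) \<le> 3 * K ^ 4 * real (n * CARD('d)) ^ 4 * (v - u)\<^sup>2"
      unfolding simple_integral_increment[OF D uv]
      using simple_integral_T_power4[OF simple_data_clip[OF D uv] K' h] by auto
  qed
qed

end

section \<open>The Ito integral\<close>

text \<open>Young's inequality with a free parameter \<open>e\<close> bounds the difference of the
  squares by a multiple of the squared distance, which vanishes in the limit for fixed
  \<open>e\<close>, plus \<open>e\<close> times a fixed integrable function. Both sides of the
  isometry pass to the limit by this lemma.\<close>

lemma tendsto_integral_norm_squared:
  fixes f :: "nat \<Rightarrow> 'a \<Rightarrow> 'b::{real_inner, second_countable_topology}"
  assumes [measurable]: "\<And>n. f n \<in> borel_measurable N" "g \<in> borel_measurable N" "W \<in> borel_measurable N"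
    and f: "\<And>n. integrable N (\<lambda>x. (norm (f n x))\<^sup>2)" and g: "integrable N (\<lambda>x. (norm (g x))\<^sup>2)"
    and d: "\<And>n. integrable N (\<lambda>x. (norm (f n x - g x))\<^sup>2)"
    and lim: "(\<lambda>n. \<integral>x. (norm (f n x - g x))\<^sup>2 \<partial>N) \<longlonglongrightarrow> 0"
    and W: "\<And>x. x \<in> space N \<Longrightarrow> \<bar>W x\<bar> \<le> C"
  shows "(\<lambda>n. \<integral>x. W x * (norm (f n x))\<^sup>2 \<partial>N) \<longlonglongrightarrow> (\<integral>x. W x * (norm (g x))\<^sup>2 \<partial>N)"
proof -
  define C' where "C' = \<bar>C\<bar> + 1"
  have W': "\<bar>W x\<bar> \<le> C'" if "x \<in> space N" for x using W[OF that] by (auto simp: C'_def)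
  have C': "C' > 0" by (auto simp: C'_def)
  define F where "F = (\<integral>x. (norm (g x))\<^sup>2 \<partial>N)"
  have F: "F \<ge> 0" by (simp add: F_def)
  have Wf: "integrable N (\<lambda>x. W x * (norm (f n x))\<^sup>2)" for n by (rule integrable_mult_bounded[OF _ f W]) simp
  have Wg: "integrable N (\<lambda>x. W x * (norm (g x))\<^sup>2)" by (rule integrable_mult_bounded[OF _ g W]) simp
  have key: "\<bar>(norm a)\<^sup>2 - (norm b)\<^sup>2\<bar> \<le> (1 + 1 / e) * (norm (a - b))\<^sup>2 + e * (norm b)\<^sup>2" if e: "e > 0" for a b :: 'b and e
  proof -
    let ?x = "norm (a - b)" and ?y = "norm b"
    have "\<bar>(norm a)\<^sup>2 - (norm b)\<^sup>2\<bar> = \<bar>norm a - norm b\<bar> * (norm a + norm b)"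
      by (simp add: power2_eq_square square_diff_square_factored abs_mult mult.commute)
    also have "\<dots> \<le> ?x * (?x + 2 * ?y)"
      using norm_triangle_ineq3[of a b] norm_triangle_ineq2[of a b] by (intro mult_mono) auto
    also have "\<dots> = ?x\<^sup>2 + 2 * ?x * ?y" by (simp add: power2_eq_square algebra_simps)
    also have "\<dots> \<le> ?x\<^sup>2 + (1 / e * ?x\<^sup>2 + e * ?y\<^sup>2)"
    proof -
      have "0 \<le> (?x - e * ?y)\<^sup>2 / e" using e by simp
      also have "\<dots> = 1 / e * ?x\<^sup>2 + e * ?y\<^sup>2 - 2 * ?x * ?y" using e
        by (simp add: power2_eq_square field_simps)
      finally show ?thesis by simp
    qed
    finally show ?thesis by (simp add: algebra_simps)
  qed
  have bound: "\<bar>(\<integral>x. W x * (norm (f n x))\<^sup>2 \<partial>N) - (\<integral>x. W x * (norm (g x))\<^sup>2 \<partial>N)\<bar>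
      \<le> C' * (1 + 1 / e) * (\<integral>x. (norm (f n x - g x))\<^sup>2 \<partial>N) + C' * e * F" if e: "e > 0" for n e
  proof -
    have "\<bar>(\<integral>x. W x * (norm (f n x))\<^sup>2 \<partial>N) - (\<integral>x. W x * (norm (g x))\<^sup>2 \<partial>N)\<bar>
        = \<bar>\<integral>x. W x * (norm (f n x))\<^sup>2 - W x * (norm (g x))\<^sup>2 \<partial>N\<bar>" using Wf Wg by simp
    also have "\<dots> \<le> (\<integral>x. \<bar>W x * (norm (f n x))\<^sup>2 - W x * (norm (g x))\<^sup>2\<bar> \<partial>N)"
      by (rule integral_abs_bound)
    also have "\<dots> \<le> (\<integral>x. C' * (1 + 1 / e) * (norm (f n x - g x))\<^sup>2 + C' * e * (norm (g x))\<^sup>2 \<partial>N)"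
    proof (rule integral_mono)
      fix x assume x: "x \<in> space N"
      have "\<bar>W x * (norm (f n x))\<^sup>2 - W x * (norm (g x))\<^sup>2\<bar> = \<bar>W x\<bar> * \<bar>(norm (f n x))\<^sup>2 - (norm (g x))\<^sup>2\<bar>"
        by (simp add: abs_mult[symmetric] right_diff_distrib)
      also have "\<dots> \<le> C' * ((1 + 1 / e) * (norm (f n x - g x))\<^sup>2 + e * (norm (g x))\<^sup>2)"
        using W'[OF x] key[OF e] C' by (intro mult_mono) auto
      finally show "\<bar>W x * (norm (f n x))\<^sup>2 - W x * (norm (g x))\<^sup>2\<bar> \<le> C' * (1 + 1 / e) * (norm (f n x - g x))\<^sup>2 + C' * e * (norm (g x))\<^sup>2"
        by (simp add: algebra_simps)
    qed (use Wf Wg d g in auto)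
    also have "\<dots> = C' * (1 + 1 / e) * (\<integral>x. (norm (f n x - g x))\<^sup>2 \<partial>N) + C' * e * F"
      using d g by (simp add: F_def)
    finally show ?thesis .
  qed
  show ?thesis
  proof (rule LIMSEQ_I)
    fix r :: real assume r: "r > 0"
    \<comment> \<open>Chosen such that the second error term stays below \<open>r / 2\<close>;
      \<open>F + 1\<close> in place of \<open>F\<close> covers \<open>F = 0\<close>.\<close>
    define e where "e = r / (2 * C' * (F + 1))"
    have e: "e > 0" using r C' F by (auto simp: e_def)
    have e2: "C' * e * F < r / 2"
    proof -
      have "C' * e * F < C' * e * (F + 1)" using C' e by simp
      also have "\<dots> = r / 2"
      proof -
        define X where "X = 2 * C' * (F + 1)"
        have "X \<noteq> 0" using C' F by (auto simp: X_def)
        then have "e * X = r" unfolding e_def X_def[symmetric] by simp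
        then show ?thesis by (simp add: X_def algebra_simps)
      qed
      finally show ?thesis .
    qed
    have pos: "C' * (1 + 1 / e) > 0" using C' e by (simp add: add_pos_pos)
    have "(\<lambda>n. C' * (1 + 1 / e) * (\<integral>x. (norm (f n x - g x))\<^sup>2 \<partial>N)) \<longlonglongrightarrow> 0"
      using tendsto_mult_left[OF lim, of "C' * (1 + 1 / e)"] by simp
    then have "\<forall>\<^sub>F n in sequentially. C' * (1 + 1 / e) * (\<integral>x. (norm (f n x - g x))\<^sup>2 \<partial>N) < r / 2"
      using r by (intro order_tendstoD(2)) auto
    then obtain n0 where n0: "\<And>n. n \<ge> n0 \<Longrightarrow> C' * (1 + 1 / e) * (\<integral>x. (norm (f n x - g x))\<^sup>2 \<partial>N) < r / 2"
      by (auto simp: eventually_sequentially)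
    show "\<exists>no. \<forall>n\<ge>no. norm ((\<integral>x. W x * (norm (f n x))\<^sup>2 \<partial>N) - (\<integral>x. W x * (norm (g x))\<^sup>2 \<partial>N)) < r"
    proof (intro exI[of _ n0] allI impI)
      fix n assume "n \<ge> n0"
      then show "norm ((\<integral>x. W x * (norm (f n x))\<^sup>2 \<partial>N) - (\<integral>x. W x * (norm (g x))\<^sup>2 \<partial>N)) < r"
        using bound[OF e, of n] n0[of n] e2 unfolding real_norm_def by linarith
    qed
  qed
qed

text \<open>From squares to products by polarization with the constant 1: \<open>2 * h\<close> is
  \<open>(h + 1)\<^sup>2 - h\<^sup>2 - 1\<close>. On a finite measure the constant is square
  integrable.\<close>

lemma tendsto_integral_mult:
  fixes f :: "nat \<Rightarrow> 'a \<Rightarrow> real"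
  assumes "finite_measure N"
    and [measurable]: "\<And>n. f n \<in> borel_measurable N" "g \<in> borel_measurable N" "W \<in> borel_measurable N"
    and f: "\<And>n. integrable N (\<lambda>x. (f n x)\<^sup>2)" and g: "integrable N (\<lambda>x. (g x)\<^sup>2)"
    and d: "\<And>n. integrable N (\<lambda>x. (f n x - g x)\<^sup>2)"
    and lim: "(\<lambda>n. \<integral>x. (f n x - g x)\<^sup>2 \<partial>N) \<longlonglongrightarrow> 0"
    and W: "\<And>x. x \<in> space N \<Longrightarrow> \<bar>W x\<bar> \<le> C"
  shows "(\<lambda>n. \<integral>x. W x * f n x \<partial>N) \<longlonglongrightarrow> (\<integral>x. W x * g x \<partial>N)"
proof -
  interpret finite_measure N by fact
  have W1: "integrable N W" by (rule integrable_const_bound[of _ C]) (use W in auto)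
  have Wf2: "integrable N (\<lambda>x. W x * (h x)\<^sup>2)" "integrable N (\<lambda>x. W x * h x)"
    if [measurable]: "h \<in> borel_measurable N" and "integrable N (\<lambda>x. (h x)\<^sup>2)" for h :: "'a \<Rightarrow> real"
  proof -
    show "integrable N (\<lambda>x. W x * (h x)\<^sup>2)" by (rule integrable_mult_bounded[OF _ that(2) W]) simp
    have "integrable N h" using that by (rule square_integrable_imp_integrable)
    then show "integrable N (\<lambda>x. W x * h x)" by (rule integrable_mult_bounded[OF assms(4) _ W])
  qed
  have eq: "(\<integral>x. W x * h x \<partial>N) = ((\<integral>x. W x * (h x + 1)\<^sup>2 \<partial>N) - (\<integral>x. W x * (h x)\<^sup>2 \<partial>N) - (\<integral>x. W x \<partial>N)) / 2"
    if [measurable]: "h \<in> borel_measurable N" and h: "integrable N (\<lambda>x. (h x)\<^sup>2)" for h :: "'a \<Rightarrow> real"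
  proof -
    have "(\<integral>x. W x * (h x + 1)\<^sup>2 \<partial>N) = (\<integral>x. W x * (h x)\<^sup>2 + 2 * (W x * h x) + W x \<partial>N)"
      by (simp add: power2_eq_square algebra_simps)
    then show ?thesis using Wf2[OF that] W1 by simp
  qed
  have int1: "integrable N (\<lambda>x. (h x + 1)\<^sup>2)"
    if [measurable]: "h \<in> borel_measurable N" and h: "integrable N (\<lambda>x. (h x)\<^sup>2)" for h :: "'a \<Rightarrow> real"
    using h by (intro integrable_add_squared) auto
  have "(\<lambda>n. \<integral>x. W x * (norm (f n x + 1))\<^sup>2 \<partial>N) \<longlonglongrightarrow> (\<integral>x. W x * (norm (g x + 1))\<^sup>2 \<partial>N)"
    by (rule tendsto_integral_norm_squared[OF _ _ _ _ _ _ _ W]) (use f g d lim in \<open>auto intro: int1\<close>)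
  moreover have "(\<lambda>n. \<integral>x. W x * (norm (f n x))\<^sup>2 \<partial>N) \<longlonglongrightarrow> (\<integral>x. W x * (norm (g x))\<^sup>2 \<partial>N)"
    by (rule tendsto_integral_norm_squared[OF _ _ _ _ _ _ _ W]) (use f g d lim in auto)
  ultimately show ?thesis unfolding eq[OF assms(2) f] eq[OF assms(3) g]
    by (intro tendsto_intros) auto
qed

lemma tendsto_integral_of_nn_integral:
  fixes f :: "nat \<Rightarrow> 'a \<Rightarrow> real"
  assumes "\<And>n. integrable N (f n)" "\<And>n x. 0 \<le> f n x" "(\<lambda>n. \<integral>\<^sup>+x. ennreal (f n x) \<partial>N) \<longlonglongrightarrow> 0"
  shows "(\<lambda>n. \<integral>x. f n x \<partial>N) \<longlonglongrightarrow> 0"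
proof -
  have "(\<lambda>n. ennreal (\<integral>x. f n x \<partial>N)) \<longlonglongrightarrow> ennreal 0"
    using assms(3) by (simp add: nn_integral_eq_integral assms(1,2))
  then show ?thesis by (rule tendsto_ennrealD) (simp_all add: assms(2))
qed

text \<open>If \<open>\<bar>y\<bar> \<le> \<bar>x\<bar>\<close>, the first term suffices. Otherwise
  \<open>\<delta> < 2 * \<bar>y\<bar>\<close>, so the factor
  \<open>4 * y\<^sup>2 / \<delta>\<^sup>2\<close> is at least 1 and may be multiplied into
  \<open>(x + y)\<^sup>2 \<le> 4 * y\<^sup>2\<close>. The part \<open>x\<close> is then controlled
  by second moments and the part \<open>y\<close> by fourth moments.\<close>

lemma truncated_square_le:
  fixes x y \<delta> :: real
  assumes \<delta>: "\<delta> > 0"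
  shows "(if \<delta> < \<bar>x + y\<bar> then (x + y)\<^sup>2 else 0) \<le> 4 * x\<^sup>2 + 16 / \<delta>\<^sup>2 * y ^ 4"
proof (cases "\<delta> < \<bar>x + y\<bar>")
  case True
  have nonneg: "0 \<le> 4 * x\<^sup>2" "0 \<le> 16 / \<delta>\<^sup>2 * y ^ 4" by simp_all
  show ?thesis
  proof (cases "\<bar>y\<bar> \<le> \<bar>x\<bar>")
    case le: True
    have "\<bar>x + y\<bar> \<le> \<bar>2 * x\<bar>" using le by linarith
    then have "(x + y)\<^sup>2 \<le> (2 * x)\<^sup>2" by (simp only: abs_le_square_iff)
    then have "(x + y)\<^sup>2 \<le> 4 * x\<^sup>2" by (simp add: power_mult_distrib)
    then show ?thesis using nonneg unfolding if_P[OF True] by linarith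
  next
    case False
    then have 1: "\<delta> \<le> 2 * \<bar>y\<bar>" and 2: "\<bar>x + y\<bar> \<le> \<bar>2 * y\<bar>" using True by linarith+
    have "\<delta>\<^sup>2 \<le> (2 * \<bar>y\<bar>)\<^sup>2" using 1 \<delta> by (intro power_mono) simp_all
    then have "1 \<le> 4 * y\<^sup>2 / \<delta>\<^sup>2" using \<delta> by (simp add: power_mult_distrib)
    then have "4 * y\<^sup>2 * 1 \<le> 4 * y\<^sup>2 * (4 * y\<^sup>2 / \<delta>\<^sup>2)" by (intro mult_left_mono) simp_all
    also have "\<dots> = 16 / \<delta>\<^sup>2 * y ^ 4" by (simp add: power4_eq_xxxx power2_eq_square)
    finally have "4 * y\<^sup>2 \<le> 16 / \<delta>\<^sup>2 * y ^ 4" by simp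
    moreover have "(x + y)\<^sup>2 \<le> 4 * y\<^sup>2" using 2 by (simp add: abs_le_square_iff power_mult_distrib)
    ultimately show ?thesis using nonneg unfolding if_P[OF True] by linarith
  qed
qed simp

section \<open>Moments of Ito integrals by passage to the limit\<close>

context filtered_brownian
begin

text \<open>Joint measurability on \<open>{0..T}\<close> is progressive measurability at time
  \<open>T\<close>; composing with \<open>clip\<close> and cutting off by the indicator carries it
  to the whole time axis.\<close>

lemma progressive_measurable:
  assumes "progressive G T H"
  shows "(\<lambda>(s, \<omega>). indicator {0..T} s *\<^sub>R H s \<omega>) \<in> borel_measurable time_product"
proof -
  have T: "T \<in> {0..T}" using T_pos by auto
  have H: "(\<lambda>(s, \<omega>). H s \<omega>) \<in> borel_measurable (restrict_space borel {0..T} \<Otimes>\<^sub>M G T)"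
    using assms T unfolding progressive_def by blast
  have "(\<lambda>x. (clip 0 T (fst x), snd x)) \<in> time_product \<rightarrow>\<^sub>M restrict_space borel {0..T} \<Otimes>\<^sub>M G T"
  proof (rule measurable_Pair)
    show "(\<lambda>x. clip 0 T (fst x)) \<in> time_product \<rightarrow>\<^sub>M restrict_space borel {0..T}"
      using T_pos by (intro measurable_restrict_space2) auto
    have "(\<lambda>\<omega>. \<omega>) \<in> M \<rightarrow>\<^sub>M G T" by (rule measurable_G_M[OF T]) simp
    then show "snd \<in> time_product \<rightarrow>\<^sub>M G T" by (rule measurable_compose[OF measurable_snd])
  qed
  from measurable_compose[OF this H]
  have [measurable]: "(\<lambda>x. H (clip 0 T (fst x)) (snd x)) \<in> borel_measurable time_product" by simp
  have "(\<lambda>(s, \<omega>). indicator {0..T} s *\<^sub>R H s \<omega>) = (\<lambda>x. indicator {0..T} (fst x) *\<^sub>R H (clip 0 T (fst x)) (snd x))"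
    by (auto simp: fun_eq_iff indicator_def)
  then show ?thesis by simp
qed

lemma nn_integral_time_product:
  assumes "(\<lambda>(s, \<omega>). indicator A s * f s \<omega>) \<in> borel_measurable time_product"
  shows "(\<integral>\<^sup>+\<omega>. (\<integral>\<^sup>+s\<in>A. f s \<omega> \<partial>lborel) \<partial>M) = (\<integral>\<^sup>+x. (case x of (s, \<omega>) \<Rightarrow> indicator A s * f s \<omega>) \<partial>time_product)"
proof -
  interpret pair_sigma_finite lborel M by (rule pair_sigma_finite_time_product)
  show ?thesis using nn_integral_snd[OF assms] by (simp add: mult.commute)
qed

text \<open>The approximation that \<open>has_ito_integral\<close> states with nonnegative
  integrals, recast for integrable functions. \<open>H\<close> is cut off outside
  \<open>{0..T}\<close>, where the simple processes vanish anyway, so that both live on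
  \<open>time_product\<close>.\<close>

definition ito_approximation ::
  "(real \<Rightarrow> 'w \<Rightarrow> real^'d) \<Rightarrow> (real \<Rightarrow> 'w \<Rightarrow> real) \<Rightarrow> (nat \<Rightarrow> nat) \<Rightarrow> (nat \<Rightarrow> nat \<Rightarrow> real) \<Rightarrow> (nat \<Rightarrow> nat \<Rightarrow> 'w \<Rightarrow> real^'d) \<Rightarrow> bool"
where
  "ito_approximation H I N \<tau> \<xi> \<longleftrightarrow>
    (\<forall>n. simple_data G T (N n) (\<tau> n) (\<xi> n)) \<and>
    (\<forall>t\<in>{0..T}. integrable M (\<lambda>\<omega>. (I t \<omega>)\<^sup>2)) \<and>
    (\<forall>t\<in>{0..T}. \<forall>n. integrable M (\<lambda>\<omega>. (simple_integral B (N n) (\<tau> n) (\<xi> n) t \<omega> - I t \<omega>)\<^sup>2)) \<and>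
    (\<forall>t\<in>{0..T}. (\<lambda>n. \<integral>\<omega>. (simple_integral B (N n) (\<tau> n) (\<xi> n) t \<omega> - I t \<omega>)\<^sup>2 \<partial>M) \<longlonglongrightarrow> 0) \<and>
    integrable time_product (\<lambda>x. (norm (indicator {0..T} (fst x) *\<^sub>R H (fst x) (snd x)))\<^sup>2) \<and>
    (\<forall>n. integrable time_product (\<lambda>x. (norm (simple_process (N n) (\<tau> n) (\<xi> n) (fst x) (snd x)
        - indicator {0..T} (fst x) *\<^sub>R H (fst x) (snd x)))\<^sup>2)) \<and>
    (\<lambda>n. \<integral>x. (norm (simple_process (N n) (\<tau> n) (\<xi> n) (fst x) (snd x)
        - indicator {0..T} (fst x) *\<^sub>R H (fst x) (snd x)))\<^sup>2 \<partial>time_product) \<longlonglongrightarrow> 0"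

lemma ito_approximationD:
  assumes "ito_approximation H I N \<tau> \<xi>"
  shows "\<And>n. simple_data G T (N n) (\<tau> n) (\<xi> n)"
    and "\<And>t. t \<in> {0..T} \<Longrightarrow> integrable M (\<lambda>\<omega>. (I t \<omega>)\<^sup>2)"
    and "\<And>t n. t \<in> {0..T} \<Longrightarrow> integrable M (\<lambda>\<omega>. (simple_integral B (N n) (\<tau> n) (\<xi> n) t \<omega> - I t \<omega>)\<^sup>2)"
    and "\<And>t. t \<in> {0..T} \<Longrightarrow> (\<lambda>n. \<integral>\<omega>. (simple_integral B (N n) (\<tau> n) (\<xi> n) t \<omega> - I t \<omega>)\<^sup>2 \<partial>M) \<longlonglongrightarrow> 0"
    and "integrable time_product (\<lambda>x. (norm (indicator {0..T} (fst x) *\<^sub>R H (fst x) (snd x)))\<^sup>2)"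
    and "\<And>n. integrable time_product (\<lambda>x. (norm (simple_process (N n) (\<tau> n) (\<xi> n) (fst x) (snd x)
        - indicator {0..T} (fst x) *\<^sub>R H (fst x) (snd x)))\<^sup>2)"
    and "(\<lambda>n. \<integral>x. (norm (simple_process (N n) (\<tau> n) (\<xi> n) (fst x) (snd x)
        - indicator {0..T} (fst x) *\<^sub>R H (fst x) (snd x)))\<^sup>2 \<partial>time_product) \<longlonglongrightarrow> 0"
  using assms unfolding ito_approximation_def by blast+

lemma has_ito_integral_approx:
  assumes I: "has_ito_integral M G T B H I"
  shows "\<exists>N \<tau> \<xi>. ito_approximation H I N \<tau> \<xi>"
proof -
  from I obtain N \<tau> \<xi> where D: "\<And>n. simple_data G T (N n) (\<tau> n) (\<xi> n)"
    and lim1: "(\<lambda>n. \<integral>\<^sup>+ \<omega>. (\<integral>\<^sup>+ s\<in>{0..T}.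
            ennreal ((norm (simple_process (N n) (\<tau> n) (\<xi> n) s \<omega> - H s \<omega>))\<^sup>2) \<partial>lborel) \<partial>M) \<longlonglongrightarrow> 0"
    and lim2: "\<And>t. t \<in> {0..T} \<Longrightarrow> (\<lambda>n. \<integral>\<^sup>+ \<omega>. ennreal ((simple_integral B (N n) (\<tau> n) (\<xi> n) t \<omega> - I t \<omega>)\<^sup>2) \<partial>M) \<longlonglongrightarrow> 0"
    unfolding has_ito_integral_def by blast
  from I have prog: "progressive G T H"
    and fin: "(\<integral>\<^sup>+ \<omega>. (\<integral>\<^sup>+ s\<in>{0..T}. ennreal ((norm (H s \<omega>))\<^sup>2) \<partial>lborel) \<partial>M) < \<infinity>"
    and meas: "\<And>t. t \<in> {0..T} \<Longrightarrow> I t \<in> borel_measurable M"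
    unfolding has_ito_integral_def by auto
  let ?J = "\<lambda>n. simple_integral B (N n) (\<tau> n) (\<xi> n)"
  let ?P = "\<lambda>n x. simple_process (N n) (\<tau> n) (\<xi> n) (fst x) (snd x)"
  let ?H = "\<lambda>x. indicator {0..T} (fst x) *\<^sub>R H (fst x) (snd x)"
  have J_meas: "?J n t \<in> borel_measurable M" if "t \<in> {0..T}" for n t
    using measurable_G_M[OF that simple_integral_measurable[OF D that]] .
  have J_int: "integrable M (\<lambda>\<omega>. (?J n t \<omega>)\<^sup>2)" if t: "t \<in> {0..T}" for n t
    using simple_integral_increment_isometry(1)[OF D[of n], of 0 t "\<lambda>_. 0" 0] simple_integral_0[OF D[of n]] t by simp
  \<comment> \<open>Convergence gives a finite distance for large \<open>n\<close> only. One such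
    \<open>n\<close> makes \<open>I t\<close> square integrable, and then the differences are square
    integrable for every \<open>n\<close>.\<close>
  have I_int: "integrable M (\<lambda>\<omega>. (I t \<omega>)\<^sup>2)" if t: "t \<in> {0..T}" for t
  proof -
    note [measurable] = meas[OF t] J_meas[OF t]
    have "\<forall>\<^sub>F n in sequentially. (\<integral>\<^sup>+ \<omega>. ennreal ((?J n t \<omega> - I t \<omega>)\<^sup>2) \<partial>M) < 1"
      by (rule order_tendstoD(2)[OF lim2[OF t]]) simp
    then obtain n where "(\<integral>\<^sup>+ \<omega>. ennreal ((?J n t \<omega> - I t \<omega>)\<^sup>2) \<partial>M) < 1"
      by (auto simp: eventually_sequentially)
    then have "integrable M (\<lambda>\<omega>. (?J n t \<omega> - I t \<omega>)\<^sup>2)"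
      by (intro integrableI_nonneg) (auto intro: order_less_trans)
    then have "integrable M (\<lambda>\<omega>. (?J n t \<omega> + - (?J n t \<omega> - I t \<omega>))\<^sup>2)"
      by (intro integrable_add_squared J_int[OF t]) (auto simp: power2_commute)
    then show ?thesis by simp
  qed
  have d_int: "integrable M (\<lambda>\<omega>. (?J n t \<omega> - I t \<omega>)\<^sup>2)" if t: "t \<in> {0..T}" for n t
    using integrable_add_squared[of "?J n t" M "\<lambda>\<omega>. - I t \<omega>"] J_meas[OF t] meas[OF t] J_int[OF t] I_int[OF t] by simp
  have Hm[measurable]: "?H \<in> borel_measurable time_product"
    using progressive_measurable[OF prog] by (simp add: case_prod_unfold)
  have Pm[measurable]: "?P n \<in> borel_measurable time_product" for n
    using simple_process_measurable[OF D] by (simp add: case_prod_unfold)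
  have H2: "(\<lambda>x. ennreal ((norm (?H x))\<^sup>2)) \<in> borel_measurable time_product"
    and dP2: "(\<lambda>x. ennreal ((norm (?P n x - ?H x))\<^sup>2)) \<in> borel_measurable time_product" for n
    by measurable
  have H_int: "integrable time_product (\<lambda>x. (norm (?H x))\<^sup>2)"
  proof (rule integrableI_nonneg)
    have *: "(\<lambda>(s, \<omega>). indicator {0..T} s * ennreal ((norm (H s \<omega>))\<^sup>2)) = (\<lambda>x. ennreal ((norm (?H x))\<^sup>2))"
      by (auto simp: fun_eq_iff indicator_def)
    have "(\<integral>\<^sup>+x. ennreal ((norm (?H x))\<^sup>2) \<partial>time_product) = (\<integral>\<^sup>+ \<omega>. (\<integral>\<^sup>+ s\<in>{0..T}. ennreal ((norm (H s \<omega>))\<^sup>2) \<partial>lborel) \<partial>M)"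
      using nn_integral_time_product[of "{0..T}" "\<lambda>s \<omega>. ennreal ((norm (H s \<omega>))\<^sup>2)"] H2 unfolding * by (simp only:)
    then show "(\<integral>\<^sup>+x. ennreal ((norm (?H x))\<^sup>2) \<partial>time_product) < \<infinity>" using fin by simp
    show "(\<lambda>x. (norm (?H x))\<^sup>2) \<in> borel_measurable time_product" by measurable
    show "AE x in time_product. 0 \<le> (norm (?H x))\<^sup>2" by (intro AE_I2 zero_le_power2)
  qed
  have P_int: "integrable time_product (\<lambda>x. (norm (?P n x))\<^sup>2)" for n
    using simple_integral_T_isometry(3)[OF D, of "\<lambda>_. 1" n 1]
    by (simp add: has_bochner_integral_iff case_prod_unfold)
  have dP_int: "integrable time_product (\<lambda>x. (norm (?P n x - ?H x))\<^sup>2)" for n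
  proof (rule Bochner_Integration.integrable_bound)
    show "integrable time_product (\<lambda>x. 2 * (norm (?P n x))\<^sup>2 + 2 * (norm (?H x))\<^sup>2)" using P_int H_int by simp
    have "(norm (a - b))\<^sup>2 \<le> 2 * (norm a)\<^sup>2 + 2 * (norm b)\<^sup>2" for a b :: "real^'d"
    proof -
      have "(norm (a - b))\<^sup>2 + (norm (a + b))\<^sup>2 = 2 * (norm a)\<^sup>2 + 2 * (norm b)\<^sup>2"
        by (simp add: power2_norm_eq_inner inner_diff inner_add inner_commute algebra_simps)
      then show ?thesis using zero_le_power2[of "norm (a + b)"] by linarith
    qed
    then show "AE x in time_product. norm ((norm (?P n x - ?H x))\<^sup>2) \<le> norm (2 * (norm (?P n x))\<^sup>2 + 2 * (norm (?H x))\<^sup>2)"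
      by (intro AE_I2) (simp only: real_norm_def abs_of_nonneg zero_le_power2 add_nonneg_nonneg mult_nonneg_nonneg zero_le_numeral)
  qed simp
  have zero: "simple_process (N n) (\<tau> n) (\<xi> n) s \<omega> = 0" if "s \<notin> {0..T}" for n s \<omega>
    unfolding simple_process_def
  proof (rule sum.neutral, rule ballI)
    fix i assume "i \<in> {..<N n}"
    then have "\<tau> n i \<in> {0..T}" "\<tau> n (Suc i) \<in> {0..T}" using D[of n] by (auto simp: simple_data_def)
    then show "indicat_real {\<tau> n i<..\<tau> n (Suc i)} s *\<^sub>R \<xi> n i \<omega> = 0" using that by (auto simp: indicator_def)
  qed
  have "(\<integral>\<^sup>+ \<omega>. (\<integral>\<^sup>+ s\<in>{0..T}. ennreal ((norm (simple_process (N n) (\<tau> n) (\<xi> n) s \<omega> - H s \<omega>))\<^sup>2) \<partial>lborel) \<partial>M)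
      = (\<integral>\<^sup>+x. ennreal ((norm (?P n x - ?H x))\<^sup>2) \<partial>time_product)" for n
  proof -
    have *: "(\<lambda>(s, \<omega>). indicator {0..T} s * ennreal ((norm (simple_process (N n) (\<tau> n) (\<xi> n) s \<omega> - H s \<omega>))\<^sup>2))
        = (\<lambda>x. ennreal ((norm (?P n x - ?H x))\<^sup>2))"
      by (auto simp: fun_eq_iff indicator_def zero)
    show ?thesis
      using nn_integral_time_product[of "{0..T}" "\<lambda>s \<omega>. ennreal ((norm (simple_process (N n) (\<tau> n) (\<xi> n) s \<omega> - H s \<omega>))\<^sup>2)"]
      dP2[of n] unfolding * by (simp only:)
  qed
  then have "(\<lambda>n. \<integral>\<^sup>+x. ennreal ((norm (?P n x - ?H x))\<^sup>2) \<partial>time_product) \<longlonglongrightarrow> 0" using lim1 by simp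
  then have "(\<lambda>n. \<integral>x. (norm (?P n x - ?H x))\<^sup>2 \<partial>time_product) \<longlonglongrightarrow> 0"
    by (rule tendsto_integral_of_nn_integral[of time_product "\<lambda>n x. (norm (?P n x - ?H x))\<^sup>2", OF dP_int zero_le_power2])
  moreover have "(\<lambda>n. \<integral>\<omega>. (?J n t \<omega> - I t \<omega>)\<^sup>2 \<partial>M) \<longlonglongrightarrow> 0" if "t \<in> {0..T}" for t
    by (rule tendsto_integral_of_nn_integral[OF d_int[OF that] _ lim2[OF that]]) simp
  ultimately have "ito_approximation H I N \<tau> \<xi>"
    unfolding ito_approximation_def using D I_int d_int H_int dP_int by blast
  then show ?thesis by blast
qed

lemma has_ito_integral_measurable:
  "has_ito_integral M G T B H I \<Longrightarrow> t \<in> {0..T} \<Longrightarrow> I t \<in> borel_measurable M"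
  by (auto simp: has_ito_integral_def)

lemma has_ito_integral_square_integrable:
  assumes "has_ito_integral M G T B H I" "t \<in> {0..T}"
  shows "integrable M (\<lambda>\<omega>. (I t \<omega>)\<^sup>2)"
  using has_ito_integral_approx[OF assms(1)] ito_approximationD(2) assms(2) by blast

lemma square_integrable_diff:
  fixes X Y :: "'w \<Rightarrow> real"
  assumes "X \<in> borel_measurable M" "Y \<in> borel_measurable M"
    and "integrable M (\<lambda>\<omega>. (X \<omega>)\<^sup>2)" "integrable M (\<lambda>\<omega>. (Y \<omega>)\<^sup>2)"
  shows "integrable M (\<lambda>\<omega>. (X \<omega> - Y \<omega>)\<^sup>2)"
  using integrable_add_squared[of X M "\<lambda>\<omega>. - Y \<omega>"] assms by simp

lemma tendsto_integral_squared_diff: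
  fixes X Y :: "nat \<Rightarrow> 'w \<Rightarrow> real"
  assumes [measurable]: "\<And>n. X n \<in> borel_measurable M" "\<And>n. Y n \<in> borel_measurable M"
    and int: "\<And>n. integrable M (\<lambda>\<omega>. (X n \<omega>)\<^sup>2)" "\<And>n. integrable M (\<lambda>\<omega>. (Y n \<omega>)\<^sup>2)"
    and "(\<lambda>n. \<integral>\<omega>. (X n \<omega>)\<^sup>2 \<partial>M) \<longlonglongrightarrow> 0" "(\<lambda>n. \<integral>\<omega>. (Y n \<omega>)\<^sup>2 \<partial>M) \<longlonglongrightarrow> 0"
  shows "(\<lambda>n. \<integral>\<omega>. (X n \<omega> - Y n \<omega>)\<^sup>2 \<partial>M) \<longlonglongrightarrow> 0"
proof (rule tendsto_sandwich)
  show "\<forall>\<^sub>F n in sequentially. 0 \<le> (\<integral>\<omega>. (X n \<omega> - Y n \<omega>)\<^sup>2 \<partial>M)" by simp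
  have "(a - b)\<^sup>2 \<le> 2 * a\<^sup>2 + 2 * b\<^sup>2" for a b :: real
    using zero_le_power2[of "a + b"] by (simp add: power2_sum power2_diff)
  then have "(\<integral>\<omega>. (X n \<omega> - Y n \<omega>)\<^sup>2 \<partial>M) \<le> (\<integral>\<omega>. 2 * (X n \<omega>)\<^sup>2 + 2 * (Y n \<omega>)\<^sup>2 \<partial>M)" for n
    using int by (intro integral_mono square_integrable_diff) auto
  then show "\<forall>\<^sub>F n in sequentially. (\<integral>\<omega>. (X n \<omega> - Y n \<omega>)\<^sup>2 \<partial>M)
      \<le> 2 * (\<integral>\<omega>. (X n \<omega>)\<^sup>2 \<partial>M) + 2 * (\<integral>\<omega>. (Y n \<omega>)\<^sup>2 \<partial>M)"
    using int by (simp add: Bochner_Integration.integral_add)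
  show "(\<lambda>n. 2 * (\<integral>\<omega>. (X n \<omega>)\<^sup>2 \<partial>M) + 2 * (\<integral>\<omega>. (Y n \<omega>)\<^sup>2 \<partial>M)) \<longlonglongrightarrow> 0"
    using tendsto_add[OF tendsto_mult_left[OF assms(5), of 2] tendsto_mult_left[OF assms(6), of 2]] by simp
qed simp

text \<open>Increments are centred given \<open>G u\<close>, and their conditional variance is that
  of the isometry; both facts are tested against bounded weights. They hold for simple integrands
  and pass to the limit, because the increments converge in the square mean on \<Omega> and, for the
  isometry, the integrands do so on \<open>time_product\<close>.\<close>

lemma has_ito_integral_increment_mean:
  assumes I: "has_ito_integral M G T B H I" and uv: "0 \<le> u" "u \<le> v" "v \<le> T"
    and Z: "Z \<in> borel_measurable (G u)" "\<And>\<omega>. \<omega> \<in> space M \<Longrightarrow> \<bar>Z \<omega>\<bar> \<le> C"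
  shows "(\<integral>\<omega>. Z \<omega> * (I v \<omega> - I u \<omega>) \<partial>M) = 0"
    and "(\<integral>\<omega>. Z \<omega> * (I v \<omega> - I u \<omega>)\<^sup>2 \<partial>M)
      = (\<integral>x. (case x of (s, \<omega>) \<Rightarrow> indicator {u<..v} s * Z \<omega> * (norm (H s \<omega>))\<^sup>2) \<partial>time_product)"
proof -
  have u: "u \<in> {0..T}" and v: "v \<in> {0..T}" using uv by auto
  obtain N \<tau> \<xi> where app: "ito_approximation H I N \<tau> \<xi>" using has_ito_integral_approx[OF I] by blast
  note D = ito_approximationD(1)[OF app] and I2 = ito_approximationD(2)[OF app] and d_int = ito_approximationD(3)[OF app]
    and d_lim = ito_approximationD(4)[OF app] and H_int = ito_approximationD(5)[OF app]
    and dP_int = ito_approximationD(6)[OF app] and dP_lim = ito_approximationD(7)[OF app]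
  let ?J = "\<lambda>n. simple_integral B (N n) (\<tau> n) (\<xi> n)"
  let ?P = "\<lambda>n x. simple_process (N n) (\<tau> n) (\<xi> n) (fst x) (snd x)"
  let ?H = "\<lambda>x. indicator {0..T} (fst x) *\<^sub>R H (fst x) (snd x)"
  have [measurable]: "Z \<in> borel_measurable M" using measurable_G_M[OF u Z(1)] .
  have IM[measurable]: "I u \<in> borel_measurable M" "I v \<in> borel_measurable M"
    using has_ito_integral_measurable[OF I] u v by auto
  have JM[measurable]: "?J n u \<in> borel_measurable M" "?J n v \<in> borel_measurable M" for n
    using measurable_G_M[OF _ simple_integral_measurable[OF D]] u v by auto
  have Hm[measurable]: "?H \<in> borel_measurable time_product"
    using progressive_measurable[of H] I by (simp add: case_prod_unfold has_ito_integral_def)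
  have Pm[measurable]: "?P n \<in> borel_measurable time_product" for n
    using simple_process_measurable[OF D] by (simp add: case_prod_unfold)
  have dI_int: "integrable M (\<lambda>\<omega>. (I v \<omega> - I u \<omega>)\<^sup>2)"
    by (rule square_integrable_diff[OF IM(2,1) I2[OF v] I2[OF u]])
  have dJ_int: "integrable M (\<lambda>\<omega>. (?J n v \<omega> - ?J n u \<omega>)\<^sup>2)" for n
    by (rule simple_integral_increment_isometry(1)[OF D uv Z])
  have eq: "(?J n v \<omega> - I v \<omega>) - (?J n u \<omega> - I u \<omega>) = (?J n v \<omega> - ?J n u \<omega>) - (I v \<omega> - I u \<omega>)" for n \<omega> by simp
  have ddJ_lim: "(\<lambda>n. \<integral>\<omega>. ((?J n v \<omega> - ?J n u \<omega>) - (I v \<omega> - I u \<omega>))\<^sup>2 \<partial>M) \<longlonglongrightarrow> 0"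
    using tendsto_integral_squared_diff[OF _ _ d_int[OF v] d_int[OF u] d_lim[OF v] d_lim[OF u]] unfolding eq by simp
  have ddJ_int: "integrable M (\<lambda>\<omega>. ((?J n v \<omega> - ?J n u \<omega>) - (I v \<omega> - I u \<omega>))\<^sup>2)" for n
    by (rule square_integrable_diff[OF _ _ dJ_int dI_int]) simp_all
  have "(\<lambda>n. \<integral>\<omega>. Z \<omega> * (?J n v \<omega> - ?J n u \<omega>) \<partial>M) \<longlonglongrightarrow> (\<integral>\<omega>. Z \<omega> * (I v \<omega> - I u \<omega>) \<partial>M)"
    by (rule tendsto_integral_mult[OF finite_measure_axioms _ _ _ dJ_int dI_int ddJ_int ddJ_lim Z(2)]) simp_all
  moreover have "(\<integral>\<omega>. Z \<omega> * (?J n v \<omega> - ?J n u \<omega>) \<partial>M) = 0" for n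
  proof -
    have "integrable M Z" by (rule integrable_const_bound[of _ C]) (use Z(2) in auto)
    from simple_integral_increment_mean[OF D uv Z(1) this] show ?thesis by (auto simp: has_bochner_integral_iff)
  qed
  ultimately show "(\<integral>\<omega>. Z \<omega> * (I v \<omega> - I u \<omega>) \<partial>M) = 0"
    by (simp add: LIMSEQ_const_iff)
  have lim1: "(\<lambda>n. \<integral>\<omega>. Z \<omega> * (norm (?J n v \<omega> - ?J n u \<omega>))\<^sup>2 \<partial>M) \<longlonglongrightarrow> (\<integral>\<omega>. Z \<omega> * (norm (I v \<omega> - I u \<omega>))\<^sup>2 \<partial>M)"
    by (rule tendsto_integral_norm_squared[OF _ _ _ _ _ _ _ Z(2)]) (use dJ_int dI_int ddJ_int ddJ_lim in simp_all)
  let ?W = "\<lambda>x. indicator {u<..v} (fst x) * Z (snd x)"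
  have W: "\<bar>?W x\<bar> \<le> \<bar>C\<bar>" if "x \<in> space time_product" for x
    using that Z(2)[of "snd x"] by (auto simp: space_pair_measure indicator_def)
  have P_int: "integrable time_product (\<lambda>x. (norm (?P n x))\<^sup>2)" for n
    using simple_integral_T_isometry(3)[OF D, of "\<lambda>_. 1" n 1]
    by (simp add: has_bochner_integral_iff case_prod_unfold)
  have "(\<lambda>n. \<integral>x. ?W x * (norm (?P n x))\<^sup>2 \<partial>time_product) \<longlonglongrightarrow> (\<integral>x. ?W x * (norm (?H x))\<^sup>2 \<partial>time_product)"
    by (rule tendsto_integral_norm_squared[OF Pm Hm _ P_int _ _ _ W])
       (use H_int dP_int dP_lim in \<open>simp_all only:\<close>, measurable)
  moreover have "(\<integral>x. ?W x * (norm (?P n x))\<^sup>2 \<partial>time_product) = (\<integral>\<omega>. Z \<omega> * (norm (?J n v \<omega> - ?J n u \<omega>))\<^sup>2 \<partial>M)" for n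
    using simple_integral_increment_isometry(2)[OF D[of n] uv Z]
    by (simp add: has_bochner_integral_iff case_prod_unfold)
  ultimately have "(\<integral>x. ?W x * (norm (?H x))\<^sup>2 \<partial>time_product) = (\<integral>\<omega>. Z \<omega> * (norm (I v \<omega> - I u \<omega>))\<^sup>2 \<partial>M)"
    using lim1 by (simp add: LIMSEQ_unique)
  moreover have "(\<integral>x. ?W x * (norm (?H x))\<^sup>2 \<partial>time_product)
      = (\<integral>x. (case x of (s, \<omega>) \<Rightarrow> indicator {u<..v} s * Z \<omega> * (norm (H s \<omega>))\<^sup>2) \<partial>time_product)"
    using uv by (intro Bochner_Integration.integral_cong) (auto simp: indicator_def)
  ultimately show "(\<integral>\<omega>. Z \<omega> * (I v \<omega> - I u \<omega>)\<^sup>2 \<partial>M)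
      = (\<integral>x. (case x of (s, \<omega>) \<Rightarrow> indicator {u<..v} s * Z \<omega> * (norm (H s \<omega>))\<^sup>2) \<partial>time_product)" by simp
qed

text \<open>Each of the two integrals has increments of mean zero against weights known at
  \<open>t N\<close>, hence so has their difference, although the two partitions are unrelated. The
  weight \<open>W (t N)\<close> is unbounded, so the statement about means for integrable weights is
  applied.\<close>

lemma simple_integral_orthogonal_increments:
  assumes D: "simple_data G T n \<tau> \<xi>" "simple_data G T n' \<tau>' \<xi>'"
    and t: "t 0 = 0" "\<And>k. k < N \<Longrightarrow> t k \<le> t (Suc k)" "\<And>k. k \<le> N \<Longrightarrow> t k \<in> {0..T}"
  defines "W \<equiv> \<lambda>s \<omega>. simple_integral B n \<tau> \<xi> s \<omega> - simple_integral B n' \<tau>' \<xi>' s \<omega>"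
  shows "(\<integral>\<omega>. (W (t N) \<omega>)\<^sup>2 \<partial>M) = (\<Sum>k<N. \<integral>\<omega>. (W (t (Suc k)) \<omega> - W (t k) \<omega>)\<^sup>2 \<partial>M)"
  using t(2,3)
proof (induction N)
  case 0
  then show ?case using simple_integral_0 D by (simp add: W_def t(1))
next
  case (Suc N)
  have tN: "t N \<in> {0..T}" "t (Suc N) \<in> {0..T}" "t N \<le> t (Suc N)" using Suc.prems by auto
  then have uv: "0 \<le> t N" "t N \<le> t (Suc N)" "t (Suc N) \<le> T" by auto
  have WG: "W s \<in> borel_measurable (G s)" if "s \<in> {0..T}" for s
    unfolding W_def using simple_integral_measurable[OF D(1) that] simple_integral_measurable[OF D(2) that] by measurable
  have WM[measurable]: "W s \<in> borel_measurable M" if "s \<in> {0..T}" for s using measurable_G_M[OF that WG[OF that]] .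
  have W2: "integrable M (\<lambda>\<omega>. (W s \<omega>)\<^sup>2)" if s: "s \<in> {0..T}" for s
  proof -
    have "integrable M (\<lambda>\<omega>. (simple_integral B n \<tau> \<xi> s \<omega>)\<^sup>2)" if "simple_data G T n \<tau> \<xi>" for n \<tau> \<xi>
      using simple_integral_increment_isometry(1)[OF that, of 0 s "\<lambda>_. 0" 0] simple_integral_0[OF that] s by simp
    then show ?thesis unfolding W_def
      using D measurable_G_M[OF s simple_integral_measurable[OF _ s]] by (intro square_integrable_diff) auto
  qed
  have W1: "integrable M (W (t N))" by (rule square_integrable_imp_integrable[OF WM[OF tN(1)] W2[OF tN(1)]])
  let ?d = "\<lambda>\<omega>. W (t (Suc N)) \<omega> - W (t N) \<omega>"
  have "has_bochner_integral M (\<lambda>\<omega>. W (t N) \<omega> * (simple_integral B n \<tau> \<xi> (t (Suc N)) \<omega> - simple_integral B n \<tau> \<xi> (t N) \<omega>)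
      - W (t N) \<omega> * (simple_integral B n' \<tau>' \<xi>' (t (Suc N)) \<omega> - simple_integral B n' \<tau>' \<xi>' (t N) \<omega>)) (0 - 0)"
    by (intro has_bochner_integral_diff simple_integral_increment_mean D uv WG tN W1)
  then have cross: "has_bochner_integral M (\<lambda>\<omega>. W (t N) \<omega> * ?d \<omega>) 0"
    by (simp add: W_def algebra_simps)
  have d2: "integrable M (\<lambda>\<omega>. (?d \<omega>)\<^sup>2)"
    using tN by (intro square_integrable_diff WM W2)
  have "(W (t (Suc N)) \<omega>)\<^sup>2 = (W (t N) \<omega>)\<^sup>2 + 2 * (W (t N) \<omega> * ?d \<omega>) + (?d \<omega>)\<^sup>2" for \<omega>
    by (simp add: power2_eq_square algebra_simps)
  then have "(\<integral>\<omega>. (W (t (Suc N)) \<omega>)\<^sup>2 \<partial>M) = (\<integral>\<omega>. (W (t N) \<omega>)\<^sup>2 + 2 * (W (t N) \<omega> * ?d \<omega>) + (?d \<omega>)\<^sup>2 \<partial>M)" by simp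
  also have "\<dots> = (\<integral>\<omega>. (W (t N) \<omega>)\<^sup>2 \<partial>M) + (\<integral>\<omega>. (?d \<omega>)\<^sup>2 \<partial>M)"
    using W2[OF tN(1)] cross d2 by (simp add: has_bochner_integral_iff)
  finally show ?case using Suc by simp
qed

text \<open>Split \<open>I = J + (I - J)\<close> with \<open>J\<close> the integral of a simple process: \<open>J\<close> has fourth moments of
  order \<open>(\<Delta>t)\<^sup>2\<close>, and the increments of \<open>I - J\<close> are orthogonal.\<close>

lemma has_ito_integral_Lindeberg:
  assumes I: "has_ito_integral M G T B H I" and t: "0 < t" "t \<le> T" and \<delta>: "\<delta> > 0"
  defines "p \<equiv> \<lambda>N k. real k * t / real N"
  shows "(\<lambda>N. \<Sum>k<N. \<integral>\<omega>. (if \<delta> < \<bar>I (p N (Suc k)) \<omega> - I (p N k) \<omega>\<bar>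
      then (I (p N (Suc k)) \<omega> - I (p N k) \<omega>)\<^sup>2 else 0) \<partial>M) \<longlonglongrightarrow> 0"
proof (rule LIMSEQ_I)
  fix r :: real assume r: "r > 0"
  obtain N \<tau> \<xi> where app: "ito_approximation H I N \<tau> \<xi>" using has_ito_integral_approx[OF I] by blast
  note D = ito_approximationD(1)[OF app] and I2 = ito_approximationD(2)[OF app] and d_int = ito_approximationD(3)[OF app]
    and d_lim = ito_approximationD(4)[OF app]
  let ?J = "\<lambda>n. simple_integral B (N n) (\<tau> n) (\<xi> n)"
  have tT: "t \<in> {0..T}" using t by auto
  have JM: "?J n s \<in> borel_measurable M" if "s \<in> {0..T}" for n s
    using measurable_G_M[OF that simple_integral_measurable[OF D that]] .
  have IM: "I s \<in> borel_measurable M" if "s \<in> {0..T}" for s by (rule has_ito_integral_measurable[OF I that])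
  have J2: "integrable M (\<lambda>\<omega>. (?J n s \<omega>)\<^sup>2)" if s: "s \<in> {0..T}" for n s
    using simple_integral_increment_isometry(1)[OF D[of n], of 0 s "\<lambda>_. 0" 0] simple_integral_0[OF D[of n]] s by simp
  have p_in: "p K k \<in> {0..T}" if "k \<le> K" for k K
  proof -
    have "real k * t / real K \<le> 1 * t" using that t by (cases "K = 0") (auto simp: field_simps)
    then show ?thesis using t by (auto simp: p_def)
  qed
  have p_mono: "p K k \<le> p K (Suc k)" for k K
    unfolding p_def using t by (intro divide_right_mono mult_right_mono) auto
  have p_diff: "p K (Suc k) - p K k = t / real K" for k K
    unfolding p_def by (simp add: diff_divide_distrib[symmetric] algebra_simps)
  have "\<forall>\<^sub>F n in sequentially. (\<integral>\<omega>. (?J n t \<omega> - I t \<omega>)\<^sup>2 \<partial>M) < r / 8"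
    using r by (intro order_tendstoD(2)[OF d_lim[OF tT]]) auto
  \<comment> \<open>The tolerance \<open>r / 8\<close> becomes \<open>r / 2\<close> after the factor
    4 of \<open>truncated_square_le\<close>.\<close>
  then obtain m where m: "(\<integral>\<omega>. (?J m t \<omega> - I t \<omega>)\<^sup>2 \<partial>M) < r / 8" by (auto simp: eventually_sequentially)
  let ?E = "\<lambda>s \<omega>. I s \<omega> - ?J m s \<omega>"
  have EM: "?E s \<in> borel_measurable M" if "s \<in> {0..T}" for s using IM[OF that] JM[OF that] by simp
  have E2: "integrable M (\<lambda>\<omega>. (?E s \<omega>)\<^sup>2)" if "s \<in> {0..T}" for s
    by (rule square_integrable_diff[OF IM[OF that] JM[OF that] I2[OF that] J2[OF that]])
  \<comment> \<open>Orthogonality is available for simple integrals. It is used for the difference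
    of \<open>?J n\<close> and \<open>?J m\<close>, which tends to \<open>?E\<close> in the square
    mean at each partition point as \<open>n\<close> grows.\<close>
  have orth: "(\<Sum>k<K. \<integral>\<omega>. (?E (p K (Suc k)) \<omega> - ?E (p K k) \<omega>)\<^sup>2 \<partial>M) = (\<integral>\<omega>. (?E (p K K) \<omega>)\<^sup>2 \<partial>M)" for K
  proof -
    let ?W = "\<lambda>n s \<omega>. ?J n s \<omega> - ?J m s \<omega>"
    have WM: "?W n s \<in> borel_measurable M" if "s \<in> {0..T}" for n s using JM[OF that] by simp
    have W2: "integrable M (\<lambda>\<omega>. (?W n s \<omega>)\<^sup>2)" if "s \<in> {0..T}" for n s
      by (rule square_integrable_diff[OF JM[OF that] JM[OF that] J2[OF that] J2[OF that]])
    have WE: "?W n s \<omega> - ?E s \<omega> = ?J n s \<omega> - I s \<omega>" for n s \<omega> by simp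
    have lim: "(\<lambda>n. \<integral>\<omega>. (X n \<omega>)\<^sup>2 \<partial>M) \<longlonglongrightarrow> (\<integral>\<omega>. (Y \<omega>)\<^sup>2 \<partial>M)"
      if "\<And>n. X n \<in> borel_measurable M" "Y \<in> borel_measurable M" "\<And>n. integrable M (\<lambda>\<omega>. (X n \<omega>)\<^sup>2)" "integrable M (\<lambda>\<omega>. (Y \<omega>)\<^sup>2)"
        "(\<lambda>n. \<integral>\<omega>. (X n \<omega> - Y \<omega>)\<^sup>2 \<partial>M) \<longlonglongrightarrow> 0" for X and Y :: "'w \<Rightarrow> real"
      using tendsto_integral_norm_squared[of X M Y "\<lambda>_. 1" 1] that square_integrable_diff[OF that(1,2) that(3,4)] by simp
    have 1: "(\<lambda>n. \<integral>\<omega>. (?W n (p K K) \<omega>)\<^sup>2 \<partial>M) \<longlonglongrightarrow> (\<integral>\<omega>. (?E (p K K) \<omega>)\<^sup>2 \<partial>M)"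
    proof (rule lim)
      have K: "p K K \<in> {0..T}" by (rule p_in) simp
      show "?W n (p K K) \<in> borel_measurable M" "integrable M (\<lambda>\<omega>. (?W n (p K K) \<omega>)\<^sup>2)" for n
        by (rule WM[OF K] W2[OF K])+
      show "?E (p K K) \<in> borel_measurable M" "integrable M (\<lambda>\<omega>. (?E (p K K) \<omega>)\<^sup>2)"
        by (rule EM[OF K] E2[OF K])+
      show "(\<lambda>n. \<integral>\<omega>. (?W n (p K K) \<omega> - ?E (p K K) \<omega>)\<^sup>2 \<partial>M) \<longlonglongrightarrow> 0"
        unfolding WE by (rule d_lim[OF K])
    qed
    have 2: "(\<lambda>n. \<Sum>k<K. \<integral>\<omega>. (?W n (p K (Suc k)) \<omega> - ?W n (p K k) \<omega>)\<^sup>2 \<partial>M)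
       \<longlonglongrightarrow> (\<Sum>k<K. \<integral>\<omega>. (?E (p K (Suc k)) \<omega> - ?E (p K k) \<omega>)\<^sup>2 \<partial>M)"
    proof (intro tendsto_sum lim)
      fix k assume "k \<in> {..<K}"
      then have k: "p K k \<in> {0..T}" "p K (Suc k) \<in> {0..T}" by (auto intro!: p_in simp del: atLeastAtMost_iff)
      show "(\<lambda>\<omega>. ?W n (p K (Suc k)) \<omega> - ?W n (p K k) \<omega>) \<in> borel_measurable M" for n using WM[OF k(1)] WM[OF k(2)] by measurable
      show "(\<lambda>\<omega>. ?E (p K (Suc k)) \<omega> - ?E (p K k) \<omega>) \<in> borel_measurable M" using EM[OF k(1)] EM[OF k(2)] by measurable
      show "integrable M (\<lambda>\<omega>. (?W n (p K (Suc k)) \<omega> - ?W n (p K k) \<omega>)\<^sup>2)" for n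
        by (rule square_integrable_diff[OF WM[OF k(2)] WM[OF k(1)] W2[OF k(2)] W2[OF k(1)]])
      show "integrable M (\<lambda>\<omega>. (?E (p K (Suc k)) \<omega> - ?E (p K k) \<omega>)\<^sup>2)"
        by (rule square_integrable_diff[OF EM[OF k(2)] EM[OF k(1)] E2[OF k(2)] E2[OF k(1)]])
      have "(\<lambda>n. \<integral>\<omega>. ((?J n (p K (Suc k)) \<omega> - I (p K (Suc k)) \<omega>) - (?J n (p K k) \<omega> - I (p K k) \<omega>))\<^sup>2 \<partial>M) \<longlonglongrightarrow> 0"
        by (rule tendsto_integral_squared_diff[OF _ _ d_int[OF k(2)] d_int[OF k(1)] d_lim[OF k(2)] d_lim[OF k(1)]])
           (use JM IM k in \<open>auto intro!: borel_measurable_diff\<close>)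
      moreover have "(?W n (p K (Suc k)) \<omega> - ?W n (p K k) \<omega>) - (?E (p K (Suc k)) \<omega> - ?E (p K k) \<omega>)
         = (?J n (p K (Suc k)) \<omega> - I (p K (Suc k)) \<omega>) - (?J n (p K k) \<omega> - I (p K k) \<omega>)" for n \<omega> by simp
      ultimately show "(\<lambda>n. \<integral>\<omega>. ((?W n (p K (Suc k)) \<omega> - ?W n (p K k) \<omega>) - (?E (p K (Suc k)) \<omega> - ?E (p K k) \<omega>))\<^sup>2 \<partial>M) \<longlonglongrightarrow> 0"
        by (simp only:)
    qed
    have "(\<integral>\<omega>. (?W n (p K K) \<omega>)\<^sup>2 \<partial>M) = (\<Sum>k<K. \<integral>\<omega>. (?W n (p K (Suc k)) \<omega> - ?W n (p K k) \<omega>)\<^sup>2 \<partial>M)" for n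
      by (rule simple_integral_orthogonal_increments[OF D D, of "p K"]) (use p_in p_mono in \<open>auto simp: p_def\<close>)
    with 1 2 show ?thesis by (simp only:) (rule LIMSEQ_unique)
  qed
  obtain C where C: "\<And>u v. 0 \<le> u \<Longrightarrow> u \<le> v \<Longrightarrow> v \<le> T \<Longrightarrow> integrable M (\<lambda>\<omega>. (?J m v \<omega> - ?J m u \<omega>) ^ 4)"
    "\<And>u v. 0 \<le> u \<Longrightarrow> u \<le> v \<Longrightarrow> v \<le> T \<Longrightarrow> (\<integral>\<omega>. (?J m v \<omega> - ?J m u \<omega>) ^ 4 \<partial>M) \<le> C * (v - u)\<^sup>2"
    using simple_integral_increment_power4[OF D[of m]] by blast
  let ?F = "\<lambda>K k \<omega>. (if \<delta> < \<bar>I (p K (Suc k)) \<omega> - I (p K k) \<omega>\<bar> then (I (p K (Suc k)) \<omega> - I (p K k) \<omega>)\<^sup>2 else 0)"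
  have summand: "0 \<le> (\<integral>\<omega>. ?F K k \<omega> \<partial>M)"
    "(\<integral>\<omega>. ?F K k \<omega> \<partial>M) \<le> 4 * (\<integral>\<omega>. (?E (p K (Suc k)) \<omega> - ?E (p K k) \<omega>)\<^sup>2 \<partial>M) + 16 / \<delta>\<^sup>2 * (C * (t / real K)\<^sup>2)"
    if "k < K" for k K
  proof -
    have k: "p K k \<in> {0..T}" "p K (Suc k) \<in> {0..T}" using that by (auto intro!: p_in simp del: atLeastAtMost_iff)
    then have k': "0 \<le> p K k" "p K k \<le> p K (Suc k)" "p K (Suc k) \<le> T" using p_mono by auto
    note [measurable] = IM[OF k(1)] IM[OF k(2)] EM[OF k(1)] EM[OF k(2)]
    show "0 \<le> (\<integral>\<omega>. ?F K k \<omega> \<partial>M)" by (intro Bochner_Integration.integral_nonneg) auto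
    let ?R = "\<lambda>\<omega>. 4 * (?E (p K (Suc k)) \<omega> - ?E (p K k) \<omega>)\<^sup>2 + 16 / \<delta>\<^sup>2 * (?J m (p K (Suc k)) \<omega> - ?J m (p K k) \<omega>) ^ 4"
    have R1: "integrable M (\<lambda>\<omega>. 4 * (?E (p K (Suc k)) \<omega> - ?E (p K k) \<omega>)\<^sup>2)"
      by (intro integrable_mult_right square_integrable_diff[OF EM[OF k(2)] EM[OF k(1)] E2[OF k(2)] E2[OF k(1)]])
    have R2: "integrable M (\<lambda>\<omega>. 16 / \<delta>\<^sup>2 * (?J m (p K (Suc k)) \<omega> - ?J m (p K k) \<omega>) ^ 4)"
      by (intro integrable_mult_right C(1)[OF k'])
    have le: "?F K k \<omega> \<le> ?R \<omega>" for \<omega>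
    proof -
      have "I (p K (Suc k)) \<omega> - I (p K k) \<omega>
        = (?E (p K (Suc k)) \<omega> - ?E (p K k) \<omega>) + (?J m (p K (Suc k)) \<omega> - ?J m (p K k) \<omega>)" by simp
      then show ?thesis by (simp only: truncated_square_le[OF \<delta>])
    qed
    have "integrable M (?F K k)"
    proof (rule Bochner_Integration.integrable_bound)
      show "integrable M ?R" using R1 R2 by (rule Bochner_Integration.integrable_add)
      have "norm (?F K k \<omega>) \<le> norm (?R \<omega>)" for \<omega>
      proof -
        have "norm (?F K k \<omega>) = ?F K k \<omega>" by simp
        also have "\<dots> \<le> ?R \<omega>" by (rule le)
        finally show ?thesis by simp
      qed
      then show "AE \<omega> in M. norm (?F K k \<omega>) \<le> norm (?R \<omega>)" by (intro AE_I2)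
    qed measurable
    then have "(\<integral>\<omega>. ?F K k \<omega> \<partial>M) \<le> (\<integral>\<omega>. ?R \<omega> \<partial>M)"
      using R1 R2 le by (intro integral_mono Bochner_Integration.integrable_add)
    also have "\<dots> = 4 * (\<integral>\<omega>. (?E (p K (Suc k)) \<omega> - ?E (p K k) \<omega>)\<^sup>2 \<partial>M) + 16 / \<delta>\<^sup>2 * (\<integral>\<omega>. (?J m (p K (Suc k)) \<omega> - ?J m (p K k) \<omega>) ^ 4 \<partial>M)"
      unfolding Bochner_Integration.integral_add[OF R1 R2] by (simp only: integral_mult_right_zero)
    also have "\<dots> \<le> 4 * (\<integral>\<omega>. (?E (p K (Suc k)) \<omega> - ?E (p K k) \<omega>)\<^sup>2 \<partial>M) + 16 / \<delta>\<^sup>2 * (C * (t / real K)\<^sup>2)"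
      using C(2)[OF k'] unfolding p_diff by (intro add_left_mono mult_left_mono) auto
    finally show "(\<integral>\<omega>. ?F K k \<omega> \<partial>M) \<le> 4 * (\<integral>\<omega>. (?E (p K (Suc k)) \<omega> - ?E (p K k) \<omega>)\<^sup>2 \<partial>M) + 16 / \<delta>\<^sup>2 * (C * (t / real K)\<^sup>2)" .
  qed
  have sum_le: "norm (\<Sum>k<K. \<integral>\<omega>. ?F K k \<omega> \<partial>M) \<le> r / 2 + 16 / \<delta>\<^sup>2 * C * t\<^sup>2 * (1 / real K)" if K: "K > 0" for K
  proof -
    have "norm (\<Sum>k<K. \<integral>\<omega>. ?F K k \<omega> \<partial>M) = (\<Sum>k<K. \<integral>\<omega>. ?F K k \<omega> \<partial>M)"
      unfolding real_norm_def by (intro abs_of_nonneg sum_nonneg) (use summand(1) in auto)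
    also have "\<dots> \<le> (\<Sum>k<K. 4 * (\<integral>\<omega>. (?E (p K (Suc k)) \<omega> - ?E (p K k) \<omega>)\<^sup>2 \<partial>M) + 16 / \<delta>\<^sup>2 * (C * (t / real K)\<^sup>2))"
      by (intro sum_mono summand(2)) auto
    also have "\<dots> = 4 * (\<integral>\<omega>. (?E (p K K) \<omega>)\<^sup>2 \<partial>M) + real K * (16 / \<delta>\<^sup>2 * (C * (t / real K)\<^sup>2))"
      unfolding sum.distrib sum_distrib_left[symmetric] orth by simp
    also have "p K K = t" using K by (simp add: p_def)
    \<comment> \<open>The fourth moments are of second order in the mesh, so their sum over
      \<open>K\<close> intervals is of order \<open>1 / K\<close>.\<close>
    also have "real K * (16 / \<delta>\<^sup>2 * (C * (t / real K)\<^sup>2)) = 16 / \<delta>\<^sup>2 * C * t\<^sup>2 * (1 / real K)"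
      using K by (simp add: power_divide power2_eq_square)
    also have "(\<integral>\<omega>. (?E t \<omega>)\<^sup>2 \<partial>M) = (\<integral>\<omega>. (?J m t \<omega> - I t \<omega>)\<^sup>2 \<partial>M)" by (simp add: power2_commute)
    finally show ?thesis using m by linarith
  qed
  have "(\<lambda>K. 16 / \<delta>\<^sup>2 * C * t\<^sup>2 * (1 / real K)) \<longlonglongrightarrow> 0"
    using tendsto_mult_left[OF lim_1_over_n, of "16 / \<delta>\<^sup>2 * C * t\<^sup>2"] by simp
  then have "\<forall>\<^sub>F K in sequentially. 16 / \<delta>\<^sup>2 * C * t\<^sup>2 * (1 / real K) < r / 2"
    using r by (intro order_tendstoD(2)) auto
  with eventually_gt_at_top[of 0]
  have "\<forall>\<^sub>F K in sequentially. norm ((\<Sum>k<K. \<integral>\<omega>. ?F K k \<omega> \<partial>M) - 0) < r"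
  proof eventually_elim
    case (elim K)
    show ?case using sum_le[OF elim(1)] elim(2) unfolding diff_0_right by linarith
  qed
  then show "\<exists>no. \<forall>K\<ge>no. norm ((\<Sum>k<K. \<integral>\<omega>. ?F K k \<omega> \<partial>M) - 0) < r"
    by (simp only: eventually_sequentially)
qed

end

section \<open>Taylor estimates for compactly supported functions\<close>

lemma has_derivative_partial:
  fixes f :: "real^'n::finite \<Rightarrow> real"
  assumes "f differentiable (at x)"
  shows "(f has_derivative (\<lambda>h. \<Sum>i\<in>UNIV. h $ i * partial i f x)) (at x)"
proof -
  let ?D = "frechet_derivative f (at x)"
  have D: "(f has_derivative ?D) (at x)" using assms by (simp add: frechet_derivative_works)
  then have lin: "linear ?D" by (rule has_derivative_linear)
  have "?D h = (\<Sum>i\<in>UNIV. h $ i * partial i f x)" for h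
  proof -
    have "?D h = ?D (\<Sum>i\<in>UNIV. h $ i *\<^sub>R axis i 1)"
      using basis_expansion[of h] by (simp add: scalar_mult_eq_scaleR)
    also have "\<dots> = (\<Sum>i\<in>UNIV. h $ i * partial i f x)"
      using lin by (simp add: linear_sum linear_scale partial_def o_def)
    finally show ?thesis .
  qed
  then have "?D = (\<lambda>h. \<Sum>i\<in>UNIV. h $ i * partial i f x)" by (rule ext)
  with D show ?thesis by (simp only:)
qed

lemma partial_eqI:
  assumes "(f has_derivative D) (at x)"
  shows "partial i f x = D (axis i 1)"
  unfolding partial_def using frechet_derivative_at[OF assms] by metis

lemma partial_add:
  assumes "f differentiable (at x)" "g differentiable (at x)"
  shows "partial i (\<lambda>x. f x + g x) x = partial i f x + partial i g x"
proof -
  have "((\<lambda>x. f x + g x) has_derivative (\<lambda>h. frechet_derivative f (at x) h + frechet_derivative g (at x) h)) (at x)"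
    using assms by (intro has_derivative_add) (simp_all add: frechet_derivative_works)
  from partial_eqI[OF this] show ?thesis by (simp add: partial_def)
qed

text \<open>Off the closed support \<open>f\<close> vanishes in a whole neighbourhood, so its
  derivative does too. Compact support is thereby inherited by all derivatives.\<close>

lemma partial_eq_0:
  assumes "x \<notin> closure {x. f x \<noteq> 0}"
  shows "partial i f x = 0"
proof -
  have "((\<lambda>_. 0) has_derivative (\<lambda>_. 0)) (at x)" by simp
  then have "(f has_derivative (\<lambda>_. 0)) (at x)"
    by (rule has_derivative_transform_within_open[of _ _ x UNIV "- closure {x. f x \<noteq> 0}"])
       (use assms closure_subset[of "{x. f x \<noteq> 0}"] in auto)
  from partial_eqI[OF this] show ?thesis by simp
qed

lemma has_real_derivative_along_line:
  fixes f :: "real^'n::finite \<Rightarrow> real"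
  assumes "\<And>x. f differentiable (at x)"
  shows "((\<lambda>\<theta>. f (x + \<theta> *\<^sub>R h)) has_real_derivative (\<Sum>i\<in>UNIV. h $ i * partial i f (x + \<theta> *\<^sub>R h))) (at \<theta>)"
proof -
  have "((\<lambda>\<theta>. x + \<theta> *\<^sub>R h) has_derivative (\<lambda>r. r *\<^sub>R h)) (at \<theta>)"
    by (auto intro!: derivative_eq_intros)
  from has_derivative_compose[OF this has_derivative_partial[OF assms]]
  show ?thesis unfolding has_field_derivative_def
    by (simp add: mult.assoc sum_distrib_left[symmetric] mult.commute[of _ "\<Sum>i\<in>UNIV. _ i"] fun_eq_iff
        del: sum_distrib_left)
qed

lemma mean_value_partial:
  fixes f :: "real^'n::finite \<Rightarrow> real"
  assumes "\<And>x. f differentiable (at x)"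
  shows "\<exists>\<theta>. 0 < \<theta> \<and> \<theta> < 1 \<and> f (x + h) - f x = (\<Sum>i\<in>UNIV. h $ i * partial i f (x + \<theta> *\<^sub>R h))"
proof -
  have "\<exists>\<theta>>0. \<theta> < 1 \<and> f (x + 1 *\<^sub>R h) - f (x + 0 *\<^sub>R h) = (1 - 0) * (\<Sum>i\<in>UNIV. h $ i * partial i f (x + \<theta> *\<^sub>R h))"
    by (rule MVT2) (use has_real_derivative_along_line[OF assms] in auto)
  then show ?thesis by simp
qed

lemma taylor_partial:
  fixes f :: "real^'n::finite \<Rightarrow> real"
  assumes f: "\<And>x. f differentiable (at x)" and Df: "\<And>i x. partial i f differentiable (at x)"
  shows "\<exists>\<theta>. 0 < \<theta> \<and> \<theta> < 1 \<and> f (x + h) - f x - (\<Sum>i\<in>UNIV. h $ i * partial i f x)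
    = 1 / 2 * (\<Sum>i\<in>UNIV. \<Sum>j\<in>UNIV. partial i (partial j f) (x + \<theta> *\<^sub>R h) * (h $ i * h $ j))"
proof -
  \<comment> \<open>The derivatives of orders 0, 1 and 2 of the restriction of \<open>f\<close> to
    the line through \<open>x\<close> in direction \<open>h\<close>, in the form that the
    one-variable Maclaurin formula takes.\<close>
  define g where "g m \<theta> = (if m = 0 then f (x + \<theta> *\<^sub>R h) else if m = 1 then \<Sum>j\<in>UNIV. h $ j * partial j f (x + \<theta> *\<^sub>R h)
     else \<Sum>j\<in>UNIV. h $ j * (\<Sum>i\<in>UNIV. h $ i * partial i (partial j f) (x + \<theta> *\<^sub>R h)))" for m :: nat and \<theta>
  have "DERIV (g m) \<theta> :> g (Suc m) \<theta>" if "m < 2" for m \<theta>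
  proof (cases "m = 0")
    case True
    then show ?thesis using has_real_derivative_along_line[OF f] by (simp add: g_def[abs_def])
  next
    case False
    then have "m = 1" using that by simp
    moreover have "((\<lambda>\<theta>. \<Sum>j\<in>UNIV. h $ j * partial j f (x + \<theta> *\<^sub>R h)) has_real_derivative
      (\<Sum>j\<in>UNIV. h $ j * (\<Sum>i\<in>UNIV. h $ i * partial i (partial j f) (x + \<theta> *\<^sub>R h)))) (at \<theta>)"
      by (intro DERIV_sum DERIV_cmult has_real_derivative_along_line Df)
    ultimately show ?thesis by (simp add: g_def[abs_def])
  qed
  then have "\<exists>\<theta>. 0 < \<theta> \<and> \<theta> < 1 \<and> f (x + 1 *\<^sub>R h) = (\<Sum>m<2. g m 0 / fact m * 1 ^ m) + g 2 \<theta> / fact 2 * 1 ^ 2"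
    by (intro Maclaurin) (auto simp only: g_def[of 0] fun_eq_iff if_True simp_thms zero_less_one zero_less_numeral)
  then obtain \<theta> where \<theta>: "0 < \<theta>" "\<theta> < 1" "f (x + h) = g 0 0 + g 1 0 + g 2 \<theta> / 2"
    by (auto simp: numeral_2_eq_2)
  have "g 2 \<theta> = (\<Sum>j\<in>UNIV. \<Sum>i\<in>UNIV. partial i (partial j f) (x + \<theta> *\<^sub>R h) * (h $ i * h $ j))"
    by (simp add: g_def sum_distrib_left mult_ac)
  also have "\<dots> = (\<Sum>i\<in>UNIV. \<Sum>j\<in>UNIV. partial i (partial j f) (x + \<theta> *\<^sub>R h) * (h $ i * h $ j))"
    by (rule sum.swap)
  finally show ?thesis using \<theta> by (intro exI[of _ \<theta>]) (simp add: g_def)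
qed

lemma compactly_supported_bounded:
  fixes g :: "real^'n::finite \<Rightarrow> real"
  assumes "continuous_on UNIV g" "compact S" "\<And>x. x \<notin> S \<Longrightarrow> g x = 0"
  shows "\<exists>K>0. \<forall>x. \<bar>g x\<bar> \<le> K"
proof -
  have "compact (g ` S)" using assms by (meson compact_continuous_image continuous_on_subset subset_UNIV)
  then obtain K where K: "K > 0" "\<And>x. x \<in> S \<Longrightarrow> \<bar>g x\<bar> \<le> K"
    by (metis bounded_pos compact_imp_bounded image_eqI real_norm_def)
  then show ?thesis using assms(3) by (intro exI[of _ K]) (metis abs_zero less_imp_le)
qed

lemma compactly_supported_uniformly_continuous:
  fixes g :: "real^'n::finite \<Rightarrow> real"
  assumes g: "continuous_on UNIV g" "compact S" "\<And>x. x \<notin> S \<Longrightarrow> g x = 0" and e: "e > 0"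
  shows "\<exists>\<delta>>0. \<forall>x y. dist x y < \<delta> \<longrightarrow> dist (g x) (g y) < e"
proof -
  obtain R where R: "\<And>x. x \<in> S \<Longrightarrow> norm x \<le> R" using compact_imp_bounded[OF g(2)] by (auto simp: bounded_iff)
  have "uniformly_continuous_on (cball 0 (R + 1)) g"
    using g(1) by (intro compact_uniformly_continuous) (auto intro: continuous_on_subset)
  then obtain d where d: "d > 0" "\<And>x y. x \<in> cball 0 (R + 1) \<Longrightarrow> y \<in> cball 0 (R + 1) \<Longrightarrow> dist y x < d \<Longrightarrow> dist (g y) (g x) < e"
    unfolding uniformly_continuous_on_def using e by meson
  \<comment> \<open>The cap 1 forces both points into the ball of radius \<open>R + 1\<close> as
    soon as one of them lies in \<open>S\<close>; if neither does, both values are 0.\<close>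
  have "dist (g x) (g y) < e" if xy: "dist x y < min d 1" for x y
  proof (cases "x \<in> S \<or> y \<in> S")
    case True
    have "norm x \<le> norm y + dist x y" "norm y \<le> norm x + dist x y"
      using norm_triangle_sub[of x y] norm_triangle_sub[of y x] by (auto simp: dist_norm norm_minus_commute)
    then have "x \<in> cball 0 (R + 1)" "y \<in> cball 0 (R + 1)" using True R[of x] R[of y] xy by auto
    then show ?thesis using d(2)[of y x] xy by auto
  qed (use g(3) e in auto)
  then show ?thesis using d(1) by (intro exI[of _ "min d 1"]) auto
qed

lemma differentiable_imp_continuous: "(\<And>x. f differentiable (at x)) \<Longrightarrow> continuous_on UNIV f"
  by (simp add: continuous_at_imp_continuous_on differentiable_imp_continuous_within)

lemma Cc2D:
  fixes f :: "real^'n::finite \<Rightarrow> real"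
  assumes f: "f \<in> Cc2"
  shows "f differentiable (at x)" "partial i f differentiable (at x)" "continuous_on UNIV f"
    "continuous_on UNIV (partial i f)" "continuous_on UNIV (partial i (partial j f))"
    and "\<exists>K>0. \<forall>x. \<bar>f x\<bar> \<le> K \<and> (\<forall>i. \<bar>partial i f x\<bar> \<le> K) \<and> (\<forall>i j. \<bar>partial i (partial j f) x\<bar> \<le> K)"
    and "e > 0 \<Longrightarrow> \<exists>\<delta>>0. \<forall>i j x y. dist x y < \<delta> \<longrightarrow> dist (partial i (partial j f) x) (partial i (partial j f) y) < e"
proof -
  have C: "Ck (Suc (Suc 0)) f" and cs: "compact (closure {x. f x \<noteq> 0})"
    using f by (auto simp: Cc2_def compact_support_def numeral_2_eq_2)
  show d1: "f differentiable (at x)" and d2: "partial i f differentiable (at x)" for i x using C by auto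
  show c0: "continuous_on UNIV f" and c1: "continuous_on UNIV (partial i f)" and c2: "continuous_on UNIV (partial i (partial j f))" for i j
    using C d1 d2 by (auto intro: differentiable_imp_continuous)
  let ?S = "closure {x. f x \<noteq> 0}"
  have z0: "f x = 0" and z1: "partial i f x = 0" if "x \<notin> ?S" for x i
    using that closure_subset[of "{x. f x \<noteq> 0}"] partial_eq_0[OF that] by auto
  have z2: "partial i (partial j f) x = 0" if "x \<notin> ?S" for x i j
  proof (rule partial_eq_0)
    have "{x. partial j f x \<noteq> 0} \<subseteq> ?S" using z1 by blast
    then show "x \<notin> closure {x. partial j f x \<noteq> 0}" using that closure_minimal by blast
  qed
  obtain K0 where K0: "K0 > 0" "\<And>x. \<bar>f x\<bar> \<le> K0" using compactly_supported_bounded[OF c0 cs z0] by auto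
  have "\<forall>i. \<exists>K>0. \<forall>x. \<bar>partial i f x\<bar> \<le> K" using compactly_supported_bounded[OF c1 cs z1] by auto
  then obtain K1 where K1: "\<And>i. K1 i > 0" "\<And>i x. \<bar>partial i f x\<bar> \<le> K1 i" by metis
  have "\<forall>i j. \<exists>K>0. \<forall>x. \<bar>partial i (partial j f) x\<bar> \<le> K" using compactly_supported_bounded[OF c2 cs z2] by auto
  then obtain K2 where K2: "\<And>i j. K2 i j > 0" "\<And>i j x. \<bar>partial i (partial j f) x\<bar> \<le> K2 i j" by metis
  show "\<exists>K>0. \<forall>x. \<bar>f x\<bar> \<le> K \<and> (\<forall>i. \<bar>partial i f x\<bar> \<le> K) \<and> (\<forall>i j. \<bar>partial i (partial j f) x\<bar> \<le> K)"
  proof (intro exI[of _ "K0 + (\<Sum>i\<in>UNIV. K1 i) + (\<Sum>i\<in>UNIV. \<Sum>j\<in>UNIV. K2 i j)"] conjI allI)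
    have p1: "0 \<le> (\<Sum>i\<in>UNIV. K1 i)" "0 \<le> (\<Sum>i\<in>UNIV. \<Sum>j\<in>UNIV. K2 i j)"
      by (intro sum_nonneg order_less_imp_le[OF K1(1)] order_less_imp_le[OF K2(1)])+
    then show "K0 + (\<Sum>i\<in>UNIV. K1 i) + (\<Sum>i\<in>UNIV. \<Sum>j\<in>UNIV. K2 i j) > 0" using K0(1) by linarith
    fix x
    show "\<bar>f x\<bar> \<le> K0 + (\<Sum>i\<in>UNIV. K1 i) + (\<Sum>i\<in>UNIV. \<Sum>j\<in>UNIV. K2 i j)" using K0(2)[of x] p1 by linarith
    fix i
    have "K1 i \<le> (\<Sum>i\<in>UNIV. K1 i)" using K1(1) by (intro member_le_sum) (auto intro: less_imp_le)
    then show "\<bar>partial i f x\<bar> \<le> K0 + (\<Sum>i\<in>UNIV. K1 i) + (\<Sum>i\<in>UNIV. \<Sum>j\<in>UNIV. K2 i j)"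
      using K0(1) K1(2)[of i x] p1 by linarith
    fix j
    have "K2 i j \<le> (\<Sum>j\<in>UNIV. K2 i j)" using K2(1) by (intro member_le_sum) (auto intro: less_imp_le)
    also have "\<dots> \<le> (\<Sum>i\<in>UNIV. \<Sum>j\<in>UNIV. K2 i j)"
      by (intro member_le_sum[of i UNIV "\<lambda>i. \<Sum>j\<in>UNIV. K2 i j"] sum_nonneg order_less_imp_le[OF K2(1)]) simp_all
    finally show "\<bar>partial i (partial j f) x\<bar> \<le> K0 + (\<Sum>i\<in>UNIV. K1 i) + (\<Sum>i\<in>UNIV. \<Sum>j\<in>UNIV. K2 i j)"
      using K0(1) K2(2)[of i j x] p1 by linarith
  qed
  assume e: "e > 0"
  have "\<forall>i j. \<exists>\<delta>>0. \<forall>x y. dist x y < \<delta> \<longrightarrow> dist (partial i (partial j f) x) (partial i (partial j f) y) < e"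
    using compactly_supported_uniformly_continuous[OF c2 cs z2 e] by auto
  then obtain d where d: "\<And>i j. d i j > 0"
    "\<And>i j x y. dist x y < d i j \<Longrightarrow> dist (partial i (partial j f) x) (partial i (partial j f) y) < e" by metis
  show "\<exists>\<delta>>0. \<forall>i j x y. dist x y < \<delta> \<longrightarrow> dist (partial i (partial j f) x) (partial i (partial j f) y) < e"
  proof (intro exI[of _ "Min (range (\<lambda>(i, j). d i j))"] conjI allI impI)
    show "0 < Min (range (\<lambda>(i, j). d i j))" using d(1) by (subst Min_gr_iff) auto
    fix i j and x y :: "real^'n" assume xy: "dist x y < Min (range (\<lambda>(i, j). d i j))"
    have "Min (range (\<lambda>(i, j). d i j)) \<le> d i j" by (rule Min_le) (auto intro: image_eqI[of _ _ "(i, j)"])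
    then show "dist (partial i (partial j f) x) (partial i (partial j f) y) < e" using d(2) xy by force
  qed
qed

text \<open>The mean value theorem is applied to the step \<open>a\<close> and then once more to the
  partial derivatives. The two bounds inside the minimum serve dominated convergence: the first is
  uniform, the second tends to 0 with the increments.\<close>

lemma Cc2_first_order:
  fixes f :: "real^'n::finite \<Rightarrow> real"
  assumes f: "f \<in> Cc2" and K: "\<And>x i. \<bar>partial i f x\<bar> \<le> K" "\<And>x i j. \<bar>partial i (partial j f) x\<bar> \<le> K"
  shows "\<bar>f (x + h + a) - f (x + h) - (\<Sum>i\<in>UNIV. a $ i * partial i f x)\<bar>
    \<le> (\<Sum>i\<in>UNIV. \<bar>a $ i\<bar>) * min (2 * K) (K * (\<Sum>i\<in>UNIV. \<bar>h $ i\<bar> + \<bar>a $ i\<bar>))"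
proof -
  obtain \<theta> where \<theta>: "0 < \<theta>" "\<theta> < 1" "f (x + h + a) - f (x + h) = (\<Sum>i\<in>UNIV. a $ i * partial i f (x + h + \<theta> *\<^sub>R a))"
    using mean_value_partial[OF Cc2D(1)[OF f], of "x + h" a] by blast
  have K0: "0 \<le> K" using K(1)[of undefined undefined] by linarith
  have le: "\<bar>partial i f (x + h + \<theta> *\<^sub>R a) - partial i f x\<bar> \<le> min (2 * K) (K * (\<Sum>i\<in>UNIV. \<bar>h $ i\<bar> + \<bar>a $ i\<bar>))" for i
  proof (rule min.boundedI)
    show "\<bar>partial i f (x + h + \<theta> *\<^sub>R a) - partial i f x\<bar> \<le> 2 * K"
      using K(1)[of i "x + h + \<theta> *\<^sub>R a"] K(1)[of i x] by linarith
    let ?y = "h + \<theta> *\<^sub>R a"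
    obtain \<eta> where \<eta>: "partial i f (x + ?y) - partial i f x = (\<Sum>j\<in>UNIV. ?y $ j * partial j (partial i f) (x + \<eta> *\<^sub>R ?y))"
      using mean_value_partial[OF Cc2D(2)[OF f], of i x ?y] by blast
    have "\<bar>partial i f (x + ?y) - partial i f x\<bar> \<le> (\<Sum>j\<in>UNIV. \<bar>?y $ j * partial j (partial i f) (x + \<eta> *\<^sub>R ?y)\<bar>)"
      unfolding \<eta> by (rule sum_abs)
    also have "\<dots> \<le> (\<Sum>j\<in>UNIV. (\<bar>h $ j\<bar> + \<bar>a $ j\<bar>) * K)"
    proof (rule sum_mono)
      fix j
      have "\<bar>\<theta> * a $ j\<bar> \<le> 1 * \<bar>a $ j\<bar>" unfolding abs_mult using \<theta> by (intro mult_right_mono) auto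
      then have "\<bar>?y $ j\<bar> \<le> \<bar>h $ j\<bar> + \<bar>a $ j\<bar>" using abs_triangle_ineq[of "h $ j" "\<theta> * a $ j"] by simp
      then show "\<bar>?y $ j * partial j (partial i f) (x + \<eta> *\<^sub>R ?y)\<bar> \<le> (\<bar>h $ j\<bar> + \<bar>a $ j\<bar>) * K"
        unfolding abs_mult using K(2) by (intro mult_mono) auto
    qed
    also have "\<dots> = K * (\<Sum>i\<in>UNIV. \<bar>h $ i\<bar> + \<bar>a $ i\<bar>)" by (simp add: sum_distrib_left mult.commute)
    finally show "\<bar>partial i f (x + h + \<theta> *\<^sub>R a) - partial i f x\<bar> \<le> K * (\<Sum>i\<in>UNIV. \<bar>h $ i\<bar> + \<bar>a $ i\<bar>)"
      by (simp add: add.assoc)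
  qed
  have "f (x + h + a) - f (x + h) - (\<Sum>i\<in>UNIV. a $ i * partial i f x)
      = (\<Sum>i\<in>UNIV. a $ i * (partial i f (x + h + \<theta> *\<^sub>R a) - partial i f x))"
    unfolding \<theta>(3) by (simp add: sum_subtractf[symmetric] right_diff_distrib)
  also have "\<bar>\<dots>\<bar> \<le> (\<Sum>i\<in>UNIV. \<bar>a $ i * (partial i f (x + h + \<theta> *\<^sub>R a) - partial i f x)\<bar>)" by (rule sum_abs)
  also have "\<dots> \<le> (\<Sum>i\<in>UNIV. \<bar>a $ i\<bar> * min (2 * K) (K * (\<Sum>i\<in>UNIV. \<bar>h $ i\<bar> + \<bar>a $ i\<bar>)))"
    unfolding abs_mult using le by (intro sum_mono mult_left_mono) auto
  finally show ?thesis by (simp add: sum_distrib_right)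
qed

text \<open>Either all coordinates of \<open>h\<close> are small and the Hessian hardly varies, or
  some coordinate exceeds \<delta>; then the largest one does, and its square controls all the
  others. The truncation acts on each coordinate separately because the Lindeberg property is known
  for scalar integrals.\<close>

lemma Cc2_second_order:
  fixes f :: "real^'n::finite \<Rightarrow> real"
  assumes f: "f \<in> Cc2" and K: "\<And>x i j. \<bar>partial i (partial j f) x\<bar> \<le> K" and e: "e > 0"
  shows "\<exists>\<delta>>0. \<forall>x h. \<bar>f (x + h) - f x - (\<Sum>i\<in>UNIV. h $ i * partial i f x)
      - 1 / 2 * (\<Sum>i\<in>UNIV. \<Sum>j\<in>UNIV. partial i (partial j f) x * (h $ i * h $ j))\<bar>
    \<le> (\<Sum>i\<in>UNIV. e * (h $ i)\<^sup>2 + K * (real CARD('n))\<^sup>2 * (if \<delta> < \<bar>h $ i\<bar> then (h $ i)\<^sup>2 else 0))"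
proof -
  let ?n = "real CARD('n)"
  have n: "?n > 0" by simp
  have K0: "0 \<le> K" using K[of undefined undefined undefined] by linarith
  have "2 * e / ?n > 0" using e by simp
  \<comment> \<open>The tolerance \<open>2 * e / ?n\<close> cancels against the factor 1/2 of the
    Taylor term and the factor \<open>?n\<close> of the bound \<open>quad\<close> below.\<close>
  then obtain d where d: "d > 0" "\<And>i j x y. dist x y < d \<Longrightarrow> dist (partial i (partial j f) x) (partial i (partial j f) y) < 2 * e / ?n"
    using Cc2D(7)[OF f, of "2 * e / ?n"] by blast
  \<comment> \<open>If all coordinates are at most \<delta>, the sum of their absolute values is at
    most \<open>d / 2\<close>, which keeps the intermediate point within distance \<open>d\<close>
    of \<open>x\<close>.\<close>
  define \<delta> where "\<delta> = d / (2 * ?n)"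
  have \<delta>: "\<delta> > 0" using d(1) by (simp add: \<delta>_def)
  have quad: "(\<Sum>i\<in>UNIV. \<Sum>j\<in>UNIV. \<bar>h $ i * h $ j\<bar>) \<le> ?n * (\<Sum>i\<in>UNIV. (h $ i)\<^sup>2)" for h :: "real^'n"
  proof -
    have "(\<Sum>i\<in>UNIV. \<Sum>j\<in>UNIV. \<bar>h $ i * h $ j\<bar>) = (\<Sum>i\<in>UNIV. \<bar>h $ i\<bar>)\<^sup>2"
      by (simp add: power2_eq_square sum_product abs_mult)
    also have "\<dots> \<le> (\<Sum>i\<in>UNIV. \<bar>h $ i\<bar>\<^sup>2) * real (card (UNIV :: 'n set))" by (rule sum_squared_le_sum_of_squares)
    finally show ?thesis by (simp add: mult.commute)
  qed
  show ?thesis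
  proof (intro exI[of _ \<delta>] conjI \<delta> allI)
    fix x h :: "real^'n"
    let ?R = "f (x + h) - f x - (\<Sum>i\<in>UNIV. h $ i * partial i f x)
      - 1 / 2 * (\<Sum>i\<in>UNIV. \<Sum>j\<in>UNIV. partial i (partial j f) x * (h $ i * h $ j))"
    obtain \<theta> where \<theta>: "0 < \<theta>" "\<theta> < 1" "f (x + h) - f x - (\<Sum>i\<in>UNIV. h $ i * partial i f x)
      = 1 / 2 * (\<Sum>i\<in>UNIV. \<Sum>j\<in>UNIV. partial i (partial j f) (x + \<theta> *\<^sub>R h) * (h $ i * h $ j))"
      using taylor_partial[OF Cc2D(1)[OF f] Cc2D(2)[OF f]] by blast
    let ?D = "\<lambda>i j. partial i (partial j f) (x + \<theta> *\<^sub>R h) - partial i (partial j f) x"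
    have R: "?R = 1 / 2 * (\<Sum>i\<in>UNIV. \<Sum>j\<in>UNIV. ?D i j * (h $ i * h $ j))"
      unfolding \<theta>(3) by (simp add: left_diff_distrib sum_subtractf right_diff_distrib)
    have bound: "\<bar>?R\<bar> \<le> c / 2 * (?n * (\<Sum>i\<in>UNIV. (h $ i)\<^sup>2))" if c: "\<And>i j. \<bar>?D i j\<bar> \<le> c" for c
    proof -
      have c0: "0 \<le> c" using c[of undefined undefined] by linarith
      have "\<bar>\<Sum>i\<in>UNIV. \<Sum>j\<in>UNIV. ?D i j * (h $ i * h $ j)\<bar> \<le> (\<Sum>i\<in>UNIV. \<Sum>j\<in>UNIV. \<bar>?D i j * (h $ i * h $ j)\<bar>)"
        by (intro order_trans[OF sum_abs] sum_mono sum_abs)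
      also have "\<dots> \<le> (\<Sum>i\<in>UNIV. \<Sum>j\<in>UNIV. c * \<bar>h $ i * h $ j\<bar>)"
        unfolding abs_mult[of "?D _ _"] using c by (intro sum_mono mult_right_mono) auto
      also have "\<dots> = c * (\<Sum>i\<in>UNIV. \<Sum>j\<in>UNIV. \<bar>h $ i * h $ j\<bar>)" by (simp add: sum_distrib_left)
      also have "\<dots> \<le> c * (?n * (\<Sum>i\<in>UNIV. (h $ i)\<^sup>2))" by (intro mult_left_mono quad c0)
      finally show ?thesis unfolding R by (simp add: abs_mult)
    qed
    show "\<bar>?R\<bar> \<le> (\<Sum>i\<in>UNIV. e * (h $ i)\<^sup>2 + K * ?n\<^sup>2 * (if \<delta> < \<bar>h $ i\<bar> then (h $ i)\<^sup>2 else 0))"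
    proof (cases "\<forall>i. \<bar>h $ i\<bar> \<le> \<delta>")
      case True
      have "norm h \<le> (\<Sum>i\<in>UNIV. \<bar>h $ i\<bar>)" by (rule norm_le_l1_cart)
      also have "\<dots> \<le> (\<Sum>i\<in>(UNIV::'n set). \<delta>)" using True by (intro sum_mono) auto
      also have "\<dots> = d / 2" by (simp add: \<delta>_def)
      also have "\<dots> < d" using d(1) by simp
      finally have "norm h < d" .
      moreover have "\<theta> * norm h \<le> 1 * norm h" using \<theta> by (intro mult_right_mono) auto
      ultimately have "dist (x + \<theta> *\<^sub>R h) x < d" using \<theta> by (simp add: dist_norm)
      then have "\<bar>?D i j\<bar> \<le> 2 * e / ?n" for i j using d(2)[of "x + \<theta> *\<^sub>R h" x i j] by (simp add: dist_real_def)
      from bound[OF this] have "\<bar>?R\<bar> \<le> e * (\<Sum>i\<in>UNIV. (h $ i)\<^sup>2)" by simp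
      also have "\<dots> = (\<Sum>i\<in>UNIV. e * (h $ i)\<^sup>2)" by (simp add: sum_distrib_left)
      also have "\<dots> \<le> (\<Sum>i\<in>UNIV. e * (h $ i)\<^sup>2 + K * ?n\<^sup>2 * (if \<delta> < \<bar>h $ i\<bar> then (h $ i)\<^sup>2 else 0))"
        using K0 by (intro sum_mono) auto
      finally show ?thesis .
    next
      case False
      then obtain i0 where "\<not> \<bar>h $ i0\<bar> \<le> \<delta>" by blast
      then have i0: "\<delta> < \<bar>h $ i0\<bar>" by simp
      obtain m where m: "\<And>i. \<bar>h $ i\<bar> \<le> \<bar>h $ m\<bar>"
        using Max_in[of "range (\<lambda>i. \<bar>h $ i\<bar>)"] Max_ge[of "range (\<lambda>i. \<bar>h $ i\<bar>)"] by fastforce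
      then have \<delta>m: "\<delta> < \<bar>h $ m\<bar>" using i0 order_less_le_trans by blast
      have "\<bar>?D i j\<bar> \<le> 2 * K" for i j
        using K[of i j "x + \<theta> *\<^sub>R h"] K[of i j x] by linarith
      from bound[OF this] have "\<bar>?R\<bar> \<le> K * ?n * (\<Sum>i\<in>UNIV. (h $ i)\<^sup>2)" by (simp add: mult.assoc)
      also have "\<dots> \<le> K * ?n * (\<Sum>i\<in>(UNIV::'n set). (h $ m)\<^sup>2)"
        using K0 m by (intro mult_left_mono sum_mono) (auto simp: abs_le_square_iff[symmetric])
      also have "\<dots> = K * ?n\<^sup>2 * (if \<delta> < \<bar>h $ m\<bar> then (h $ m)\<^sup>2 else 0)" using \<delta>m by (simp add: power2_eq_square)
      also have "\<dots> \<le> (\<Sum>i\<in>UNIV. K * ?n\<^sup>2 * (if \<delta> < \<bar>h $ i\<bar> then (h $ i)\<^sup>2 else 0))"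
        using K0 by (intro member_le_sum[of m UNIV "\<lambda>i. K * ?n\<^sup>2 * (if \<delta> < \<bar>h $ i\<bar> then (h $ i)\<^sup>2 else 0)"]) auto
      also have "\<dots> \<le> (\<Sum>i\<in>UNIV. e * (h $ i)\<^sup>2 + K * ?n\<^sup>2 * (if \<delta> < \<bar>h $ i\<bar> then (h $ i)\<^sup>2 else 0))"
        using e by (intro sum_mono) auto
      finally show ?thesis .
    qed
  qed
qed

section \<open>The expected Ito formula\<close>

definition part_point :: "real \<Rightarrow> nat \<Rightarrow> nat \<Rightarrow> real" where
  "part_point t N k = real k * t / real N"

text \<open>For \<open>N > 0\<close> and \<open>s\<close> in \<open>{0<..t}\<close>, the index of
  the partition interval that contains \<open>s\<close>. The intervals are open on the left, hence
  the ceiling minus 1 instead of the floor.\<close>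

definition part_index :: "real \<Rightarrow> nat \<Rightarrow> real \<Rightarrow> nat" where
  "part_index t N s = nat (\<lceil>real N * s / t\<rceil> - 1)"

lemma part_point_0: "part_point t N 0 = 0"
  by (simp add: part_point_def)

lemma part_point_N: "N > 0 \<Longrightarrow> part_point t N N = t"
  by (simp add: part_point_def)

lemma part_point_mono: "0 \<le> t \<Longrightarrow> part_point t N k \<le> part_point t N (Suc k)"
  unfolding part_point_def by (intro divide_right_mono mult_right_mono) auto

lemma part_point_in:
  assumes "0 \<le> t" "k \<le> N"
  shows "part_point t N k \<in> {0..t}"
proof -
  have "real k * t / real N \<le> 1 * t"
    using assms by (cases "N = 0") (auto simp: pos_divide_le_eq mult.commute intro!: mult_left_mono)
  then show ?thesis using assms by (simp add: part_point_def)
qed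

lemma part_index_iff:
  assumes t: "t > 0" and N: "N > 0" and s: "s \<in> {0<..t}"
  shows "s \<in> {part_point t N k<..part_point t N (Suc k)} \<longleftrightarrow> k = part_index t N s"
    and "part_index t N s < N"
proof -
  have "real N * s / t > 0" using assms by simp
  then have c: "\<lceil>real N * s / t\<rceil> \<ge> 1" by linarith
  have "s \<in> {part_point t N k<..part_point t N (Suc k)} \<longleftrightarrow> real k < real N * s / t \<and> real N * s / t \<le> real k + 1"
    using t N by (auto simp: part_point_def field_simps)
  also have "\<dots> \<longleftrightarrow> \<lceil>real N * s / t\<rceil> = int k + 1" by (simp add: ceiling_eq_iff)
  also have "\<dots> \<longleftrightarrow> k = part_index t N s" using c unfolding part_index_def by auto
  finally show "s \<in> {part_point t N k<..part_point t N (Suc k)} \<longleftrightarrow> k = part_index t N s" .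
  have "real N * s / t \<le> real N" using assms by (simp add: pos_divide_le_eq)
  then have "\<lceil>real N * s / t\<rceil> \<le> int N" by (simp add: ceiling_le_iff)
  then show "part_index t N s < N" using c unfolding part_index_def by linarith
qed

lemma part_point_tendsto:
  assumes t: "t > 0" and s: "s \<in> {0<..t}"
  shows "(\<lambda>N. part_point t N (part_index t N s)) \<longlonglongrightarrow> s"
    and "(\<lambda>N. part_point t N (Suc (part_index t N s))) \<longlonglongrightarrow> s"
proof -
  have bounds: "part_point t N (part_index t N s) < s" "s \<le> part_point t N (Suc (part_index t N s))" if "N > 0" for N
    using part_index_iff(1)[OF t that s, of "part_index t N s"] by auto
  have diff: "part_point t N (Suc k) - part_point t N k = t * (1 / real N)" for N k
    unfolding part_point_def by (simp add: diff_divide_distrib[symmetric] algebra_simps)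
  have lim0: "(\<lambda>N. t * (1 / real N)) \<longlonglongrightarrow> 0" using tendsto_mult_left[OF lim_1_over_n, of t] by simp
  show "(\<lambda>N. part_point t N (part_index t N s)) \<longlonglongrightarrow> s"
  proof (rule tendsto_sandwich)
    show "\<forall>\<^sub>F N in sequentially. s - t * (1 / real N) \<le> part_point t N (part_index t N s)"
      using eventually_gt_at_top[of 0]
    proof eventually_elim
      case (elim N)
      then show ?case using bounds[of N] diff[of N "part_index t N s"] by linarith
    qed
    show "\<forall>\<^sub>F N in sequentially. part_point t N (part_index t N s) \<le> s"
      using eventually_gt_at_top[of 0] by eventually_elim (use bounds in \<open>auto intro: less_imp_le\<close>)
    show "(\<lambda>N. s - t * (1 / real N)) \<longlonglongrightarrow> s" using tendsto_diff[OF tendsto_const lim0, of s] by simp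
  qed simp
  show "(\<lambda>N. part_point t N (Suc (part_index t N s))) \<longlonglongrightarrow> s"
  proof (rule tendsto_sandwich)
    show "\<forall>\<^sub>F N in sequentially. part_point t N (Suc (part_index t N s)) \<le> s + t * (1 / real N)"
      using eventually_gt_at_top[of 0]
    proof eventually_elim
      case (elim N)
      then show ?case using bounds[of N] diff[of N "part_index t N s"] by linarith
    qed
    show "\<forall>\<^sub>F N in sequentially. s \<le> part_point t N (Suc (part_index t N s))"
      using eventually_gt_at_top[of 0] by eventually_elim (use bounds in auto)
    show "(\<lambda>N. s + t * (1 / real N)) \<longlonglongrightarrow> s" using tendsto_add[OF tendsto_const lim0, of s] by simp
  qed simp
qed

section \<open>Riemann sums against integrable densities\<close>

context filtered_brownian
begin

lemma AE_time_product_snd: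
  assumes "AE \<omega> in M. P \<omega>"
  shows "AE x in time_product. P (snd x)"
proof -
  obtain N where N: "N \<in> null_sets M" "{\<omega> \<in> space M. \<not> P \<omega>} \<subseteq> N"
    using assms by (auto elim!: AE_E simp: null_sets_def)
  show ?thesis
  proof (rule AE_I')
    have "emeasure time_product (UNIV \<times> N) = emeasure lborel (UNIV :: real set) * emeasure M N"
      using N by (intro sigma_finite_measure.emeasure_pair_measure_Times)
        (auto intro: prob_space_imp_sigma_finite prob_space_axioms)
    then show "UNIV \<times> N \<in> null_sets time_product" using N by (intro null_setsI) auto
    show "{x \<in> space time_product. \<not> P (snd x)} \<subseteq> UNIV \<times> N"
      using N by (auto simp: space_pair_measure)
  qed
qed

text \<open>The intervals are disjoint, so the sum is a single integral in which \<open>Z N\<close>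
  is evaluated at the index of the interval containing the time. Only the weight is discretized and
  the density \<open>g\<close> is left as it is; dominated convergence with the bound
  \<open>\<bar>C\<bar> * \<bar>g x\<bar>\<close> therefore works for every integrable
  \<open>g\<close>.\<close>

lemma partition_sum_tendsto:
  fixes Z :: "nat \<Rightarrow> nat \<Rightarrow> 'w \<Rightarrow> real" and z g :: "real \<times> 'w \<Rightarrow> real"
  assumes t: "t > 0" and g: "integrable time_product g"
    and Z: "\<And>N k. k < N \<Longrightarrow> Z N k \<in> borel_measurable M" "\<And>N k \<omega>. k < N \<Longrightarrow> \<omega> \<in> space M \<Longrightarrow> \<bar>Z N k \<omega>\<bar> \<le> C"
    and z: "z \<in> borel_measurable time_product"
    and lim: "AE x in time_product. fst x \<in> {0<..t} \<longrightarrow> (\<lambda>N. Z N (part_index t N (fst x)) (snd x)) \<longlonglongrightarrow> z x"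
  shows "integrable time_product (\<lambda>x. indicator {0<..t} (fst x) * z x * g x)"
    and "\<And>N k. k < N \<Longrightarrow> integrable time_product (\<lambda>x. indicator {part_point t N k<..part_point t N (Suc k)} (fst x) * Z N k (snd x) * g x)"
    and "(\<lambda>N. \<Sum>k<N. \<integral>x. indicator {part_point t N k<..part_point t N (Suc k)} (fst x) * Z N k (snd x) * g x \<partial>time_product)
      \<longlonglongrightarrow> (\<integral>x. indicator {0<..t} (fst x) * z x * g x \<partial>time_product)"
proof -
  let ?p = "part_point t" and ?F = "\<lambda>N k x. indicator {part_point t N k<..part_point t N (Suc k)} (fst x) * Z N k (snd x) * g x"
  have [measurable]: "g \<in> borel_measurable time_product" using g by auto
  note z[measurable]
  have Zm: "(\<lambda>x. Z N k (snd x)) \<in> borel_measurable time_product" if "k < N" for N k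
    by (rule measurable_compose[OF measurable_snd Z(1)[OF that]])
  show int: "integrable time_product (?F N k)" if k: "k < N" for N k
  proof (rule integrable_mult_bounded[OF _ g, where C="\<bar>C\<bar>"])
    show "(\<lambda>x. indicator {?p N k<..?p N (Suc k)} (fst x) * Z N k (snd x)) \<in> borel_measurable time_product"
      using Zm[OF k] by measurable
    fix x assume "x \<in> space time_product"
    then have "\<bar>Z N k (snd x)\<bar> \<le> C" using Z(2)[OF k] by (auto simp: space_pair_measure)
    then show "\<bar>indicator {?p N k<..?p N (Suc k)} (fst x) * Z N k (snd x)\<bar> \<le> \<bar>C\<bar>" by (auto simp: indicator_def)
  qed
  have F_eq: "(\<Sum>k<N. ?F N k x) = indicator {0<..t} (fst x) * Z N (part_index t N (fst x)) (snd x) * g x" if N: "N > 0" for N x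
  proof (cases "fst x \<in> {0<..t}")
    case True
    have "(\<Sum>k<N. ?F N k x) = (\<Sum>k<N. if k = part_index t N (fst x) then Z N k (snd x) * g x else 0)"
      using part_index_iff(1)[OF t N True] by (intro sum.cong) (auto simp: indicator_def simp del: greaterThanAtMost_iff)
    also have "\<dots> = Z N (part_index t N (fst x)) (snd x) * g x"
      using part_index_iff(2)[OF t N True] by simp
    finally show ?thesis using True by simp
  next
    case False
    have "fst x \<notin> {?p N k<..?p N (Suc k)}" if "k < N" for k
      using False part_point_in[of t k N] part_point_in[of t "Suc k" N] that t by auto
    then have "(\<Sum>k<N. ?F N k x) = (\<Sum>k<N. 0)" by (intro sum.cong) (auto simp del: greaterThanAtMost_iff)
    then show ?thesis using False by simp
  qed
  have bound: "norm (\<Sum>k<N. ?F N k x) \<le> \<bar>C\<bar> * \<bar>g x\<bar>" if x: "x \<in> space time_product" for N x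
  proof (cases "N > 0 \<and> fst x \<in> {0<..t}")
    case True
    then have "\<bar>Z N (part_index t N (fst x)) (snd x)\<bar> \<le> C"
      using Z(2)[OF part_index_iff(2)[OF t, of N "fst x"]] x by (auto simp: space_pair_measure)
    then show ?thesis using F_eq[of N x] True by (auto simp: abs_mult intro!: mult_right_mono)
  next
    case False
    then show ?thesis using F_eq[of N x] by (cases "N = 0") auto
  qed
  have lim': "AE x in time_product. (\<lambda>N. \<Sum>k<N. ?F N k x) \<longlonglongrightarrow> indicator {0<..t} (fst x) * z x * g x"
    using lim
  proof eventually_elim
    case (elim x)
    have "\<forall>\<^sub>F N in sequentially. indicator {0<..t} (fst x) * Z N (part_index t N (fst x)) (snd x) * g x = (\<Sum>k<N. ?F N k x)"
      using eventually_gt_at_top[of 0] by eventually_elim (simp only: F_eq)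
    moreover have "(\<lambda>N. indicator {0<..t} (fst x) * Z N (part_index t N (fst x)) (snd x) * g x) \<longlonglongrightarrow> indicator {0<..t} (fst x) * z x * g x"
      using elim by (cases "fst x \<in> {0<..t}") (auto intro!: tendsto_intros simp del: greaterThanAtMost_iff)
    ultimately show ?case by (rule Lim_transform_eventually[rotated])
  qed
  have Fm: "(\<lambda>x. \<Sum>k<N. ?F N k x) \<in> borel_measurable time_product" for N
    using int by (intro borel_measurable_sum) auto
  have zm: "(\<lambda>x. indicator {0<..t} (fst x) * z x * g x) \<in> borel_measurable time_product" by measurable
  have dom: "integrable time_product (\<lambda>x. \<bar>C\<bar> * \<bar>g x\<bar>)" using g by simp
  have bound': "AE x in time_product. norm (\<Sum>k<N. ?F N k x) \<le> \<bar>C\<bar> * \<bar>g x\<bar>" for N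
    using bound by (intro AE_I2) auto
  show "integrable time_product (\<lambda>x. indicator {0<..t} (fst x) * z x * g x)"
    by (rule integrable_dominated_convergence[OF zm Fm dom lim' bound'])
  have "(\<lambda>N. \<integral>x. (\<Sum>k<N. ?F N k x) \<partial>time_product) \<longlonglongrightarrow> (\<integral>x. indicator {0<..t} (fst x) * z x * g x \<partial>time_product)"
    by (rule integral_dominated_convergence[OF zm Fm dom lim' bound'])
  moreover have "(\<integral>x. (\<Sum>k<N. ?F N k x) \<partial>time_product) = (\<Sum>k<N. \<integral>x. ?F N k x \<partial>time_product)" for N
    using int by (intro Bochner_Integration.integral_sum) auto
  ultimately show "(\<lambda>N. \<Sum>k<N. \<integral>x. ?F N k x \<partial>time_product) \<longlonglongrightarrow> (\<integral>x. indicator {0<..t} (fst x) * z x * g x \<partial>time_product)"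
    by simp
qed

end


text \<open>The properties on which the expected Ito formula rests, separated from the SPDE.
  \<open>\<beta>\<close> and \<open>q\<close> are the densities, on time and \<Omega>, of the drift
  of \<open>X\<close> and of the covariations of its martingale part \<open>I\<close>; the
  stochastic integrands no longer appear.\<close>

locale ito_system = filtered_brownian M G T B
  for M :: "'w measure" and G T and B :: "real \<Rightarrow> 'w \<Rightarrow> real^'d::finite" +
  fixes X :: "real \<Rightarrow> 'w \<Rightarrow> real^'k::finite" and I :: "'k \<Rightarrow> real \<Rightarrow> 'w \<Rightarrow> real"
    and \<beta> :: "'k \<Rightarrow> real \<times> 'w \<Rightarrow> real" and q :: "'k \<Rightarrow> 'k \<Rightarrow> real \<times> 'w \<Rightarrow> real"
  assumes X_adapted: "\<And>t. t \<in> {0..T} \<Longrightarrow> X t \<in> borel_measurable (G t)"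
    and X_continuous: "\<And>\<omega>. \<omega> \<in> space M \<Longrightarrow> continuous_on {0..T} (\<lambda>t. X t \<omega>)"
    and I_measurable: "\<And>i t. t \<in> {0..T} \<Longrightarrow> I i t \<in> borel_measurable M"
    and I_square_integrable: "\<And>i t. t \<in> {0..T} \<Longrightarrow> integrable M (\<lambda>\<omega>. (I i t \<omega>)\<^sup>2)"
    and I_continuous: "\<And>i. AE \<omega> in M. continuous_on {0..T} (\<lambda>t. I i t \<omega>)"
    and I_mean: "\<And>i u v Z C. 0 \<le> u \<Longrightarrow> u \<le> v \<Longrightarrow> v \<le> T \<Longrightarrow> Z \<in> borel_measurable (G u) \<Longrightarrow>
      (\<And>\<omega>. \<omega> \<in> space M \<Longrightarrow> \<bar>Z \<omega>\<bar> \<le> C) \<Longrightarrow> (\<integral>\<omega>. Z \<omega> * (I i v \<omega> - I i u \<omega>) \<partial>M) = 0"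
    and I_covariation: "\<And>i j u v Z C. 0 \<le> u \<Longrightarrow> u \<le> v \<Longrightarrow> v \<le> T \<Longrightarrow> Z \<in> borel_measurable (G u) \<Longrightarrow>
      (\<And>\<omega>. \<omega> \<in> space M \<Longrightarrow> \<bar>Z \<omega>\<bar> \<le> C) \<Longrightarrow>
      (\<integral>\<omega>. Z \<omega> * ((I i v \<omega> - I i u \<omega>) * (I j v \<omega> - I j u \<omega>)) \<partial>M)
        = (\<integral>x. indicator {u<..v} (fst x) * Z (snd x) * q i j x \<partial>time_product)"
    and I_Lindeberg: "\<And>i t \<delta>. 0 < t \<Longrightarrow> t \<le> T \<Longrightarrow> 0 < \<delta> \<Longrightarrow>
      (\<lambda>N. \<Sum>k<N. \<integral>\<omega>. (if \<delta> < \<bar>I i (part_point t N (Suc k)) \<omega> - I i (part_point t N k) \<omega>\<bar>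
        then (I i (part_point t N (Suc k)) \<omega> - I i (part_point t N k) \<omega>)\<^sup>2 else 0) \<partial>M) \<longlonglongrightarrow> 0"
    and \<beta>_integrable: "\<And>i. integrable time_product (\<beta> i)"
    and q_integrable: "\<And>i j. integrable time_product (q i j)"
    and X_eq: "\<And>i. AE \<omega> in M. \<forall>t\<in>{0..T}. X t \<omega> $ i
      = X 0 \<omega> $ i + (\<integral>s. indicator {0..t} s * \<beta> i (s, \<omega>) \<partial>lborel) + I i t \<omega>"
begin

text \<open>Defined as what \<open>I\<close> leaves of the increment of \<open>X\<close>, and not as
  a time integral of \<beta>. The decomposition of \<open>X\<close> then holds for every \<omega>
  and measurability is immediate, while the integral formula holds almost surely.\<close>

definition drift_incr :: "'k \<Rightarrow> real \<Rightarrow> real \<Rightarrow> 'w \<Rightarrow> real" where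
  "drift_incr i u v \<omega> = (X v \<omega> $ i - X u \<omega> $ i) - (I i v \<omega> - I i u \<omega>)"

lemma X_measurable: "t \<in> {0..T} \<Longrightarrow> X t \<in> borel_measurable M"
  using measurable_G_M[OF _ X_adapted] .

lemma drift_incr_measurable:
  assumes "u \<in> {0..T}" "v \<in> {0..T}"
  shows "drift_incr i u v \<in> borel_measurable M"
  unfolding drift_incr_def[abs_def]
  using X_measurable[OF assms(1)] X_measurable[OF assms(2)] I_measurable[OF assms(1)] I_measurable[OF assms(2)]
  by measurable

lemma drift_incr_eq:
  assumes uv: "0 \<le> u" "u \<le> v" "v \<le> T"
  shows "AE \<omega> in M. integrable lborel (\<lambda>s. indicator {u<..v} s * \<beta> i (s, \<omega>)) \<and>
    drift_incr i u v \<omega> = (\<integral>s. indicator {u<..v} s * \<beta> i (s, \<omega>) \<partial>lborel)"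
proof -
  interpret pair_sigma_finite lborel M by (rule pair_sigma_finite_time_product)
  have "AE \<omega> in M. integrable lborel (\<lambda>s. \<beta> i (s, \<omega>))"
    using AE_integrable_snd[of "\<lambda>s \<omega>. \<beta> i (s, \<omega>)"] \<beta>_integrable[of i] by simp
  with X_eq[of i] show ?thesis
  proof eventually_elim
    case (elim \<omega>)
    have int: "integrable lborel (\<lambda>s. indicator A s * \<beta> i (s, \<omega>))" if "A \<in> sets borel" for A
      using integrable_mult_indicator[OF _ elim(2), of A] that by simp
    have "indicator {0..v} s = indicator {0..u} s + (indicator {u<..v} s :: real)" for s
      using uv by (auto simp: indicator_def)
    then have "(\<integral>s. indicator {0..v} s * \<beta> i (s, \<omega>) \<partial>lborel)
        = (\<integral>s. indicator {0..u} s * \<beta> i (s, \<omega>) + indicator {u<..v} s * \<beta> i (s, \<omega>) \<partial>lborel)"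
      by (simp only: distrib_right)
    also have "\<dots> = (\<integral>s. indicator {0..u} s * \<beta> i (s, \<omega>) \<partial>lborel) + (\<integral>s. indicator {u<..v} s * \<beta> i (s, \<omega>) \<partial>lborel)"
      by (intro Bochner_Integration.integral_add int) simp_all
    moreover have "u \<in> {0..T}" "v \<in> {0..T}" using uv by auto
    ultimately show ?case
      using elim(1)[rule_format, of u] elim(1)[rule_format, of v] int[of "{u<..v}"] unfolding drift_incr_def by simp
  qed
qed

text \<open>Fubini applied to the almost sure formula \<open>drift_incr_eq\<close>. With absolute
  values an inequality remains, because they are moved under the time integral.\<close>

lemma drift_incr_integral:
  assumes uv: "0 \<le> u" "u \<le> v" "v \<le> T" and W: "W \<in> borel_measurable M" "\<And>\<omega>. \<omega> \<in> space M \<Longrightarrow> \<bar>W \<omega>\<bar> \<le> C"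
  shows "integrable M (\<lambda>\<omega>. W \<omega> * drift_incr i u v \<omega>)"
    and "(\<integral>\<omega>. W \<omega> * drift_incr i u v \<omega> \<partial>M) = (\<integral>x. indicator {u<..v} (fst x) * W (snd x) * \<beta> i x \<partial>time_product)"
    and "(\<And>\<omega>. \<omega> \<in> space M \<Longrightarrow> 0 \<le> W \<omega>) \<Longrightarrow> (\<integral>\<omega>. W \<omega> * \<bar>drift_incr i u v \<omega>\<bar> \<partial>M)
      \<le> (\<integral>x. indicator {u<..v} (fst x) * W (snd x) * \<bar>\<beta> i x\<bar> \<partial>time_product)"
proof -
  interpret pair_sigma_finite lborel M by (rule pair_sigma_finite_time_product)
  note [measurable] = W(1)
  have [measurable]: "drift_incr i u v \<in> borel_measurable M" using uv by (intro drift_incr_measurable) auto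
  have bd: "\<bar>indicator {u<..v} (fst x) * W (snd x)\<bar> \<le> \<bar>C\<bar>" if "x \<in> space time_product" for x
    using W(2)[of "snd x"] that by (auto simp: space_pair_measure indicator_def)
  let ?h = "\<lambda>s \<omega>. indicator {u<..v} s * W \<omega> * \<beta> i (s, \<omega>)"
  let ?h' = "\<lambda>s \<omega>. indicator {u<..v} s * W \<omega> * \<bar>\<beta> i (s, \<omega>)\<bar>"
  have h: "integrable time_product (case_prod ?h)"
    using integrable_mult_bounded[OF _ \<beta>_integrable bd] by (simp add: case_prod_unfold)
  have h': "integrable time_product (case_prod ?h')"
    using integrable_mult_bounded[OF _ integrable_abs[OF \<beta>_integrable] bd] by (simp add: case_prod_unfold)
  have eq: "AE \<omega> in M. W \<omega> * drift_incr i u v \<omega> = (\<integral>s. ?h s \<omega> \<partial>lborel)"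
    using drift_incr_eq[OF uv, of i]
  proof eventually_elim
    case (elim \<omega>)
    have "(\<integral>s. ?h s \<omega> \<partial>lborel) = (\<integral>s. W \<omega> * (indicator {u<..v} s * \<beta> i (s, \<omega>)) \<partial>lborel)" by (simp add: mult_ac)
    then show ?case using elim by (simp add: integral_mult_right_zero)
  qed
  have hm: "(\<lambda>\<omega>. \<integral>s. ?h s \<omega> \<partial>lborel) \<in> borel_measurable M" using integrable_snd[OF h] by auto
  show int: "integrable M (\<lambda>\<omega>. W \<omega> * drift_incr i u v \<omega>)"
    using integrable_cong_AE[OF _ hm eq] integrable_snd[OF h] by simp
  have "(\<integral>\<omega>. W \<omega> * drift_incr i u v \<omega> \<partial>M) = (\<integral>\<omega>. (\<integral>s. ?h s \<omega> \<partial>lborel) \<partial>M)"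
    using hm by (intro integral_cong_AE eq) auto
  also have "\<dots> = (\<integral>x. indicator {u<..v} (fst x) * W (snd x) * \<beta> i x \<partial>time_product)"
    using integral_snd[OF h] by (simp add: case_prod_unfold)
  finally show "(\<integral>\<omega>. W \<omega> * drift_incr i u v \<omega> \<partial>M) = (\<integral>x. indicator {u<..v} (fst x) * W (snd x) * \<beta> i x \<partial>time_product)" .
  assume W0: "\<And>\<omega>. \<omega> \<in> space M \<Longrightarrow> 0 \<le> W \<omega>"
  have "(\<integral>\<omega>. W \<omega> * \<bar>drift_incr i u v \<omega>\<bar> \<partial>M) \<le> (\<integral>\<omega>. (\<integral>s. ?h' s \<omega> \<partial>lborel) \<partial>M)"
  proof (rule integral_mono_AE)
    have "integrable M (\<lambda>\<omega>. \<bar>W \<omega> * drift_incr i u v \<omega>\<bar>)" using int by (rule integrable_abs)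
    moreover have "\<bar>W \<omega> * drift_incr i u v \<omega>\<bar> = W \<omega> * \<bar>drift_incr i u v \<omega>\<bar>" if "\<omega> \<in> space M" for \<omega>
      using W0[OF that] by (simp add: abs_mult)
    ultimately show "integrable M (\<lambda>\<omega>. W \<omega> * \<bar>drift_incr i u v \<omega>\<bar>)"
      by (simp cong: Bochner_Integration.integrable_cong)
    show "integrable M (\<lambda>\<omega>. \<integral>s. ?h' s \<omega> \<partial>lborel)" by (rule integrable_snd[OF h'])
    show "AE \<omega> in M. W \<omega> * \<bar>drift_incr i u v \<omega>\<bar> \<le> (\<integral>s. ?h' s \<omega> \<partial>lborel)"
      using drift_incr_eq[OF uv, of i] AE_space
    proof eventually_elim
      case (elim \<omega>)
      have "\<bar>drift_incr i u v \<omega>\<bar> \<le> (\<integral>s. \<bar>indicator {u<..v} s * \<beta> i (s, \<omega>)\<bar> \<partial>lborel)"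
        using elim integral_abs_bound[of lborel "\<lambda>s. indicator {u<..v} s * \<beta> i (s, \<omega>)"] by simp
      then have "W \<omega> * \<bar>drift_incr i u v \<omega>\<bar> \<le> W \<omega> * (\<integral>s. \<bar>indicator {u<..v} s * \<beta> i (s, \<omega>)\<bar> \<partial>lborel)"
        using W0 elim by (intro mult_left_mono) auto
      also have "\<dots> = (\<integral>s. ?h' s \<omega> \<partial>lborel)"
        unfolding integral_mult_right_zero[symmetric] by (simp add: abs_mult mult_ac)
      finally show ?case .
    qed
  qed
  also have "\<dots> = (\<integral>x. indicator {u<..v} (fst x) * W (snd x) * \<bar>\<beta> i x\<bar> \<partial>time_product)"
    using integral_snd[OF h'] by (simp add: case_prod_unfold)
  finally show "(\<integral>\<omega>. W \<omega> * \<bar>drift_incr i u v \<omega>\<bar> \<partial>M) \<le> (\<integral>x. indicator {u<..v} (fst x) * W (snd x) * \<bar>\<beta> i x\<bar> \<partial>time_product)" .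
qed

text \<open>The second factor in \<open>Cc2_first_order\<close>, taken at the increments of
  \<open>I\<close> and of the drift.\<close>

definition osc :: "real \<Rightarrow> real \<Rightarrow> real \<Rightarrow> 'w \<Rightarrow> real" where
  "osc K u v \<omega> = min (2 * K) (K * (\<Sum>i\<in>UNIV. \<bar>I i v \<omega> - I i u \<omega>\<bar> + \<bar>drift_incr i u v \<omega>\<bar>))"

text \<open>The first and second order Taylor estimates are integrated over \<Omega>. Derivatives of
  \<open>f\<close> are evaluated at \<open>X u\<close>, which is known at time \<open>u\<close>; so
  the linear term in the increment of \<open>I\<close> has mean zero and the quadratic term becomes
  an integral of \<open>q\<close>. The factor 1 in front of \<open>q i i\<close> keeps the shape of
  a partition sum with constant weight.\<close>

lemma one_step:
  assumes uv: "0 \<le> u" "u \<le> v" "v \<le> T" and f: "f \<in> Cc2" and e: "e > 0"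
    and K: "\<And>x. \<bar>f x\<bar> \<le> K" "\<And>x i. \<bar>partial i f x\<bar> \<le> K" "\<And>x i j. \<bar>partial i (partial j f) x\<bar> \<le> K"
    and \<delta>: "\<And>x h. \<bar>f (x + h) - f x - (\<Sum>i\<in>UNIV. h $ i * partial i f x)
      - 1 / 2 * (\<Sum>i\<in>UNIV. \<Sum>j\<in>UNIV. partial i (partial j f) x * (h $ i * h $ j))\<bar>
    \<le> (\<Sum>i\<in>UNIV. e * (h $ i)\<^sup>2 + K * (real CARD('k))\<^sup>2 * (if \<delta> < \<bar>h $ i\<bar> then (h $ i)\<^sup>2 else 0))"
  shows "\<bar>(\<integral>\<omega>. f (X v \<omega>) \<partial>M) - (\<integral>\<omega>. f (X u \<omega>) \<partial>M)
      - (\<Sum>i\<in>UNIV. \<integral>x. indicator {u<..v} (fst x) * partial i f (X u (snd x)) * \<beta> i x \<partial>time_product)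
      - 1 / 2 * (\<Sum>i\<in>UNIV. \<Sum>j\<in>UNIV. \<integral>x. indicator {u<..v} (fst x) * partial i (partial j f) (X u (snd x)) * q i j x \<partial>time_product)\<bar>
    \<le> (\<Sum>i\<in>UNIV. \<integral>x. indicator {u<..v} (fst x) * osc K u v (snd x) * \<bar>\<beta> i x\<bar> \<partial>time_product)
      + (\<Sum>i\<in>UNIV. e * (\<integral>x. indicator {u<..v} (fst x) * 1 * q i i x \<partial>time_product)
        + K * (real CARD('k))\<^sup>2 * (\<integral>\<omega>. (if \<delta> < \<bar>I i v \<omega> - I i u \<omega>\<bar> then (I i v \<omega> - I i u \<omega>)\<^sup>2 else 0) \<partial>M))"
proof -
  have u: "u \<in> {0..T}" and v: "v \<in> {0..T}" using uv by auto
  have K0: "0 \<le> K" using K(1)[of undefined] by linarith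
  define dI where "dI i \<omega> = I i v \<omega> - I i u \<omega>" for i \<omega>
  define dA where "dA i = drift_incr i u v" for i
  define D1 where "D1 i \<omega> = partial i f (X u \<omega>)" for i \<omega>
  define D2 where "D2 i j \<omega> = partial i (partial j f) (X u \<omega>)" for i j \<omega>
  define L where "L i \<omega> = (if \<delta> < \<bar>dI i \<omega>\<bar> then (dI i \<omega>)\<^sup>2 else 0)" for i \<omega>
  define m where "m = osc K u v"
  have [measurable]: "X u \<in> borel_measurable M" "X v \<in> borel_measurable M" using X_measurable u v by auto
  have dI_m[measurable]: "dI i \<in> borel_measurable M" for i
    unfolding dI_def[abs_def] using I_measurable[OF u] I_measurable[OF v] by measurable
  have dA_m[measurable]: "dA i \<in> borel_measurable M" for i unfolding dA_def by (rule drift_incr_measurable[OF u v])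
  have fm: "f \<in> borel_measurable borel" "partial i f \<in> borel_measurable borel" "partial i (partial j f) \<in> borel_measurable borel" for i j
    using Cc2D(3,4,5)[OF f] by (auto intro: borel_measurable_continuous_onI)
  note [measurable] = fm(1)
  have D1G: "D1 i \<in> borel_measurable (G u)" and D2G: "D2 i j \<in> borel_measurable (G u)" for i j
    unfolding D1_def[abs_def] D2_def[abs_def]
    using measurable_compose[OF X_adapted[OF u] fm(2)] measurable_compose[OF X_adapted[OF u] fm(3)] by auto
  have D1m[measurable]: "D1 i \<in> borel_measurable M" and D2m[measurable]: "D2 i j \<in> borel_measurable M" for i j
    using measurable_G_M[OF u D1G] measurable_G_M[OF u D2G] by auto
  have D1b: "\<bar>D1 i \<omega>\<bar> \<le> K" and D2b: "\<bar>D2 i j \<omega>\<bar> \<le> K" for i j \<omega> using K by (auto simp: D1_def D2_def)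
  have m_m[measurable]: "m \<in> borel_measurable M" unfolding m_def osc_def[abs_def] dI_def[symmetric] dA_def[symmetric] by measurable
  have m_b: "0 \<le> m \<omega>" "\<bar>m \<omega>\<bar> \<le> 2 * K" for \<omega>
  proof -
    show "0 \<le> m \<omega>" unfolding m_def osc_def using K0 by (auto intro!: mult_nonneg_nonneg sum_nonneg)
    moreover have "m \<omega> \<le> 2 * K" unfolding m_def osc_def by (rule min.cobounded1)
    ultimately show "\<bar>m \<omega>\<bar> \<le> 2 * K" by simp
  qed
  have dI2: "integrable M (\<lambda>\<omega>. (dI i \<omega>)\<^sup>2)" for i
    unfolding dI_def using I_square_integrable I_measurable u v by (intro square_integrable_diff) auto
  have dI1: "integrable M (dI i)" for i by (rule square_integrable_imp_integrable[OF dI_m dI2])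
  have dIij: "integrable M (\<lambda>\<omega>. dI i \<omega> * dI j \<omega>)" for i j
    by (rule integrable_mult_square_integrable[OF dI_m dI_m dI2 dI2])
  have fX: "integrable M (\<lambda>\<omega>. f (X u \<omega>))" "integrable M (\<lambda>\<omega>. f (X v \<omega>))"
    by (rule integrable_const_bound[of _ K]; use K(1) in simp)+
  have T1: "integrable M (\<lambda>\<omega>. D1 i \<omega> * dA i \<omega>)"
    "(\<integral>\<omega>. D1 i \<omega> * dA i \<omega> \<partial>M) = (\<integral>x. indicator {u<..v} (fst x) * D1 i (snd x) * \<beta> i x \<partial>time_product)" for i
    unfolding dA_def by (rule drift_incr_integral[OF uv D1m D1b])+
  have T2: "integrable M (\<lambda>\<omega>. D1 i \<omega> * dI i \<omega>)" "(\<integral>\<omega>. D1 i \<omega> * dI i \<omega> \<partial>M) = 0" for i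
    using integrable_mult_bounded[OF D1m dI1 D1b] I_mean[OF uv D1G D1b] by (auto simp: dI_def)
  have T3: "integrable M (\<lambda>\<omega>. D2 i j \<omega> * (dI i \<omega> * dI j \<omega>))"
    "(\<integral>\<omega>. D2 i j \<omega> * (dI i \<omega> * dI j \<omega>) \<partial>M) = (\<integral>x. indicator {u<..v} (fst x) * D2 i j (snd x) * q i j x \<partial>time_product)" for i j
    using integrable_mult_bounded[OF D2m dIij D2b] I_covariation[OF uv D2G D2b] by (auto simp: dI_def)
  have T4: "integrable M (\<lambda>\<omega>. m \<omega> * \<bar>dA i \<omega>\<bar>)"
    "(\<integral>\<omega>. m \<omega> * \<bar>dA i \<omega>\<bar> \<partial>M) \<le> (\<integral>x. indicator {u<..v} (fst x) * m (snd x) * \<bar>\<beta> i x\<bar> \<partial>time_product)" for i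
  proof -
    have "integrable M (\<lambda>\<omega>. 1 * dA i \<omega>)"
      unfolding dA_def by (rule drift_incr_integral(1)[OF uv, of "\<lambda>_. 1" 1]) auto
    then show "integrable M (\<lambda>\<omega>. m \<omega> * \<bar>dA i \<omega>\<bar>)"
      by (intro integrable_mult_bounded[OF m_m _ m_b(2)] integrable_abs) simp
    show "(\<integral>\<omega>. m \<omega> * \<bar>dA i \<omega>\<bar> \<partial>M) \<le> (\<integral>x. indicator {u<..v} (fst x) * m (snd x) * \<bar>\<beta> i x\<bar> \<partial>time_product)"
      unfolding dA_def by (rule drift_incr_integral(3)[OF uv m_m m_b(2) m_b(1)])
  qed
  have T5: "(\<integral>\<omega>. (dI i \<omega>)\<^sup>2 \<partial>M) = (\<integral>x. indicator {u<..v} (fst x) * 1 * q i i x \<partial>time_product)" for i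
    using I_covariation[OF uv, of "\<lambda>_. 1" 1 i i] by (simp add: dI_def power2_eq_square)
  have T6: "integrable M (L i)" for i
  proof (rule Bochner_Integration.integrable_bound[OF dI2[of i]])
    show "L i \<in> borel_measurable M" unfolding L_def[abs_def] by measurable
    show "AE \<omega> in M. norm (L i \<omega>) \<le> norm ((dI i \<omega>)\<^sup>2)" by (auto simp: L_def)
  qed
  let ?E = "\<lambda>\<omega>. f (X v \<omega>) - f (X u \<omega>) - (\<Sum>i\<in>UNIV. D1 i \<omega> * dA i \<omega>) - (\<Sum>i\<in>UNIV. D1 i \<omega> * dI i \<omega>)
      - 1 / 2 * (\<Sum>i\<in>UNIV. \<Sum>j\<in>UNIV. D2 i j \<omega> * (dI i \<omega> * dI j \<omega>))"
  let ?F = "\<lambda>\<omega>. (\<Sum>i\<in>UNIV. m \<omega> * \<bar>dA i \<omega>\<bar>) + (\<Sum>i\<in>UNIV. e * (dI i \<omega>)\<^sup>2 + K * (real CARD('k))\<^sup>2 * L i \<omega>)"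
  have pw: "\<bar>?E \<omega>\<bar> \<le> ?F \<omega>" for \<omega>
  proof -
    let ?h = "\<chi> i. dI i \<omega>" and ?a = "\<chi> i. dA i \<omega>"
    have Xv: "X v \<omega> = X u \<omega> + ?h + ?a" by (simp add: vec_eq_iff dI_def dA_def drift_incr_def)
    have 1: "\<bar>f (X u \<omega> + ?h + ?a) - f (X u \<omega> + ?h) - (\<Sum>i\<in>UNIV. ?a $ i * partial i f (X u \<omega>))\<bar>
        \<le> (\<Sum>i\<in>UNIV. \<bar>?a $ i\<bar>) * min (2 * K) (K * (\<Sum>i\<in>UNIV. \<bar>?h $ i\<bar> + \<bar>?a $ i\<bar>))"
      by (rule Cc2_first_order[OF f K(2,3)])
    have 2: "(\<Sum>i\<in>UNIV. \<bar>?a $ i\<bar>) * min (2 * K) (K * (\<Sum>i\<in>UNIV. \<bar>?h $ i\<bar> + \<bar>?a $ i\<bar>)) = (\<Sum>i\<in>UNIV. m \<omega> * \<bar>dA i \<omega>\<bar>)"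
      by (simp add: m_def osc_def dI_def dA_def sum_distrib_right mult.commute[of "min _ _"])
    have 3: "?E \<omega> = (f (X u \<omega> + ?h + ?a) - f (X u \<omega> + ?h) - (\<Sum>i\<in>UNIV. ?a $ i * partial i f (X u \<omega>)))
       + (f (X u \<omega> + ?h) - f (X u \<omega>) - (\<Sum>i\<in>UNIV. ?h $ i * partial i f (X u \<omega>))
      - 1 / 2 * (\<Sum>i\<in>UNIV. \<Sum>j\<in>UNIV. partial i (partial j f) (X u \<omega>) * (?h $ i * ?h $ j)))"
      unfolding Xv D1_def D2_def by (simp add: mult.commute)
    have 4: "\<bar>f (X u \<omega> + ?h) - f (X u \<omega>) - (\<Sum>i\<in>UNIV. ?h $ i * partial i f (X u \<omega>))
      - 1 / 2 * (\<Sum>i\<in>UNIV. \<Sum>j\<in>UNIV. partial i (partial j f) (X u \<omega>) * (?h $ i * ?h $ j))\<bar>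
      \<le> (\<Sum>i\<in>UNIV. e * (dI i \<omega>)\<^sup>2 + K * (real CARD('k))\<^sup>2 * L i \<omega>)"
      using \<delta>[of "X u \<omega>" ?h] unfolding L_def by (simp only: vec_lambda_beta cong: if_cong)
    show ?thesis unfolding 3 by (rule order_trans[OF abs_triangle_ineq add_mono[OF 1[unfolded 2] 4]])
  qed
  have E_int: "integrable M ?E" using fX T1(1) T2(1) T3(1)
    by (intro Bochner_Integration.integrable_diff integrable_mult_right Bochner_Integration.integrable_sum)
  have F_int: "integrable M ?F" using T4(1) dI2 T6
    by (intro Bochner_Integration.integrable_add Bochner_Integration.integrable_sum integrable_mult_right)
  have E_eq: "(\<integral>\<omega>. ?E \<omega> \<partial>M) = (\<integral>\<omega>. f (X v \<omega>) \<partial>M) - (\<integral>\<omega>. f (X u \<omega>) \<partial>M)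
      - (\<Sum>i\<in>UNIV. \<integral>\<omega>. D1 i \<omega> * dA i \<omega> \<partial>M) - (\<Sum>i\<in>UNIV. \<integral>\<omega>. D1 i \<omega> * dI i \<omega> \<partial>M)
      - 1 / 2 * (\<Sum>i\<in>UNIV. \<Sum>j\<in>UNIV. \<integral>\<omega>. D2 i j \<omega> * (dI i \<omega> * dI j \<omega>) \<partial>M)"
    using fX T1(1) T2(1) T3(1)
    by (simp add: Bochner_Integration.integral_diff Bochner_Integration.integral_sum)
  have F_eq: "(\<integral>\<omega>. ?F \<omega> \<partial>M) = (\<Sum>i\<in>UNIV. \<integral>\<omega>. m \<omega> * \<bar>dA i \<omega>\<bar> \<partial>M)
      + (\<Sum>i\<in>UNIV. e * (\<integral>\<omega>. (dI i \<omega>)\<^sup>2 \<partial>M) + K * (real CARD('k))\<^sup>2 * (\<integral>\<omega>. L i \<omega> \<partial>M))"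
    using T4(1) dI2 T6 by (simp add: Bochner_Integration.integral_add Bochner_Integration.integral_sum)
  have "\<bar>\<integral>\<omega>. ?E \<omega> \<partial>M\<bar> \<le> (\<integral>\<omega>. \<bar>?E \<omega>\<bar> \<partial>M)" by (rule integral_abs_bound)
  also have "\<dots> \<le> (\<integral>\<omega>. ?F \<omega> \<partial>M)" using pw by (intro integral_mono integrable_abs E_int F_int)
  also have "\<dots> \<le> (\<Sum>i\<in>UNIV. \<integral>x. indicator {u<..v} (fst x) * m (snd x) * \<bar>\<beta> i x\<bar> \<partial>time_product)
      + (\<Sum>i\<in>UNIV. e * (\<integral>\<omega>. (dI i \<omega>)\<^sup>2 \<partial>M) + K * (real CARD('k))\<^sup>2 * (\<integral>\<omega>. L i \<omega> \<partial>M))"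
    unfolding F_eq by (intro add_right_mono sum_mono T4(2))
  finally show ?thesis
    unfolding E_eq T1(2) T2(2) T3(2) T5 unfolding m_def L_def dI_def D1_def D2_def by simp
qed

lemma X_jointly_measurable: "(\<lambda>x. X (clip 0 T (fst x)) (snd x)) \<in> borel_measurable time_product"
proof -
  have "(\<lambda>(s, \<omega>). X (clip 0 T s) \<omega>) \<in> borel_measurable (borel \<Otimes>\<^sub>M M)"
    using T_pos by (intro continuous_process_measurable X_measurable X_continuous) auto
  moreover have "sets (borel \<Otimes>\<^sub>M M) = sets time_product" by (intro sets_pair_measure_cong) auto
  ultimately show ?thesis using measurable_cong_sets by (fastforce simp: case_prod_unfold)
qed

lemma tendsto_along_partition:
  fixes g :: "real \<Rightarrow> 'b::topological_space"
  assumes g: "continuous_on {0..T} g" and t: "0 < t" "t \<le> T" and s: "s \<in> {0<..t}"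
  shows "(\<lambda>N. g (part_point t N (part_index t N s))) \<longlonglongrightarrow> g s"
    and "(\<lambda>N. g (part_point t N (Suc (part_index t N s)))) \<longlonglongrightarrow> g s"
proof -
  have sT: "s \<in> {0..T}" using t s by auto
  have "part_point t N k \<in> {0..T}" if "k \<le> N" for N k
    using part_point_in[of t k N] that t by auto
  moreover have "part_index t N s < N" if "N > 0" for N using part_index_iff(2)[OF t(1) that s] .
  ultimately have "part_point t N (part_index t N s) \<in> {0..T}" "part_point t N (Suc (part_index t N s)) \<in> {0..T}" if "N > 0" for N
    using that by (meson less_imp_le Suc_leI)+
  then have "\<forall>\<^sub>F N in sequentially. part_point t N (part_index t N s) \<in> {0..T}"
    "\<forall>\<^sub>F N in sequentially. part_point t N (Suc (part_index t N s)) \<in> {0..T}"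
    by (auto intro: eventually_mono[OF eventually_gt_at_top[of "0::nat"]] simp del: atLeastAtMost_iff)
  then show "(\<lambda>N. g (part_point t N (part_index t N s))) \<longlonglongrightarrow> g s"
    "(\<lambda>N. g (part_point t N (Suc (part_index t N s)))) \<longlonglongrightarrow> g s"
    using continuous_on_tendsto_compose[OF g part_point_tendsto(1)[OF t(1) s] sT]
      continuous_on_tendsto_compose[OF g part_point_tendsto(2)[OF t(1) s] sT] by auto
qed

text \<open>The weight is evaluated at the left end of each interval, as the martingale property
  demands, and path continuity identifies the limit.\<close>

lemma partition_sum_tendsto_process:
  fixes g :: "real^'k \<Rightarrow> real"
  assumes t: "0 < t" "t \<le> T" and g: "continuous_on UNIV g" "\<And>x. \<bar>g x\<bar> \<le> C" and h: "integrable time_product h"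
  shows "integrable time_product (\<lambda>x. indicator {0<..t} (fst x) * g (X (clip 0 T (fst x)) (snd x)) * h x)"
    and "(\<lambda>N. \<Sum>k<N. \<integral>x. indicator {part_point t N k<..part_point t N (Suc k)} (fst x) * g (X (part_point t N k) (snd x)) * h x \<partial>time_product)
      \<longlonglongrightarrow> (\<integral>x. indicator {0<..t} (fst x) * g (X (clip 0 T (fst x)) (snd x)) * h x \<partial>time_product)"
proof -
  have gm: "g \<in> borel_measurable borel" using g(1) by (rule borel_measurable_continuous_onI)
  have Zm: "(\<lambda>\<omega>. g (X (part_point t N k) \<omega>)) \<in> borel_measurable M" if "k < N" for N k
    using part_point_in[of t k N] that t by (intro measurable_compose[OF X_measurable gm]) auto
  have zm: "(\<lambda>x. g (X (clip 0 T (fst x)) (snd x))) \<in> borel_measurable time_product"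
    by (rule measurable_compose[OF X_jointly_measurable gm])
  have "AE x in time_product. fst x \<in> {0<..t} \<longrightarrow>
      (\<lambda>N. g (X (part_point t N (part_index t N (fst x))) (snd x))) \<longlonglongrightarrow> g (X (clip 0 T (fst x)) (snd x))"
  proof (rule AE_I2, rule impI)
    fix x assume x: "x \<in> space time_product" "fst x \<in> {0<..t}"
    then have "snd x \<in> space M" by (auto simp: space_pair_measure)
    from continuous_on_compose2[OF g(1) X_continuous[OF this]]
    have "continuous_on {0..T} (\<lambda>s. g (X s (snd x)))" by simp
    moreover have "clip 0 T (fst x) = fst x" using x t by auto
    ultimately
    show "(\<lambda>N. g (X (part_point t N (part_index t N (fst x))) (snd x))) \<longlonglongrightarrow> g (X (clip 0 T (fst x)) (snd x))"
      using tendsto_along_partition(1)[OF _ t x(2)] by (simp only:)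
  qed
  note * = partition_sum_tendsto[where Z="\<lambda>N k \<omega>. g (X (part_point t N k) \<omega>)" and C=C, OF t(1) h Zm g(2) zm this]
  show "integrable time_product (\<lambda>x. indicator {0<..t} (fst x) * g (X (clip 0 T (fst x)) (snd x)) * h x)" by (rule *(1))
  show "(\<lambda>N. \<Sum>k<N. \<integral>x. indicator {part_point t N k<..part_point t N (Suc k)} (fst x) * g (X (part_point t N k) (snd x)) * h x \<partial>time_product)
      \<longlonglongrightarrow> (\<integral>x. indicator {0<..t} (fst x) * g (X (clip 0 T (fst x)) (snd x)) * h x \<partial>time_product)" by (rule *(3))
qed

text \<open>\<open>osc\<close> is at most \<open>2 * K\<close> and tends to 0 along the partition at
  almost every point, because the paths of \<open>X\<close> and \<open>I\<close> are continuous. The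
  drift increment inherits this as a difference of their increments.\<close>

lemma osc_sum_tendsto:
  assumes t: "0 < t" "t \<le> T" and K: "0 \<le> K" and h: "integrable time_product h"
  shows "(\<lambda>N. \<Sum>k<N. \<integral>x. indicator {part_point t N k<..part_point t N (Suc k)} (fst x)
      * osc K (part_point t N k) (part_point t N (Suc k)) (snd x) * h x \<partial>time_product) \<longlonglongrightarrow> 0"
proof -
  have Zm: "osc K (part_point t N k) (part_point t N (Suc k)) \<in> borel_measurable M" if "k < N" for N k
  proof -
    have p: "part_point t N k \<in> {0..T}" "part_point t N (Suc k) \<in> {0..T}"
      using part_point_in[of t k N] part_point_in[of t "Suc k" N] that t by auto
    note [measurable] = I_measurable[OF p(1)] I_measurable[OF p(2)] drift_incr_measurable[OF p]
    show ?thesis unfolding osc_def[abs_def] by measurable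
  qed
  have Zb: "\<bar>osc K u v \<omega>\<bar> \<le> 2 * K" for u v \<omega>
  proof -
    have "0 \<le> osc K u v \<omega>" unfolding osc_def using K by (auto intro!: mult_nonneg_nonneg sum_nonneg)
    then show ?thesis unfolding osc_def by simp
  qed
  have I_cont: "AE \<omega> in M. \<forall>i. continuous_on {0..T} (\<lambda>s. I i s \<omega>)" using I_continuous by (simp add: AE_all_countable)
  have "AE x in time_product. fst x \<in> {0<..t} \<longrightarrow> (\<lambda>N. osc K (part_point t N (part_index t N (fst x)))
      (part_point t N (Suc (part_index t N (fst x)))) (snd x)) \<longlonglongrightarrow> 0"
    using AE_time_product_snd[OF I_cont] AE_space[of time_product]
  proof eventually_elim
    case (elim x)
    let ?u = "\<lambda>N. part_point t N (part_index t N (fst x))" and ?v = "\<lambda>N. part_point t N (Suc (part_index t N (fst x)))"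
    have w: "snd x \<in> space M" using elim by (auto simp: space_pair_measure)
    show ?case
    proof (rule impI)
      assume s: "fst x \<in> {0<..t}"
      have dI: "(\<lambda>N. I i (?v N) (snd x) - I i (?u N) (snd x)) \<longlonglongrightarrow> I i (fst x) (snd x) - I i (fst x) (snd x)" for i
        using elim(1) s by (intro tendsto_diff tendsto_along_partition[OF _ t]) auto
      have "continuous_on {0..T} (\<lambda>s. X s (snd x) $ i)" for i
        by (intro continuous_intros X_continuous w)
      then have dX: "(\<lambda>N. X (?v N) (snd x) $ i - X (?u N) (snd x) $ i) \<longlonglongrightarrow> X (fst x) (snd x) $ i - X (fst x) (snd x) $ i" for i
        using s by (intro tendsto_diff tendsto_along_partition[OF _ t, where g="\<lambda>s. X s (snd x) $ i"]) auto
      have "(\<lambda>N. osc K (?u N) (?v N) (snd x)) \<longlonglongrightarrow>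
        min (2 * K) (K * (\<Sum>i\<in>UNIV. \<bar>I i (fst x) (snd x) - I i (fst x) (snd x)\<bar>
          + \<bar>(X (fst x) (snd x) $ i - X (fst x) (snd x) $ i) - (I i (fst x) (snd x) - I i (fst x) (snd x))\<bar>))"
        unfolding osc_def drift_incr_def by (intro tendsto_intros dI dX)
      then show "(\<lambda>N. osc K (?u N) (?v N) (snd x)) \<longlonglongrightarrow> 0" using K by simp
    qed
  qed
  from partition_sum_tendsto(3)[where Z="\<lambda>N k. osc K (part_point t N k) (part_point t N (Suc k))" and z="\<lambda>_. 0", OF t(1) h Zm Zb _ this]
  show ?thesis by simp
qed

theorem expected_ito_formula:
  assumes t: "t \<in> {0..T}" and f: "f \<in> Cc2"
  defines "L \<equiv> \<lambda>x. (\<Sum>i\<in>UNIV. partial i f (X (clip 0 T (fst x)) (snd x)) * \<beta> i x)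
      + 1 / 2 * (\<Sum>i\<in>UNIV. \<Sum>j\<in>UNIV. partial i (partial j f) (X (clip 0 T (fst x)) (snd x)) * q i j x)"
  shows "integrable time_product (\<lambda>x. indicator {0<..t} (fst x) * L x)"
    and "(\<integral>\<omega>. f (X t \<omega>) \<partial>M) - (\<integral>\<omega>. f (X 0 \<omega>) \<partial>M) = (\<integral>x. indicator {0<..t} (fst x) * L x \<partial>time_product)"
proof -
  have "integrable time_product (\<lambda>x. indicator {0<..t} (fst x) * L x) \<and>
    (\<integral>\<omega>. f (X t \<omega>) \<partial>M) - (\<integral>\<omega>. f (X 0 \<omega>) \<partial>M) = (\<integral>x. indicator {0<..t} (fst x) * L x \<partial>time_product)"
  proof (cases "t = 0")
    case False
    then have t: "0 < t" "t \<le> T" using t by auto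
    obtain K where K: "K > 0" "\<And>x. \<bar>f x\<bar> \<le> K" "\<And>x i. \<bar>partial i f x\<bar> \<le> K" "\<And>x i j. \<bar>partial i (partial j f) x\<bar> \<le> K"
      using Cc2D(6)[OF f] by blast
    let ?p = "part_point t"
    let ?J = "\<lambda>N k x. indicator {?p N k<..?p N (Suc k)} (fst x) :: real"
    define a where "a i = (\<integral>x. indicator {0<..t} (fst x) * partial i f (X (clip 0 T (fst x)) (snd x)) * \<beta> i x \<partial>time_product)" for i
    define c where "c i j = (\<integral>x. indicator {0<..t} (fst x) * partial i (partial j f) (X (clip 0 T (fst x)) (snd x)) * q i j x \<partial>time_product)" for i j
    define s where "s i = (\<integral>x. indicator {0<..t} (fst x) * 1 * q i i x \<partial>time_product)" for i
    have a_int: "integrable time_product (\<lambda>x. indicator {0<..t} (fst x) * partial i f (X (clip 0 T (fst x)) (snd x)) * \<beta> i x)"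
      and a_lim: "(\<lambda>N. \<Sum>k<N. \<integral>x. ?J N k x * partial i f (X (?p N k) (snd x)) * \<beta> i x \<partial>time_product) \<longlonglongrightarrow> a i" for i
      using partition_sum_tendsto_process[OF t Cc2D(4)[OF f] K(3) \<beta>_integrable] unfolding a_def by auto
    have c_int: "integrable time_product (\<lambda>x. indicator {0<..t} (fst x) * partial i (partial j f) (X (clip 0 T (fst x)) (snd x)) * q i j x)"
      and c_lim: "(\<lambda>N. \<Sum>k<N. \<integral>x. ?J N k x * partial i (partial j f) (X (?p N k) (snd x)) * q i j x \<partial>time_product) \<longlonglongrightarrow> c i j" for i j
      using partition_sum_tendsto_process[OF t Cc2D(5)[OF f] K(4) q_integrable] unfolding c_def by auto
    have s_lim: "(\<lambda>N. \<Sum>k<N. \<integral>x. ?J N k x * 1 * q i i x \<partial>time_product) \<longlonglongrightarrow> s i" for i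
      using partition_sum_tendsto_process(2)[OF t, of "\<lambda>_. 1" 1, OF _ _ q_integrable] unfolding s_def by simp
    have r_lim: "(\<lambda>N. \<Sum>k<N. \<integral>x. ?J N k x * osc K (?p N k) (?p N (Suc k)) (snd x) * \<bar>\<beta> i x\<bar> \<partial>time_product) \<longlonglongrightarrow> 0" for i
      using K(1) by (intro osc_sum_tendsto[OF t] integrable_abs \<beta>_integrable) simp
    let ?D = "(\<integral>\<omega>. f (X t \<omega>) \<partial>M) - (\<integral>\<omega>. f (X 0 \<omega>) \<partial>M)"
    define A where "A N = (\<Sum>i\<in>UNIV. \<Sum>k<N. \<integral>x. ?J N k x * partial i f (X (?p N k) (snd x)) * \<beta> i x \<partial>time_product)
      + 1 / 2 * (\<Sum>i\<in>UNIV. \<Sum>j\<in>UNIV. \<Sum>k<N. \<integral>x. ?J N k x * partial i (partial j f) (X (?p N k) (snd x)) * q i j x \<partial>time_product)" for N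
    have A_lim: "A \<longlonglongrightarrow> (\<Sum>i\<in>UNIV. a i) + 1 / 2 * (\<Sum>i\<in>UNIV. \<Sum>j\<in>UNIV. c i j)"
      unfolding A_def by (intro tendsto_intros a_lim c_lim)
    \<comment> \<open>For fixed \<open>e\<close> the mesh tends to 0 first: the oscillation and
      Lindeberg terms vanish, and what remains is \<open>e\<close> times the expected quadratic
      variations \<open>s i\<close>. Afterwards \<open>e\<close> is sent to 0 along
      \<open>1 / n\<close>.\<close>
    have small: "\<bar>?D - ((\<Sum>i\<in>UNIV. a i) + 1 / 2 * (\<Sum>i\<in>UNIV. \<Sum>j\<in>UNIV. c i j))\<bar> \<le> (\<Sum>i\<in>UNIV. e * s i)" if e: "e > 0" for e
    proof -
      obtain \<delta> where \<delta>: "\<delta> > 0" "\<And>x h. \<bar>f (x + h) - f x - (\<Sum>i\<in>UNIV. h $ i * partial i f x)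
          - 1 / 2 * (\<Sum>i\<in>UNIV. \<Sum>j\<in>UNIV. partial i (partial j f) x * (h $ i * h $ j))\<bar>
        \<le> (\<Sum>i\<in>UNIV. e * (h $ i)\<^sup>2 + K * (real CARD('k))\<^sup>2 * (if \<delta> < \<bar>h $ i\<bar> then (h $ i)\<^sup>2 else 0))"
        using Cc2_second_order[OF f K(4) e] by blast
      define l where "l i N k = (\<integral>\<omega>. (if \<delta> < \<bar>I i (?p N (Suc k)) \<omega> - I i (?p N k) \<omega>\<bar>
        then (I i (?p N (Suc k)) \<omega> - I i (?p N k) \<omega>)\<^sup>2 else 0) \<partial>M)" for i N k
      have l_lim: "(\<lambda>N. \<Sum>k<N. l i N k) \<longlonglongrightarrow> 0" for i
        unfolding l_def by (rule I_Lindeberg[OF t \<delta>(1)])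
      define R where "R N = (\<Sum>i\<in>UNIV. \<Sum>k<N. \<integral>x. ?J N k x * osc K (?p N k) (?p N (Suc k)) (snd x) * \<bar>\<beta> i x\<bar> \<partial>time_product)
        + (\<Sum>i\<in>UNIV. e * (\<Sum>k<N. \<integral>x. ?J N k x * 1 * q i i x \<partial>time_product) + K * (real CARD('k))\<^sup>2 * (\<Sum>k<N. l i N k))" for N
      have "R \<longlonglongrightarrow> (\<Sum>i\<in>(UNIV :: 'k set). 0) + (\<Sum>i\<in>UNIV. e * s i + K * (real CARD('k))\<^sup>2 * 0)"
        unfolding R_def by (intro tendsto_intros r_lim s_lim l_lim)
      then have R_lim: "R \<longlonglongrightarrow> (\<Sum>i\<in>UNIV. e * s i)" by simp
      have "\<bar>?D - A N\<bar> \<le> R N" if N: "N > 0" for N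
      proof -
        let ?a = "\<lambda>k i. \<integral>x. ?J N k x * partial i f (X (?p N k) (snd x)) * \<beta> i x \<partial>time_product"
        let ?c = "\<lambda>k i j. \<integral>x. ?J N k x * partial i (partial j f) (X (?p N k) (snd x)) * q i j x \<partial>time_product"
        let ?r = "\<lambda>k i. \<integral>x. ?J N k x * osc K (?p N k) (?p N (Suc k)) (snd x) * \<bar>\<beta> i x\<bar> \<partial>time_product"
        let ?s = "\<lambda>k i. \<integral>x. ?J N k x * 1 * q i i x \<partial>time_product"
        let ?E = "\<lambda>k. \<integral>\<omega>. f (X (?p N k) \<omega>) \<partial>M"
        have D: "?D = (\<Sum>k<N. ?E (Suc k) - ?E k)"
          using sum_lessThan_telescope[of ?E N] by (simp only: part_point_0 part_point_N[OF N])
        have AN: "A N = (\<Sum>k<N. (\<Sum>i\<in>UNIV. ?a k i) + 1 / 2 * (\<Sum>i\<in>UNIV. \<Sum>j\<in>UNIV. ?c k i j))"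
        proof -
          have "(\<Sum>i\<in>UNIV. \<Sum>j\<in>UNIV. \<Sum>k<N. ?c k i j) = (\<Sum>i\<in>UNIV. \<Sum>k<N. \<Sum>j\<in>UNIV. ?c k i j)"
            by (intro sum.cong refl sum.swap)
          also have "\<dots> = (\<Sum>k<N. \<Sum>i\<in>UNIV. \<Sum>j\<in>UNIV. ?c k i j)" by (rule sum.swap)
          finally show ?thesis unfolding A_def sum.distrib sum_distrib_left[symmetric]
            by (simp only: sum.swap[of ?a])
        qed
        have RN: "R N = (\<Sum>k<N. (\<Sum>i\<in>UNIV. ?r k i) + (\<Sum>i\<in>UNIV. e * ?s k i + K * (real CARD('k))\<^sup>2 * l i N k))"
        proof -
          have "(\<Sum>i\<in>UNIV. e * (\<Sum>k<N. ?s k i) + K * (real CARD('k))\<^sup>2 * (\<Sum>k<N. l i N k))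
             = (\<Sum>i\<in>UNIV. \<Sum>k<N. e * ?s k i + K * (real CARD('k))\<^sup>2 * l i N k)"
            by (simp only: sum.distrib sum_distrib_left)
          also have "\<dots> = (\<Sum>k<N. \<Sum>i\<in>UNIV. e * ?s k i + K * (real CARD('k))\<^sup>2 * l i N k)" by (rule sum.swap)
          finally show ?thesis unfolding R_def by (simp only: sum.distrib[of "\<lambda>k. \<Sum>i\<in>UNIV. ?r k i"] sum.swap[of ?r])
        qed
        have step: "\<bar>?E (Suc k) - ?E k - ((\<Sum>i\<in>UNIV. ?a k i) + 1 / 2 * (\<Sum>i\<in>UNIV. \<Sum>j\<in>UNIV. ?c k i j))\<bar>
          \<le> (\<Sum>i\<in>UNIV. ?r k i) + (\<Sum>i\<in>UNIV. e * ?s k i + K * (real CARD('k))\<^sup>2 * l i N k)" if k: "k < N" for k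
        proof -
          have p: "0 \<le> ?p N k" "?p N k \<le> ?p N (Suc k)" "?p N (Suc k) \<le> T"
            using part_point_in[of t k N] part_point_in[of t "Suc k" N] part_point_mono[of t N k] k t by auto
          show ?thesis using one_step[OF p f e K(2,3,4) \<delta>(2)] unfolding l_def by (simp only: diff_diff_eq)
        qed
        have "\<bar>?D - A N\<bar> = \<bar>\<Sum>k<N. ?E (Suc k) - ?E k - ((\<Sum>i\<in>UNIV. ?a k i) + 1 / 2 * (\<Sum>i\<in>UNIV. \<Sum>j\<in>UNIV. ?c k i j))\<bar>"
          unfolding D AN sum_subtractf ..
        also have "\<dots> \<le> (\<Sum>k<N. \<bar>?E (Suc k) - ?E k - ((\<Sum>i\<in>UNIV. ?a k i) + 1 / 2 * (\<Sum>i\<in>UNIV. \<Sum>j\<in>UNIV. ?c k i j))\<bar>)"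
          by (rule sum_abs)
        also have "\<dots> \<le> R N" unfolding RN by (intro sum_mono step) simp
        finally show ?thesis .
      qed
      then have "\<forall>\<^sub>F N in sequentially. \<bar>?D - A N\<bar> \<le> R N"
        by (intro eventually_mono[OF eventually_gt_at_top[of "0::nat"]])
      moreover have "(\<lambda>N. \<bar>?D - A N\<bar>) \<longlonglongrightarrow> \<bar>?D - ((\<Sum>i\<in>UNIV. a i) + 1 / 2 * (\<Sum>i\<in>UNIV. \<Sum>j\<in>UNIV. c i j))\<bar>"
        by (intro tendsto_intros A_lim)
      ultimately show ?thesis using R_lim by (intro tendsto_le[OF sequentially_bot])
    qed
    have "?D - ((\<Sum>i\<in>UNIV. a i) + 1 / 2 * (\<Sum>i\<in>UNIV. \<Sum>j\<in>UNIV. c i j)) = 0"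
    proof -
      have "(\<lambda>n. \<Sum>i\<in>UNIV. (1 / real n) * s i) \<longlonglongrightarrow> (\<Sum>i\<in>UNIV. 0 * s i)"
        by (intro tendsto_intros lim_1_over_n)
      moreover have "\<forall>\<^sub>F n in sequentially. \<bar>?D - ((\<Sum>i\<in>UNIV. a i) + 1 / 2 * (\<Sum>i\<in>UNIV. \<Sum>j\<in>UNIV. c i j))\<bar> \<le> (\<Sum>i\<in>UNIV. (1 / real n) * s i)"
        using eventually_gt_at_top[of "0::nat"] by eventually_elim (intro small, simp)
      ultimately have "\<bar>?D - ((\<Sum>i\<in>UNIV. a i) + 1 / 2 * (\<Sum>i\<in>UNIV. \<Sum>j\<in>UNIV. c i j))\<bar> \<le> (\<Sum>i\<in>UNIV. 0 * s i)"
        by (intro tendsto_le[OF sequentially_bot _ tendsto_const])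
      then show ?thesis by simp
    qed
    moreover have L_eq: "indicator {0<..t} (fst x) * L x
      = (\<Sum>i\<in>UNIV. indicator {0<..t} (fst x) * partial i f (X (clip 0 T (fst x)) (snd x)) * \<beta> i x)
      + 1 / 2 * (\<Sum>i\<in>UNIV. \<Sum>j\<in>UNIV. indicator {0<..t} (fst x) * partial i (partial j f) (X (clip 0 T (fst x)) (snd x)) * q i j x)" for x
      unfolding L_def by (simp only: distrib_left sum_distrib_left mult_ac)
    moreover have "(\<integral>x. indicator {0<..t} (fst x) * L x \<partial>time_product)
      = (\<Sum>i\<in>UNIV. a i) + 1 / 2 * (\<Sum>i\<in>UNIV. \<Sum>j\<in>UNIV. c i j)"
      unfolding L_eq using a_int c_int
      by (simp add: Bochner_Integration.integral_add Bochner_Integration.integral_sum a_def c_def)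
    moreover have "integrable time_product (\<lambda>x. indicator {0<..t} (fst x) * L x)"
      unfolding L_eq using a_int c_int
      by (intro Bochner_Integration.integrable_add Bochner_Integration.integrable_sum integrable_mult_right)
    ultimately show ?thesis by simp
  qed simp
  then show "integrable time_product (\<lambda>x. indicator {0<..t} (fst x) * L x)"
    "(\<integral>\<omega>. f (X t \<omega>) \<partial>M) - (\<integral>\<omega>. f (X 0 \<omega>) \<partial>M) = (\<integral>x. indicator {0<..t} (fst x) * L x \<partial>time_product)" by auto
qed

end

section \<open>Polarization and bounds for the generator\<close>

lemma borel_measurable_vecI:
  fixes f :: "'a \<Rightarrow> real^'n::finite"
  assumes "\<And>i. (\<lambda>x. f x $ i) \<in> borel_measurable N"
  shows "f \<in> borel_measurable N"
  by (subst borel_measurable_euclidean_space) (auto simp: Basis_vec_def inner_axis assms)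

lemma Ck_add:
  fixes f g :: "real^'n::finite \<Rightarrow> real"
  assumes "Ck k f" "Ck k g"
  shows "Ck k (\<lambda>x. f x + g x)"
  using assms
proof (induction k arbitrary: f g)
  case 0
  then show ?case by (auto intro: continuous_intros)
next
  case (Suc k)
  have "partial i (\<lambda>x. f x + g x) = (\<lambda>x. partial i f x + partial i g x)" for i
    using Suc.prems by (intro ext partial_add) auto
  then show ?case using Suc by auto
qed

lemma Cc_infinity_add:
  fixes f g :: "real^'n::finite \<Rightarrow> real"
  assumes "f \<in> Cc_infinity" "g \<in> Cc_infinity"
  shows "(\<lambda>x. f x + g x) \<in> Cc_infinity"
proof -
  have "compact (closure {x. f x + g x \<noteq> 0})"
  proof (rule compact_closure[THEN iffD2], rule bounded_subset)
    have "bounded (closure {x. f x \<noteq> 0} \<union> closure {x. g x \<noteq> 0})"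
      using assms by (auto simp: Cc_infinity_def compact_support_def compact_imp_bounded)
    then show "bounded ({x. f x \<noteq> 0} \<union> {x. g x \<noteq> 0})"
      by (rule bounded_subset) (intro Un_mono closure_subset)
  qed auto
  then show ?thesis using assms by (auto simp: Cc_infinity_def compact_support_def Ck_add)
qed

lemma Cc_infinityD:
  fixes f :: "real^'n::finite \<Rightarrow> real"
  assumes f: "f \<in> Cc_infinity"
  shows "f differentiable (at x)" "partial i f differentiable (at x)" "continuous_on UNIV f"
    "continuous_on UNIV (partial i f)" "continuous_on UNIV (partial i (partial j f))" "bounded (range f)"
    and "\<exists>K>0. \<forall>x. \<bar>f x\<bar> \<le> K \<and> (\<forall>i. \<bar>partial i f x\<bar> \<le> K) \<and> (\<forall>i j. \<bar>partial i (partial j f) x\<bar> \<le> K)"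
proof -
  have "f \<in> Cc2" using f by (auto simp: Cc_infinity_def Cc2_def)
  note * = Cc2D[OF this]
  show "f differentiable (at x)" "partial i f differentiable (at x)" "continuous_on UNIV f"
    "continuous_on UNIV (partial i f)" "continuous_on UNIV (partial i (partial j f))"
    "\<exists>K>0. \<forall>x. \<bar>f x\<bar> \<le> K \<and> (\<forall>i. \<bar>partial i f x\<bar> \<le> K) \<and> (\<forall>i j. \<bar>partial i (partial j f) x\<bar> \<le> K)"
    by (rule *)+
  then show "bounded (range f)" by (auto simp: bounded_iff)
qed

lemma frob_inner_eq_inner: "frob_inner S R = S \<bullet> R"
  by (simp add: frob_inner_def trace_def matrix_matrix_mult_def transpose_def inner_vec_def)

lemma grad_add:
  assumes "f differentiable (at x)" "g differentiable (at x)"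
  shows "grad (\<lambda>x. f x + g x) x = grad f x + grad g x"
  using assms by (simp add: grad_def vec_eq_iff partial_add)

lemma hess_add:
  assumes "\<And>x. f differentiable (at x)" "\<And>x. g differentiable (at x)"
    "\<And>i x. partial i f differentiable (at x)" "\<And>i x. partial i g differentiable (at x)"
  shows "hess (\<lambda>x. f x + g x) x = hess f x + hess g x"
proof -
  have "partial j (\<lambda>x. f x + g x) = (\<lambda>x. partial j f x + partial j g x)" for j
    using assms by (intro ext partial_add) auto
  then show ?thesis using assms by (simp add: hess_def vec_eq_iff partial_add)
qed

lemma generator_add:
  assumes "f \<in> Cc_infinity" "g \<in> Cc_infinity"
  shows "generator b a s m (\<lambda>x. f x + g x) x = generator b a s m f x + generator b a s m g x"
  using Cc_infinityD(1,2)[OF assms(1)] Cc_infinityD(1,2)[OF assms(2)]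
  by (simp add: generator_def frob_inner_eq_inner grad_add hess_add inner_add_right algebra_simps)

lemma norm_vector_matrix_mult_le:
  fixes x :: "real^'n::finite" and A :: "real^'m::finite^'n"
  shows "norm (x v* A) \<le> (\<Sum>i\<in>UNIV. \<bar>x $ i\<bar>) * norm A"
proof -
  have "x v* A = (\<Sum>i\<in>UNIV. x $ i *\<^sub>R A $ i)"
    by (simp add: vec_eq_iff vector_matrix_mult_def mult.commute)
  then have "norm (x v* A) \<le> (\<Sum>i\<in>UNIV. \<bar>x $ i\<bar> * norm (A $ i))"
    using norm_sum[of "\<lambda>i. x $ i *\<^sub>R A $ i" UNIV] by simp
  also have "\<dots> \<le> (\<Sum>i\<in>UNIV. \<bar>x $ i\<bar> * norm A)"
    by (intro sum_mono mult_left_mono Finite_Cartesian_Product.norm_nth_le) simp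
  finally show ?thesis by (simp add: sum_distrib_right)
qed

text \<open>If \<open>K\<close> bounds the partial derivatives up to order two, the gradient is at
  most \<open>?n * K\<close> and the Hessian at most \<open>?n * (?n * K)\<close>, where
  \<open>?n\<close> is the dimension. The larger number serves all estimates, and through it the L1
  norms of the coefficients dominate every integral over space that occurs.\<close>

lemma generator_bound:
  fixes \<phi> :: "real^'d::finite \<Rightarrow> real"
  assumes "\<phi> \<in> Cc_infinity"
  shows "\<exists>C\<ge>0. (\<forall>b a s m x. \<bar>generator b a s m \<phi> x\<bar> \<le> C * (norm (b s m x) + norm (a s m x)))
    \<and> (\<forall>(A :: real^'d^'d) x. norm (grad \<phi> x v* A) \<le> C * norm A)"
proof -
  obtain K where K: "K > 0" "\<And>x i. \<bar>partial i \<phi> x\<bar> \<le> K" "\<And>x i j. \<bar>partial i (partial j \<phi>) x\<bar> \<le> K"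
    using Cc_infinityD(7)[OF assms] by blast
  let ?n = "real CARD('d)"
  have n: "?n \<ge> 1" by simp
  have s1: "(\<Sum>i\<in>UNIV. \<bar>grad \<phi> x $ i\<bar>) \<le> ?n * K" for x
    using sum_mono[of UNIV "\<lambda>i. \<bar>grad \<phi> x $ i\<bar>" "\<lambda>_. K"] K(2) by (simp add: grad_def)
  then have g: "norm (grad \<phi> x) \<le> ?n * K" for x using norm_le_l1_cart[of "grad \<phi> x"] order_trans by blast
  have h: "norm (hess \<phi> x) \<le> ?n * (?n * K)" for x
  proof -
    have "norm (hess \<phi> x) \<le> (\<Sum>i\<in>UNIV. norm (hess \<phi> x $ i))"
      unfolding norm_vec_def by (rule L2_set_le_sum) simp
    also have "\<dots> \<le> (\<Sum>i\<in>(UNIV :: 'd set). ?n * K)"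
    proof (rule sum_mono)
      fix i
      have "norm (hess \<phi> x $ i) \<le> (\<Sum>j\<in>UNIV. \<bar>hess \<phi> x $ i $ j\<bar>)" by (rule norm_le_l1_cart)
      also have "\<dots> \<le> (\<Sum>j\<in>(UNIV :: 'd set). K)" using K(3) by (intro sum_mono) (simp add: hess_def)
      finally show "norm (hess \<phi> x $ i) \<le> ?n * K" by simp
    qed
    finally show ?thesis by simp
  qed
  let ?C = "?n * (?n * K)"
  have C: "?n * K \<le> ?C" using n K(1) by (intro mult_left_mono) simp_all
  have C0: "0 \<le> ?C" using K(1) by simp
  show ?thesis
  proof (intro exI[of _ ?C] conjI C0 allI)
    fix b :: "real \<Rightarrow> (real^'d) measure \<Rightarrow> real^'d \<Rightarrow> real^'d" and a s m x
    have "\<bar>b s m x \<bullet> grad \<phi> x\<bar> \<le> norm (b s m x) * ?C"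
      by (rule order_trans[OF Cauchy_Schwarz_ineq2 mult_left_mono[OF order_trans[OF g C] norm_ge_zero]])
    moreover have "\<bar>a s m x \<bullet> hess \<phi> x\<bar> \<le> norm (a s m x) * ?C"
      by (rule order_trans[OF Cauchy_Schwarz_ineq2 mult_left_mono[OF h norm_ge_zero]])
    ultimately have "\<bar>generator b a s m \<phi> x\<bar> \<le> norm (b s m x) * ?C + norm (a s m x) * ?C"
      unfolding generator_def frob_inner_eq_inner by linarith
    then show "\<bar>generator b a s m \<phi> x\<bar> \<le> ?C * (norm (b s m x) + norm (a s m x))" by (simp add: algebra_simps)
  next
    fix A :: "real^'d^'d" and x
    have "norm (grad \<phi> x v* A) \<le> (\<Sum>i\<in>UNIV. \<bar>grad \<phi> x $ i\<bar>) * norm A" by (rule norm_vector_matrix_mult_le)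
    also have "\<dots> \<le> ?C * norm A" by (rule mult_right_mono[OF order_trans[OF s1 C] norm_ge_zero])
    finally show "norm (grad \<phi> x v* A) \<le> ?C * norm A" .
  qed
qed

lemma continuous_grad: "\<phi> \<in> Cc_infinity \<Longrightarrow> continuous_on UNIV (grad \<phi>)"
  unfolding grad_def using Cc_infinityD(4) by (intro continuous_on_vec_lambda) auto

lemma continuous_hess: "\<phi> \<in> Cc_infinity \<Longrightarrow> continuous_on UNIV (hess \<phi>)"
  unfolding hess_def using Cc_infinityD(5) by (intro continuous_on_vec_lambda) auto

lemma borel_measurable_vector_matrix_mult:
  fixes f :: "'a \<Rightarrow> real^'n::finite" and A :: "'a \<Rightarrow> real^'m::finite^'n"
  assumes "f \<in> borel_measurable N" "A \<in> borel_measurable N"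
  shows "(\<lambda>x. f x v* A x) \<in> borel_measurable N"
proof (rule borel_measurable_continuous_Pair[OF assms])
  show "continuous_on UNIV (\<lambda>x. fst x v* (snd x :: real^'m^'n))"
    unfolding vector_matrix_mult_def by (intro continuous_intros)
qed

text \<open>Time and measure are grouped into one parameter so that \<open>x\<close> can be
  integrated against the second component of it, and the target of the path is
  \<open>prob_borel\<close>, where kernels are measurable.\<close>

lemma coefficient_clip_measurable:
  fixes c :: "real \<Rightarrow> 'a::{metric_space, second_countable_topology} measure \<Rightarrow> 'a \<Rightarrow> 'b::topological_space"
  assumes "0 \<le> T" "(\<lambda>(t, m, x). c t m x) \<in> borel_measurable (restrict_space borel {0..T} \<Otimes>\<^sub>M weak_borel \<Otimes>\<^sub>M borel)"
  shows "(\<lambda>(y, x). c (clip 0 T (fst y)) (snd y) x) \<in> borel_measurable ((borel \<Otimes>\<^sub>M prob_borel) \<Otimes>\<^sub>M borel)"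
proof -
  let ?A = "((borel :: real measure) \<Otimes>\<^sub>M (prob_borel :: 'a measure measure)) \<Otimes>\<^sub>M (borel :: 'a measure)"
  have "(\<lambda>z. (clip 0 T (fst (fst z)), snd (fst z), snd z)) \<in> ?A \<rightarrow>\<^sub>M restrict_space borel {0..T} \<Otimes>\<^sub>M weak_borel \<Otimes>\<^sub>M borel"
  proof (rule measurable_Pair[OF _ measurable_Pair])
    show "(\<lambda>z. clip 0 T (fst (fst z))) \<in> ?A \<rightarrow>\<^sub>M restrict_space borel {0..T}"
      using assms(1) by (intro measurable_restrict_space2) auto
    show "(\<lambda>z. snd (fst z)) \<in> ?A \<rightarrow>\<^sub>M weak_borel"
      unfolding measurable_weak_borel_eq by (rule measurable_compose[OF measurable_fst measurable_snd])
  qed (rule measurable_snd)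
  from measurable_compose[OF this assms(2)] show ?thesis by (simp add: case_prod_unfold)
qed

section \<open>Covariation of two Ito integrals\<close>

context filtered_brownian
begin

text \<open>The weighted isometry holds for all three integrals. Expanding the squares on both sides
  of the one for \<open>I3\<close> and cancelling the other two leaves the cross terms. The
  identities for \<open>H3\<close> and \<open>I3\<close> are assumed almost everywhere, which is the
  form in which the equation provides them.\<close>

lemma ito_covariation:
  assumes I1: "has_ito_integral M G T B H1 I1" and I2: "has_ito_integral M G T B H2 I2"
    and I3: "has_ito_integral M G T B H3 I3"
    and H: "AE x in time_product. fst x \<in> {0..T} \<longrightarrow> H3 (fst x) (snd x) = H1 (fst x) (snd x) + H2 (fst x) (snd x)"
    and I: "\<And>t. t \<in> {0..T} \<Longrightarrow> AE \<omega> in M. I3 t \<omega> = I1 t \<omega> + I2 t \<omega>"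
    and uv: "0 \<le> u" "u \<le> v" "v \<le> T"
    and Z: "Z \<in> borel_measurable (G u)" "\<And>\<omega>. \<omega> \<in> space M \<Longrightarrow> \<bar>Z \<omega>\<bar> \<le> C"
  shows "(\<integral>\<omega>. Z \<omega> * ((I1 v \<omega> - I1 u \<omega>) * (I2 v \<omega> - I2 u \<omega>)) \<partial>M)
    = (\<integral>x. indicator {u<..v} (fst x) * Z (snd x) * (indicator {0..T} (fst x) * (H1 (fst x) (snd x) \<bullet> H2 (fst x) (snd x))) \<partial>time_product)"
    and "integrable time_product (\<lambda>x. indicator {0..T} (fst x) * (H1 (fst x) (snd x) \<bullet> H2 (fst x) (snd x)))"
proof -
  have u: "u \<in> {0..T}" and v: "v \<in> {0..T}" using uv by auto
  let ?d = "\<lambda>I \<omega>. I v \<omega> - I u \<omega>"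
  let ?h = "\<lambda>H x. indicator {0..T} (fst x) *\<^sub>R H (fst x) (snd x)"
  let ?J = "\<lambda>x. indicator {u<..v} (fst x) * Z (snd x)"
  have ZM[measurable]: "Z \<in> borel_measurable M" using measurable_G_M[OF u Z(1)] .
  have hm: "?h H \<in> borel_measurable time_product" if "has_ito_integral M G T B H I" for H I
    using progressive_measurable[of H] that by (simp add: case_prod_unfold has_ito_integral_def)
  note [measurable] = hm[OF I1] hm[OF I2] hm[OF I3]
  have hi: "integrable time_product (\<lambda>x. (norm (?h H x))\<^sup>2)" if "has_ito_integral M G T B H I" for H I
    using has_ito_integral_approx[OF that] ito_approximationD(5) by blast
  have inner: "integrable time_product (\<lambda>x. ?h H1 x \<bullet> ?h H2 x)"
  proof (rule Bochner_Integration.integrable_bound)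
    show "integrable time_product (\<lambda>x. (norm (?h H1 x))\<^sup>2 + (norm (?h H2 x))\<^sup>2)"
      by (intro Bochner_Integration.integrable_add hi[OF I1] hi[OF I2])
    have "\<bar>a \<bullet> b\<bar> \<le> (norm a)\<^sup>2 + (norm b)\<^sup>2" for a b :: "real^'d"
    proof -
      have "\<bar>a \<bullet> b\<bar> \<le> norm a * norm b" by (rule Cauchy_Schwarz_ineq2)
      moreover have "2 * norm a * norm b \<le> (norm a)\<^sup>2 + (norm b)\<^sup>2" by (rule sum_squares_bound)
      moreover have "0 \<le> norm a * norm b" by simp
      ultimately show ?thesis by linarith
    qed
    then show "AE x in time_product. norm (?h H1 x \<bullet> ?h H2 x) \<le> norm ((norm (?h H1 x))\<^sup>2 + (norm (?h H2 x))\<^sup>2)"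
      by (intro AE_I2) (simp only: real_norm_def abs_of_nonneg zero_le_power2 add_nonneg_nonneg)
  qed measurable
  have inner_eq: "?h H1 x \<bullet> ?h H2 x = indicator {0..T} (fst x) * (H1 (fst x) (snd x) \<bullet> H2 (fst x) (snd x))" for x
    by (simp add: indicator_def)
  show "integrable time_product (\<lambda>x. indicator {0..T} (fst x) * (H1 (fst x) (snd x) \<bullet> H2 (fst x) (snd x)))"
    using inner unfolding inner_eq .
  have Jm: "?J \<in> borel_measurable time_product" by measurable
  have Jb: "\<bar>?J x\<bar> \<le> \<bar>C\<bar>" if "x \<in> space time_product" for x
    using that Z(2)[of "snd x"] by (auto simp: space_pair_measure indicator_def)
  note J = integrable_mult_bounded[OF Jm _ Jb]
  have iso: "(\<integral>\<omega>. Z \<omega> * (?d I \<omega>)\<^sup>2 \<partial>M) = (\<integral>x. ?J x * (norm (?h H x))\<^sup>2 \<partial>time_product)"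
    if "has_ito_integral M G T B H I" for H I
  proof -
    have "(\<integral>\<omega>. Z \<omega> * (?d I \<omega>)\<^sup>2 \<partial>M) = (\<integral>x. (case x of (s, \<omega>) \<Rightarrow> indicator {u<..v} s * Z \<omega> * (norm (H s \<omega>))\<^sup>2) \<partial>time_product)"
      by (rule has_ito_integral_increment_mean(2)[OF that uv Z])
    also have "\<dots> = (\<integral>x. ?J x * (norm (?h H x))\<^sup>2 \<partial>time_product)"
      by (intro Bochner_Integration.integral_cong refl) (use uv in \<open>auto simp: indicator_def split: prod.splits\<close>)
    finally show ?thesis .
  qed
  have Im: "I s \<in> borel_measurable M" "integrable M (\<lambda>\<omega>. (I s \<omega>)\<^sup>2)" if "has_ito_integral M G T B H I" "s \<in> {0..T}" for H I s
    using has_ito_integral_measurable[OF that] has_ito_integral_square_integrable[OF that] by auto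
  have dm: "?d I \<in> borel_measurable M" "integrable M (\<lambda>\<omega>. (?d I \<omega>)\<^sup>2)" if "has_ito_integral M G T B H I" for H I
    using Im[OF that u] Im[OF that v] by (auto intro: square_integrable_diff)
  note [measurable] = dm(1)[OF I1] dm(1)[OF I2] dm(1)[OF I3]
  have d_int: "integrable M (\<lambda>\<omega>. Z \<omega> * (?d I1 \<omega>)\<^sup>2)" "integrable M (\<lambda>\<omega>. Z \<omega> * (?d I2 \<omega>)\<^sup>2)"
    "integrable M (\<lambda>\<omega>. Z \<omega> * (?d I1 \<omega> * ?d I2 \<omega>))"
    using integrable_mult_bounded[OF ZM dm(2)[OF I1] Z(2)] integrable_mult_bounded[OF ZM dm(2)[OF I2] Z(2)]
      integrable_mult_bounded[OF ZM integrable_mult_square_integrable[OF dm(1)[OF I1] dm(1)[OF I2] dm(2)[OF I1] dm(2)[OF I2]] Z(2)]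
    by blast+
  have "(\<integral>\<omega>. Z \<omega> * (?d I3 \<omega>)\<^sup>2 \<partial>M) = (\<integral>\<omega>. Z \<omega> * (?d I1 \<omega>)\<^sup>2 + 2 * (Z \<omega> * (?d I1 \<omega> * ?d I2 \<omega>)) + Z \<omega> * (?d I2 \<omega>)\<^sup>2 \<partial>M)"
  proof (rule integral_cong_AE)
    show "AE \<omega> in M. Z \<omega> * (?d I3 \<omega>)\<^sup>2 = Z \<omega> * (?d I1 \<omega>)\<^sup>2 + 2 * (Z \<omega> * (?d I1 \<omega> * ?d I2 \<omega>)) + Z \<omega> * (?d I2 \<omega>)\<^sup>2"
      using I[OF u] I[OF v] by eventually_elim (simp add: power2_eq_square algebra_simps)
  qed measurable
  then have 1: "(\<integral>\<omega>. Z \<omega> * (?d I3 \<omega>)\<^sup>2 \<partial>M) = (\<integral>\<omega>. Z \<omega> * (?d I1 \<omega>)\<^sup>2 \<partial>M)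
      + 2 * (\<integral>\<omega>. Z \<omega> * (?d I1 \<omega> * ?d I2 \<omega>) \<partial>M) + (\<integral>\<omega>. Z \<omega> * (?d I2 \<omega>)\<^sup>2 \<partial>M)"
    using d_int by simp
  have "(\<integral>x. ?J x * (norm (?h H3 x))\<^sup>2 \<partial>time_product)
      = (\<integral>x. ?J x * (norm (?h H1 x))\<^sup>2 + 2 * (?J x * (?h H1 x \<bullet> ?h H2 x)) + ?J x * (norm (?h H2 x))\<^sup>2 \<partial>time_product)"
  proof (rule integral_cong_AE)
    show "AE x in time_product. ?J x * (norm (?h H3 x))\<^sup>2
      = ?J x * (norm (?h H1 x))\<^sup>2 + 2 * (?J x * (?h H1 x \<bullet> ?h H2 x)) + ?J x * (norm (?h H2 x))\<^sup>2"
      using H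
    proof eventually_elim
      case (elim x)
      then have "?h H3 x = ?h H1 x + ?h H2 x" by (cases "fst x \<in> {0..T}") (auto simp del: atLeastAtMost_iff)
      moreover have "(norm (a + b))\<^sup>2 = (norm a)\<^sup>2 + 2 * (a \<bullet> b) + (norm b)\<^sup>2" for a b :: "real^'d"
        by (simp add: power2_norm_eq_inner inner_add inner_commute)
      ultimately have sq: "(norm (?h H3 x))\<^sup>2 = (norm (?h H1 x))\<^sup>2 + 2 * (?h H1 x \<bullet> ?h H2 x) + (norm (?h H2 x))\<^sup>2"
        by (simp only:)
      have distr: "j * (a + 2 * b + c) = j * a + 2 * (j * b) + j * c" for j a b c :: real by (simp add: algebra_simps)
      show ?case unfolding sq by (rule distr)
    qed
  qed measurable
  also have "\<dots> = (\<integral>x. ?J x * (norm (?h H1 x))\<^sup>2 \<partial>time_product)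
      + 2 * (\<integral>x. ?J x * (?h H1 x \<bullet> ?h H2 x) \<partial>time_product) + (\<integral>x. ?J x * (norm (?h H2 x))\<^sup>2 \<partial>time_product)"
    using J[OF hi[OF I1]] J[OF hi[OF I2]] J[OF inner] by (simp only: Bochner_Integration.integral_add Bochner_Integration.integrable_add integrable_mult_right integral_mult_right_zero)
  finally have "(\<integral>\<omega>. Z \<omega> * (?d I1 \<omega> * ?d I2 \<omega>) \<partial>M) = (\<integral>x. ?J x * (?h H1 x \<bullet> ?h H2 x) \<partial>time_product)"
    using 1 iso[OF I1] iso[OF I2] iso[OF I3] by linarith
  then show "(\<integral>\<omega>. Z \<omega> * ((I1 v \<omega> - I1 u \<omega>) * (I2 v \<omega> - I2 u \<omega>)) \<partial>M)
    = (\<integral>x. indicator {u<..v} (fst x) * Z (snd x) * (indicator {0..T} (fst x) * (H1 (fst x) (snd x) \<bullet> H2 (fst x) (snd x))) \<partial>time_product)"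
    unfolding inner_eq .
qed

end

section \<open>The Fokker-Planck equation\<close>

text \<open>Slices at fixed \<omega>: they serve to compare time integrals along a single
  path.\<close>

lemma (in filtered_brownian) AE_time_product_swap:
  assumes "AE x in time_product. P x"
  shows "AE \<omega> in M. AE s in lborel. P (s, \<omega>)"
proof -
  interpret pair_sigma_finite lborel M by (rule pair_sigma_finite_time_product)
  obtain N where N: "N \<in> sets time_product" "emeasure time_product N = 0" "{x \<in> space time_product. \<not> P x} \<subseteq> N"
    using assms unfolding eventually_ae_filter null_sets_def by blast
  have "(\<integral>\<^sup>+\<omega>. emeasure lborel ((\<lambda>s. (s, \<omega>)) -` N) \<partial>M) = 0"
    using emeasure_pair_measure_alt2[OF N(1)] N(2) by simp
  then have "AE \<omega> in M. emeasure lborel ((\<lambda>s. (s, \<omega>)) -` N) = 0"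
    using measurable_emeasure_Pair2[OF N(1)] by (simp add: nn_integral_0_iff_AE)
  with AE_space show ?thesis
  proof eventually_elim
    case (elim \<omega>)
    show ?case
    proof (rule AE_I')
      show "(\<lambda>s. (s, \<omega>)) -` N \<in> null_sets lborel"
        using elim(2) sets_Pair2[OF N(1), of \<omega>] by (intro null_setsI)
      show "{s \<in> space lborel. \<not> P (s, \<omega>)} \<subseteq> (\<lambda>s. (s, \<omega>)) -` N"
        using N(3) elim(1) by (auto simp: space_pair_measure)
    qed
  qed
qed

locale spde_solution = filtered_brownian M G T B
  for M :: "'w measure" and G T and B :: "real \<Rightarrow> 'w \<Rightarrow> real^'d::finite" +
  fixes b :: "real \<Rightarrow> (real^'d) measure \<Rightarrow> real^'d \<Rightarrow> real^'d"
    and a \<gamma> :: "real \<Rightarrow> (real^'d) measure \<Rightarrow> real^'d \<Rightarrow> real^'d^'d"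
    and \<mu> :: "real \<Rightarrow> 'w \<Rightarrow> (real^'d) measure"
  assumes b_measurable: "(\<lambda>(t, m, x). b t m x) \<in>
      borel_measurable (restrict_space borel {0..T} \<Otimes>\<^sub>M weak_borel \<Otimes>\<^sub>M borel)"
    and a_measurable: "(\<lambda>(t, m, x). a t m x) \<in>
      borel_measurable (restrict_space borel {0..T} \<Otimes>\<^sub>M weak_borel \<Otimes>\<^sub>M borel)"
    and \<gamma>_measurable: "(\<lambda>(t, m, x). \<gamma> t m x) \<in>
      borel_measurable (restrict_space borel {0..T} \<Otimes>\<^sub>M weak_borel \<Otimes>\<^sub>M borel)"
    and adapted: "continuous_adapted M G T \<mu>"
    and spde: "solves_spde b a \<gamma> M G T B \<mu>"
    and coefficients_integrable: "(\<integral>\<^sup>+ \<omega>. (\<integral>\<^sup>+ t\<in>{0..T}.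
            ((\<integral>\<^sup>+ x. ennreal (norm (b t (\<mu> t \<omega>) x)) \<partial>\<mu> t \<omega>)
           + (\<integral>\<^sup>+ x. ennreal (norm (a t (\<mu> t \<omega>) x)) \<partial>\<mu> t \<omega>)
           + (\<integral>\<^sup>+ x. ennreal (norm (\<gamma> t (\<mu> t \<omega>) x)) \<partial>\<mu> t \<omega>)\<^sup>2) \<partial>lborel) \<partial>M) < \<infinity>"
begin

section \<open>Coefficients along the solution path\<close>

definition L1_norm :: "(real \<Rightarrow> (real^'d) measure \<Rightarrow> real^'d \<Rightarrow> 'c::real_normed_vector) \<Rightarrow> real \<Rightarrow> (real^'d) measure \<Rightarrow> ennreal" where
  "L1_norm c s m = (\<integral>\<^sup>+ x. ennreal (norm (c s m x)) \<partial>m)"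

text \<open>Here the integrals over space are genuine. Elsewhere a Bochner integral may take its
  default value 0, and additivity in the test function can fail.\<close>

definition finite_coefficients :: "real \<Rightarrow> (real^'d) measure \<Rightarrow> bool" where
  "finite_coefficients s m \<longleftrightarrow> L1_norm b s m < \<infinity> \<and> L1_norm a s m < \<infinity> \<and> L1_norm \<gamma> s m < \<infinity>"

abbreviation gen_int :: "(real^'d \<Rightarrow> real) \<Rightarrow> real \<Rightarrow> (real^'d) measure \<Rightarrow> real" where
  "gen_int \<phi> s m \<equiv> \<integral>x. generator b a s m \<phi> x \<partial>m"

abbreviation diff_int :: "(real^'d \<Rightarrow> real) \<Rightarrow> real \<Rightarrow> (real^'d) measure \<Rightarrow> real^'d" where
  "diff_int \<phi> s m \<equiv> \<integral>x. grad \<phi> x v* \<gamma> s m x \<partial>m"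

abbreviation clipped :: "(real \<Rightarrow> (real^'d) measure \<Rightarrow> real^'d \<Rightarrow> 'c) \<Rightarrow> (real \<times> (real^'d) measure) \<Rightarrow> real^'d \<Rightarrow> 'c" where
  "clipped c y x \<equiv> c (clip 0 T (fst y)) (snd y) x"

lemmas coefficients_clip_measurable[measurable] =
  coefficient_clip_measurable[OF order_less_imp_le[OF T_pos] b_measurable]
  coefficient_clip_measurable[OF order_less_imp_le[OF T_pos] a_measurable]
  coefficient_clip_measurable[OF order_less_imp_le[OF T_pos] \<gamma>_measurable]

lemma \<mu>_jointly_measurable: "(\<lambda>x. \<mu> (clip 0 T (fst x)) (snd x)) \<in> time_product \<rightarrow>\<^sub>M prob_borel"
proof -
  have "(\<lambda>(s, \<omega>). \<mu> (clip 0 T s) \<omega>) \<in> borel \<Otimes>\<^sub>M M \<rightarrow>\<^sub>M prob_borel"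
    using T_pos adapted subalgebra_G by (intro continuous_adapted_jointly_measurable) auto
  moreover have "sets (borel \<Otimes>\<^sub>M M) = sets time_product" by (intro sets_pair_measure_cong) auto
  ultimately show ?thesis using measurable_cong_sets by (fastforce simp: case_prod_unfold)
qed

lemma path_measurable: "(\<lambda>x. (fst x, \<mu> (clip 0 T (fst x)) (snd x))) \<in> time_product \<rightarrow>\<^sub>M borel \<Otimes>\<^sub>M prob_borel"
  by (intro measurable_Pair \<mu>_jointly_measurable) simp

lemma \<mu>_space:
  assumes "t \<in> {0..T}" "\<omega> \<in> space M"
  shows "\<mu> t \<omega> \<in> space prob_borel"
proof -
  have "\<mu> t \<in> M \<rightarrow>\<^sub>M weak_borel"
    using adapted assms(1) by (intro measurable_G_M[OF assms(1)]) (auto simp: continuous_adapted_def)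
  from measurable_space[OF this assms(2)] show ?thesis by (simp add: space_weak_borel)
qed

lemma \<mu>_measurable: "t \<in> {0..T} \<Longrightarrow> \<mu> t \<in> M \<rightarrow>\<^sub>M prob_borel"
  using adapted measurable_G_M[of t "\<mu> t" weak_borel]
  by (auto simp: continuous_adapted_def measurable_weak_borel_eq)

lemma generator_measurable:
  assumes "\<phi> \<in> Cc_infinity"
  shows "(\<lambda>(y, x). generator b a (clip 0 T (fst y)) (snd y) \<phi> x) \<in> borel_measurable ((borel \<Otimes>\<^sub>M prob_borel) \<Otimes>\<^sub>M borel)"
proof -
  have [measurable]: "grad \<phi> \<in> borel_measurable borel" "hess \<phi> \<in> borel_measurable borel"
    using continuous_grad[OF assms] continuous_hess[OF assms] by (auto intro: borel_measurable_continuous_onI)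
  show ?thesis unfolding generator_def frob_inner_eq_inner by measurable
qed

lemma diffusion_measurable:
  assumes "\<phi> \<in> Cc_infinity"
  shows "(\<lambda>(y, x). grad \<phi> x v* \<gamma> (clip 0 T (fst y)) (snd y) x) \<in> borel_measurable ((borel \<Otimes>\<^sub>M prob_borel) \<Otimes>\<^sub>M borel)"
proof -
  have g: "grad \<phi> \<in> borel_measurable borel"
    using continuous_grad[OF assms] by (auto intro: borel_measurable_continuous_onI)
  show ?thesis
    using borel_measurable_vector_matrix_mult[OF measurable_compose[OF measurable_snd g] coefficients_clip_measurable(3)]
    by (simp add: case_prod_unfold)
qed

lemma integral_kernel_measurable:
  fixes h :: "real \<times> (real^'d) measure \<Rightarrow> real^'d \<Rightarrow> 'c::{banach, second_countable_topology}"
  assumes "(\<lambda>(y, x). h y x) \<in> borel_measurable ((borel \<Otimes>\<^sub>M prob_borel) \<Otimes>\<^sub>M borel)"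
  shows "(\<lambda>y. \<integral>x. h y x \<partial>snd y) \<in> borel_measurable (borel \<Otimes>\<^sub>M prob_borel)"
  by (rule integral_measurable_subprob_algebra_pair[OF assms measurable_prob_algebraD[OF measurable_snd]])

lemma L1_norm_measurable:
  fixes c :: "real \<Rightarrow> (real^'d) measure \<Rightarrow> real^'d \<Rightarrow> 'c::{real_normed_vector, second_countable_topology}"
  assumes [measurable]: "(\<lambda>(y, x). clipped c y x) \<in> borel_measurable ((borel \<Otimes>\<^sub>M prob_borel) \<Otimes>\<^sub>M borel)"
  shows "(\<lambda>y. L1_norm c (clip 0 T (fst y)) (snd y)) \<in> borel_measurable (borel \<Otimes>\<^sub>M prob_borel)"
  unfolding L1_norm_def
  by (rule nn_integral_measurable_subprob_algebra2[OF _ measurable_prob_algebraD[OF measurable_snd]]) measurable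

lemma section_measurable:
  assumes c: "(\<lambda>(y, x). clipped c y x) \<in> borel_measurable ((borel \<Otimes>\<^sub>M prob_borel) \<Otimes>\<^sub>M borel)"
    and s: "s \<in> {0..T}" and m: "m \<in> space prob_borel"
  shows "c s m \<in> borel_measurable m"
proof -
  have "(\<lambda>x. ((s, m), x)) \<in> borel \<rightarrow>\<^sub>M (borel \<Otimes>\<^sub>M prob_borel) \<Otimes>\<^sub>M borel"
    using m by (intro measurable_Pair1') (simp add: space_pair_measure)
  from measurable_compose[OF this c] s have "c s m \<in> borel_measurable borel" by simp
  then show ?thesis using measurable_cong_sets[OF prob_borelD(2)[OF m] refl] by blast
qed

lemma finite_coefficients_integrable:
  assumes s: "s \<in> {0..T}" and m: "m \<in> space prob_borel" and fin: "finite_coefficients s m" and \<phi>: "\<phi> \<in> Cc_infinity"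
  shows "integrable m (generator b a s m \<phi>)" "integrable m (\<lambda>x. grad \<phi> x v* \<gamma> s m x)"
proof -
  obtain C where C: "C \<ge> 0" "\<And>s m x. \<bar>generator b a s m \<phi> x\<bar> \<le> C * (norm (b s m x) + norm (a s m x))"
    "\<And>(A :: real^'d^'d) x. norm (grad \<phi> x v* A) \<le> C * norm A"
    using generator_bound[OF \<phi>] by blast
  have int: "integrable m (b s m)" "integrable m (a s m)" "integrable m (\<gamma> s m)"
    using fin section_measurable[OF coefficients_clip_measurable(1) s m]
      section_measurable[OF coefficients_clip_measurable(2) s m] section_measurable[OF coefficients_clip_measurable(3) s m]
    by (auto simp: finite_coefficients_def L1_norm_def integrable_iff_bounded)
  show "integrable m (generator b a s m \<phi>)"
  proof (rule Bochner_Integration.integrable_bound)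
    show "integrable m (\<lambda>x. C * (norm (b s m x) + norm (a s m x)))" using int by auto
    show "generator b a s m \<phi> \<in> borel_measurable m"
      by (rule section_measurable[of "\<lambda>s m. generator b a s m \<phi>", OF generator_measurable[OF \<phi>] s m])
    show "AE x in m. norm (generator b a s m \<phi> x) \<le> norm (C * (norm (b s m x) + norm (a s m x)))"
      using C(1,2) by (intro AE_I2) (simp add: abs_of_nonneg)
  qed
  show "integrable m (\<lambda>x. grad \<phi> x v* \<gamma> s m x)"
  proof (rule Bochner_Integration.integrable_bound)
    show "integrable m (\<lambda>x. C * norm (\<gamma> s m x))" using int by auto
    show "(\<lambda>x. grad \<phi> x v* \<gamma> s m x) \<in> borel_measurable m"
      by (rule section_measurable[of "\<lambda>s m x. grad \<phi> x v* \<gamma> s m x", OF diffusion_measurable[OF \<phi>] s m])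
    show "AE x in m. norm (grad \<phi> x v* \<gamma> s m x) \<le> norm (C * norm (\<gamma> s m x))"
      using C(1,3) by (intro AE_I2) (simp add: abs_of_nonneg)
  qed
qed

lemma L1_norms_finite:
  "(\<integral>\<^sup>+x. indicator {0..T} (fst x) * (L1_norm b (fst x) (\<mu> (fst x) (snd x)) + L1_norm a (fst x) (\<mu> (fst x) (snd x))
      + (L1_norm \<gamma> (fst x) (\<mu> (fst x) (snd x)))\<^sup>2) \<partial>time_product) < \<infinity>"
  and L1_norms_measurable:
  "(\<lambda>x. indicator {0..T} (fst x) * (L1_norm b (fst x) (\<mu> (fst x) (snd x)) + L1_norm a (fst x) (\<mu> (fst x) (snd x))
      + (L1_norm \<gamma> (fst x) (\<mu> (fst x) (snd x)))\<^sup>2)) \<in> borel_measurable time_product"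
proof -
  let ?N = "\<lambda>s m. L1_norm b s m + L1_norm a s m + (L1_norm \<gamma> s m)\<^sup>2"
  have N: "(\<lambda>y. ?N (clip 0 T (fst y)) (snd y)) \<in> borel_measurable (borel \<Otimes>\<^sub>M prob_borel)"
    using L1_norm_measurable[OF coefficients_clip_measurable(1)] L1_norm_measurable[OF coefficients_clip_measurable(2)]
      L1_norm_measurable[OF coefficients_clip_measurable(3)] by measurable
  have [measurable]: "(\<lambda>x. ?N (clip 0 T (fst x)) (\<mu> (clip 0 T (fst x)) (snd x))) \<in> borel_measurable time_product"
    using measurable_compose[OF path_measurable N] by simp
  have eq: "(\<lambda>x. indicator {0..T} (fst x) * ?N (fst x) (\<mu> (fst x) (snd x)))
     = (\<lambda>x. indicator {0..T} (fst x) * ?N (clip 0 T (fst x)) (\<mu> (clip 0 T (fst x)) (snd x)))"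
    by (auto simp: fun_eq_iff indicator_def)
  show meas: "(\<lambda>x. indicator {0..T} (fst x) * ?N (fst x) (\<mu> (fst x) (snd x))) \<in> borel_measurable time_product"
    unfolding eq by measurable
  have "(\<integral>\<^sup>+ \<omega>. (\<integral>\<^sup>+ t\<in>{0..T}. ?N t (\<mu> t \<omega>) \<partial>lborel) \<partial>M)
      = (\<integral>\<^sup>+x. (case x of (s, \<omega>) \<Rightarrow> indicator {0..T} s * ?N s (\<mu> s \<omega>)) \<partial>time_product)"
    by (rule nn_integral_time_product) (use meas in \<open>simp add: case_prod_unfold\<close>)
  then show "(\<integral>\<^sup>+x. indicator {0..T} (fst x) * ?N (fst x) (\<mu> (fst x) (snd x)) \<partial>time_product) < \<infinity>"
    using coefficients_integrable unfolding L1_norm_def by (simp add: case_prod_unfold)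
qed

lemma AE_finite_coefficients:
  "AE x in time_product. fst x \<in> {0..T} \<longrightarrow> finite_coefficients (fst x) (\<mu> (fst x) (snd x))"
proof -
  have "AE x in time_product. indicator {0..T} (fst x) * (L1_norm b (fst x) (\<mu> (fst x) (snd x)) + L1_norm a (fst x) (\<mu> (fst x) (snd x))
      + (L1_norm \<gamma> (fst x) (\<mu> (fst x) (snd x)))\<^sup>2) \<noteq> \<infinity>"
    using L1_norms_finite by (intro nn_integral_PInf_AE L1_norms_measurable) auto
  then show ?thesis
    by eventually_elim (auto simp: finite_coefficients_def less_top power2_eq_square ennreal_mult_eq_top_iff)
qed

lemma gen_int_integrable:
  assumes \<phi>: "\<phi> \<in> Cc_infinity"
  shows "integrable time_product (\<lambda>x. indicator {0..T} (fst x) * gen_int \<phi> (fst x) (\<mu> (fst x) (snd x)))"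
proof -
  obtain C where C: "C \<ge> 0" "\<And>s m x. \<bar>generator b a s m \<phi> x\<bar> \<le> C * (norm (b s m x) + norm (a s m x))"
    using generator_bound[OF \<phi>] by blast
  have g: "(\<lambda>y. gen_int \<phi> (clip 0 T (fst y)) (snd y)) \<in> borel_measurable (borel \<Otimes>\<^sub>M prob_borel)"
    by (rule integral_kernel_measurable[OF generator_measurable[OF \<phi>]])
  have [measurable]: "(\<lambda>x. gen_int \<phi> (clip 0 T (fst x)) (\<mu> (clip 0 T (fst x)) (snd x))) \<in> borel_measurable time_product"
    using measurable_compose[OF path_measurable g] by simp
  have eq: "(\<lambda>x. indicator {0..T} (fst x) * gen_int \<phi> (fst x) (\<mu> (fst x) (snd x)))
     = (\<lambda>x. indicator {0..T} (fst x) * gen_int \<phi> (clip 0 T (fst x)) (\<mu> (clip 0 T (fst x)) (snd x)))"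
    by (auto simp: fun_eq_iff indicator_def)
  show ?thesis
  proof (rule integrableI_bounded)
    show "(\<lambda>x. indicator {0..T} (fst x) * gen_int \<phi> (fst x) (\<mu> (fst x) (snd x))) \<in> borel_measurable time_product"
      unfolding eq by measurable
    let ?N = "\<lambda>x. indicator {0..T} (fst x) * (L1_norm b (fst x) (\<mu> (fst x) (snd x)) + L1_norm a (fst x) (\<mu> (fst x) (snd x))
      + (L1_norm \<gamma> (fst x) (\<mu> (fst x) (snd x)))\<^sup>2)"
    have le: "ennreal (norm (indicator {0..T} (fst x) * gen_int \<phi> (fst x) (\<mu> (fst x) (snd x)))) \<le> ennreal C * ?N x"
      if x: "x \<in> space time_product" for x
    proof (cases "fst x \<in> {0..T}")
      case True
      let ?m = "\<mu> (fst x) (snd x)"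
      have m: "?m \<in> space prob_borel" using True x by (intro \<mu>_space) (auto simp: space_pair_measure)
      note [measurable] = section_measurable[OF coefficients_clip_measurable(1) True m]
        section_measurable[OF coefficients_clip_measurable(2) True m]
      have "ennreal (norm (gen_int \<phi> (fst x) ?m)) \<le> (\<integral>\<^sup>+y. ennreal (norm (generator b a (fst x) ?m \<phi> y)) \<partial>?m)"
      \<comment> \<open>Without integrability the left-hand side is 0 by convention, so the bound
        holds at every point and not merely almost everywhere.\<close>
      proof (cases "integrable ?m (generator b a (fst x) ?m \<phi>)")
        case True
        then show ?thesis by (rule integral_norm_bound_ennreal)
      qed (simp add: not_integrable_integral_eq)
      also have "\<dots> \<le> (\<integral>\<^sup>+y. ennreal C * (ennreal (norm (b (fst x) ?m y)) + ennreal (norm (a (fst x) ?m y))) \<partial>?m)"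
        using C by (intro nn_integral_mono) (simp add: ennreal_plus[symmetric] ennreal_mult[symmetric] del: ennreal_plus)
      also have "\<dots> = ennreal C * (L1_norm b (fst x) ?m + L1_norm a (fst x) ?m)"
        unfolding L1_norm_def by (simp add: nn_integral_cmult nn_integral_add)
      also have "\<dots> \<le> ennreal C * ?N x" using True by (intro mult_left_mono) simp_all
      finally show ?thesis using True by simp
    qed simp
    have "(\<integral>\<^sup>+x. ennreal (norm (indicator {0..T} (fst x) * gen_int \<phi> (fst x) (\<mu> (fst x) (snd x)))) \<partial>time_product)
        \<le> (\<integral>\<^sup>+x. ennreal C * ?N x \<partial>time_product)" by (intro nn_integral_mono le)
    also have "\<dots> = ennreal C * (\<integral>\<^sup>+x. ?N x \<partial>time_product)" by (intro nn_integral_cmult L1_norms_measurable)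
    also have "\<dots> < \<infinity>" using L1_norms_finite by (simp add: ennreal_mult_less_top)
    finally show "(\<integral>\<^sup>+x. ennreal (norm (indicator {0..T} (fst x) * gen_int \<phi> (fst x) (\<mu> (fst x) (snd x)))) \<partial>time_product) < \<infinity>" .
  qed
qed

lemma gen_int_add:
  assumes "finite_coefficients s m" "s \<in> {0..T}" "m \<in> space prob_borel" "\<phi> \<in> Cc_infinity" "\<psi> \<in> Cc_infinity"
  shows "gen_int (\<lambda>x. \<phi> x + \<psi> x) s m = gen_int \<phi> s m + gen_int \<psi> s m"
    and "diff_int (\<lambda>x. \<phi> x + \<psi> x) s m = diff_int \<phi> s m + diff_int \<psi> s m"
proof -
  note int = finite_coefficients_integrable[OF assms(2,3,1)]
  show "gen_int (\<lambda>x. \<phi> x + \<psi> x) s m = gen_int \<phi> s m + gen_int \<psi> s m"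
    unfolding generator_add[OF assms(4,5)] by (rule Bochner_Integration.integral_add[OF int(1)[OF assms(4)] int(1)[OF assms(5)]])
  have "grad (\<lambda>x. \<phi> x + \<psi> x) x v* \<gamma> s m x = grad \<phi> x v* \<gamma> s m x + grad \<psi> x v* \<gamma> s m x" for x
    using Cc_infinityD(1)[OF assms(4)] Cc_infinityD(1)[OF assms(5)]
    by (simp add: grad_add vec_eq_iff vector_matrix_mult_def distrib_left distrib_right sum.distrib)
  then show "diff_int (\<lambda>x. \<phi> x + \<psi> x) s m = diff_int \<phi> s m + diff_int \<psi> s m"
    using Bochner_Integration.integral_add[OF int(2)[OF assms(4)] int(2)[OF assms(5)]] by simp
qed

text \<open>The equation with its drift integrand cut off to \<open>{0..T}\<close>, so that this
  integrand is a density on \<open>time_product\<close> as \<open>ito_system\<close>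
  expects.\<close>

definition solution_integral :: "(real^'d \<Rightarrow> real) \<Rightarrow> (real \<Rightarrow> 'w \<Rightarrow> real) \<Rightarrow> bool" where
  "solution_integral \<phi> I \<longleftrightarrow> has_ito_integral M G T B (\<lambda>s \<omega>. diff_int \<phi> s (\<mu> s \<omega>)) I \<and>
    (AE \<omega> in M. \<forall>t\<in>{0..T}. (\<integral>x. \<phi> x \<partial>\<mu> t \<omega>) = (\<integral>x. \<phi> x \<partial>\<mu> 0 \<omega>)
      + (\<integral>s. indicator {0..t} s * (indicator {0..T} s * gen_int \<phi> s (\<mu> s \<omega>)) \<partial>lborel) + I t \<omega>)"

lemma solution_integral_exists:
  assumes "\<phi> \<in> Cc_infinity"
  shows "\<exists>I. solution_integral \<phi> I"
proof -
  obtain I where I: "has_ito_integral M G T B (\<lambda>s \<omega>. diff_int \<phi> s (\<mu> s \<omega>)) I"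
    and eq: "AE \<omega> in M. \<forall>t\<in>{0..T}. (\<integral>x. \<phi> x \<partial>\<mu> t \<omega>) = (\<integral>x. \<phi> x \<partial>\<mu> 0 \<omega>)
             + (LINT s:{0..t}|lborel. gen_int \<phi> s (\<mu> s \<omega>)) + I t \<omega>"
    using spde assms unfolding solves_spde_def by blast
  have "(LINT s:{0..t}|lborel. gen_int \<phi> s (\<mu> s \<omega>)) = (\<integral>s. indicator {0..t} s * (indicator {0..T} s * gen_int \<phi> s (\<mu> s \<omega>)) \<partial>lborel)"
    if "t \<in> {0..T}" for t \<omega>
    unfolding set_lebesgue_integral_def
    by (intro Bochner_Integration.integral_cong) (use that in \<open>auto simp: indicator_def\<close>)
  then show ?thesis using I eq unfolding solution_integral_def by auto
qed

text \<open>Additivity is read off from the equation and not from the construction of the integral: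
  the integrals of the test functions are additive, the drift terms are additive almost surely,
  hence the remaining terms are so too.\<close>

lemma solution_integral_add:
  assumes \<phi>: "\<phi> \<in> Cc_infinity" "\<psi> \<in> Cc_infinity"
    and I: "solution_integral \<phi> I1" "solution_integral \<psi> I2" "solution_integral (\<lambda>x. \<phi> x + \<psi> x) I3"
    and t: "t \<in> {0..T}"
  shows "AE \<omega> in M. I3 t \<omega> = I1 t \<omega> + I2 t \<omega>"
proof -
  interpret pair_sigma_finite lborel M by (rule pair_sigma_finite_time_product)
  let ?g = "\<lambda>\<phi> s \<omega>. indicator {0..T} s * gen_int \<phi> s (\<mu> s \<omega>)"
  have "AE \<omega> in M. integrable lborel (\<lambda>s. ?g \<phi> s \<omega>)" if "\<phi> \<in> Cc_infinity" for \<phi>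
    using AE_integrable_snd[of "?g \<phi>"] gen_int_integrable[OF that] by (simp add: case_prod_unfold)
  note int = this[OF \<phi>(1)] this[OF \<phi>(2)]
  have good: "AE \<omega> in M. AE s in lborel. s \<in> {0..T} \<longrightarrow> finite_coefficients s (\<mu> s \<omega>)"
    using AE_time_product_swap[OF AE_finite_coefficients] by simp
  have eqs: "AE \<omega> in M. \<forall>t\<in>{0..T}. (\<integral>x. \<phi> x \<partial>\<mu> t \<omega>) = (\<integral>x. \<phi> x \<partial>\<mu> 0 \<omega>)
      + (\<integral>s. indicator {0..t} s * ?g \<phi> s \<omega> \<partial>lborel) + I t \<omega>" if "solution_integral \<phi> I" for \<phi> I
    using that by (simp add: solution_integral_def)
  show ?thesis
    using int good eqs[OF I(1)] eqs[OF I(2)] eqs[OF I(3)] AE_space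
  proof eventually_elim
    case (elim \<omega>)
    have add: "(\<integral>x. \<phi> x + \<psi> x \<partial>\<mu> r \<omega>) = (\<integral>x. \<phi> x \<partial>\<mu> r \<omega>) + (\<integral>x. \<psi> x \<partial>\<mu> r \<omega>)" if "r \<in> {0..T}" for r
      using \<mu>_space[OF that elim(7)] \<phi>
      by (intro Bochner_Integration.integral_add integrable_bounded_continuous Cc_infinityD)
    have ind: "integrable lborel (\<lambda>s. indicator {0..t} s * ?g \<phi> s \<omega>)" "integrable lborel (\<lambda>s. indicator {0..t} s * ?g \<psi> s \<omega>)"
      using integrable_mult_indicator[OF _ elim(1), of "{0..t}"] integrable_mult_indicator[OF _ elim(2), of "{0..t}"] by auto
    have "(\<integral>s. indicator {0..t} s * ?g (\<lambda>x. \<phi> x + \<psi> x) s \<omega> \<partial>lborel)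
       = (\<integral>s. indicator {0..t} s * ?g \<phi> s \<omega> + indicator {0..t} s * ?g \<psi> s \<omega> \<partial>lborel)"
    proof -
      have ae: "AE s in lborel. indicator {0..t} s * ?g \<phi> s \<omega> + indicator {0..t} s * ?g \<psi> s \<omega>
          = indicator {0..t} s * ?g (\<lambda>x. \<phi> x + \<psi> x) s \<omega>"
        using elim(3)
      proof eventually_elim
        case (elim s)
        show ?case
        proof (cases "s \<in> {0..T}")
          case True
          then show ?thesis using gen_int_add(1)[OF _ True \<mu>_space[OF True \<open>\<omega> \<in> space M\<close>] \<phi>] elim by (simp add: distrib_left)
        qed simp
      qed
      have m: "(\<lambda>s. indicator {0..t} s * ?g \<phi> s \<omega> + indicator {0..t} s * ?g \<psi> s \<omega>) \<in> borel_measurable lborel"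
        using ind by (intro borel_measurable_add) auto
      have "(\<lambda>s. gen_int (\<lambda>x. \<phi> x + \<psi> x) (clip 0 T s) (\<mu> (clip 0 T s) \<omega>)) \<in> borel_measurable lborel"
      proof -
        have "(\<lambda>s. (s, \<omega>)) \<in> lborel \<rightarrow>\<^sub>M time_product" using elim(7) by (intro measurable_Pair2')
        from measurable_compose[OF measurable_compose[OF this path_measurable]
            integral_kernel_measurable[OF generator_measurable[OF Cc_infinity_add[OF \<phi>]]]]
        show ?thesis by simp
      qed
      then have "(\<lambda>s. indicator {0..t} s * (indicator {0..T} s * gen_int (\<lambda>x. \<phi> x + \<psi> x) (clip 0 T s) (\<mu> (clip 0 T s) \<omega>))) \<in> borel_measurable lborel"
        by measurable
      moreover have "(\<lambda>s. indicator {0..t} s * (indicator {0..T} s * gen_int (\<lambda>x. \<phi> x + \<psi> x) (clip 0 T s) (\<mu> (clip 0 T s) \<omega>)))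
         = (\<lambda>s. indicator {0..t} s * ?g (\<lambda>x. \<phi> x + \<psi> x) s \<omega>)"
        by (auto simp: fun_eq_iff indicator_def)
      ultimately have m': "(\<lambda>s. indicator {0..t} s * ?g (\<lambda>x. \<phi> x + \<psi> x) s \<omega>) \<in> borel_measurable lborel" by simp
      from integral_cong_AE[OF m m' ae] show ?thesis by simp
    qed
    also have "\<dots> = (\<integral>s. indicator {0..t} s * ?g \<phi> s \<omega> \<partial>lborel) + (\<integral>s. indicator {0..t} s * ?g \<psi> s \<omega> \<partial>lborel)"
      by (rule Bochner_Integration.integral_add[OF ind])
    finally have "(\<integral>s. indicator {0..t} s * ?g (\<lambda>x. \<phi> x + \<psi> x) s \<omega> \<partial>lborel)
      = (\<integral>s. indicator {0..t} s * ?g \<phi> s \<omega> \<partial>lborel) + (\<integral>s. indicator {0..t} s * ?g \<psi> s \<omega> \<partial>lborel)" .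
    moreover have "0 \<in> {0..T}" using t by auto
    ultimately show ?case
      using elim(4)[rule_format, OF t] elim(5)[rule_format, OF t] elim(6)[rule_format, OF t] add[OF t] add[of 0] by linarith
  qed
qed

lemma solution_ito_system:
  fixes \<phi> :: "'k::finite \<Rightarrow> real^'d \<Rightarrow> real"
  assumes \<phi>: "\<And>i. \<phi> i \<in> Cc_infinity" and I: "\<And>i. solution_integral (\<phi> i) (I i)"
  shows "ito_system M G T B (\<lambda>t \<omega>. pairing (\<mu> t \<omega>) \<phi>) I
    (\<lambda>i x. indicator {0..T} (fst x) * gen_int (\<phi> i) (fst x) (\<mu> (fst x) (snd x)))
    (\<lambda>i j x. indicator {0..T} (fst x)
      * (diff_int (\<phi> i) (fst x) (\<mu> (fst x) (snd x)) \<bullet> diff_int (\<phi> j) (fst x) (\<mu> (fst x) (snd x))))"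
proof -
  have ito: "has_ito_integral M G T B (\<lambda>s \<omega>. diff_int (\<phi> i) s (\<mu> s \<omega>)) (I i)" for i
    using I by (simp add: solution_integral_def)
  have c: "continuous_on UNIV (\<phi> i)" "bounded (range (\<phi> i))" for i using Cc_infinityD(3,6)[OF \<phi>] by auto
  \<comment> \<open>The equation for \<open>\<phi> i + \<phi> j\<close> supplies the third integral
    of the polarization, also when \<open>i = j\<close>.\<close>
  have "\<exists>I3. solution_integral (\<lambda>x. \<phi> i x + \<phi> j x) I3" for i j
    by (intro solution_integral_exists Cc_infinity_add \<phi>)
  then obtain I3 where I3: "\<And>i j. solution_integral (\<lambda>x. \<phi> i x + \<phi> j x) (I3 i j)" by metis
  have ito3: "has_ito_integral M G T B (\<lambda>s \<omega>. diff_int (\<lambda>x. \<phi> i x + \<phi> j x) s (\<mu> s \<omega>)) (I3 i j)" for i j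
    using I3 by (simp add: solution_integral_def)
  have H3: "AE x in time_product. fst x \<in> {0..T} \<longrightarrow> diff_int (\<lambda>x. \<phi> i x + \<phi> j x) (fst x) (\<mu> (fst x) (snd x))
      = diff_int (\<phi> i) (fst x) (\<mu> (fst x) (snd x)) + diff_int (\<phi> j) (fst x) (\<mu> (fst x) (snd x))" for i j
    using AE_finite_coefficients AE_space[of time_product]
  proof eventually_elim
    case (elim x)
    show ?case
    proof (rule impI)
      assume s: "fst x \<in> {0..T}"
      have "snd x \<in> space M" using elim by (auto simp: space_pair_measure)
      from gen_int_add(2)[OF _ s \<mu>_space[OF s this] \<phi> \<phi>] elim(1) s
      show "diff_int (\<lambda>x. \<phi> i x + \<phi> j x) (fst x) (\<mu> (fst x) (snd x))
        = diff_int (\<phi> i) (fst x) (\<mu> (fst x) (snd x)) + diff_int (\<phi> j) (fst x) (\<mu> (fst x) (snd x))" by simp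
    qed
  qed
  note cov = ito_covariation[OF ito ito ito3 H3 solution_integral_add[OF \<phi> \<phi> I I I3]]
  show ?thesis
  proof unfold_locales
    show "(\<lambda>\<omega>. pairing (\<mu> t \<omega>) \<phi>) \<in> borel_measurable (G t)" if "t \<in> {0..T}" for t
      using continuous_adapted_integral(1)[OF adapted c that] by (intro borel_measurable_vecI) (simp add: pairing_def)
    show "continuous_on {0..T} (\<lambda>t. pairing (\<mu> t \<omega>) \<phi>)" if "\<omega> \<in> space M" for \<omega>
      unfolding pairing_def using continuous_adapted_integral(2)[OF adapted c that] by (intro continuous_on_vec_lambda)
    show "I i t \<in> borel_measurable M" if "t \<in> {0..T}" for i t by (rule has_ito_integral_measurable[OF ito that])
    show "integrable M (\<lambda>\<omega>. (I i t \<omega>)\<^sup>2)" if "t \<in> {0..T}" for i t by (rule has_ito_integral_square_integrable[OF ito that])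
    show "AE \<omega> in M. continuous_on {0..T} (\<lambda>t. I i t \<omega>)" for i using ito[of i] by (simp add: has_ito_integral_def)
    show "(\<integral>\<omega>. Z \<omega> * (I i v \<omega> - I i u \<omega>) \<partial>M) = 0"
      if "0 \<le> u" "u \<le> v" "v \<le> T" "Z \<in> borel_measurable (G u)" "\<And>\<omega>. \<omega> \<in> space M \<Longrightarrow> \<bar>Z \<omega>\<bar> \<le> C" for i u v Z C
      by (rule has_ito_integral_increment_mean(1)[OF ito that])
    show "(\<integral>\<omega>. Z \<omega> * ((I i v \<omega> - I i u \<omega>) * (I j v \<omega> - I j u \<omega>)) \<partial>M)
      = (\<integral>x. indicator {u<..v} (fst x) * Z (snd x) * (indicator {0..T} (fst x)
        * (diff_int (\<phi> i) (fst x) (\<mu> (fst x) (snd x)) \<bullet> diff_int (\<phi> j) (fst x) (\<mu> (fst x) (snd x)))) \<partial>time_product)"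
      if "0 \<le> u" "u \<le> v" "v \<le> T" "Z \<in> borel_measurable (G u)" "\<And>\<omega>. \<omega> \<in> space M \<Longrightarrow> \<bar>Z \<omega>\<bar> \<le> C" for i j u v Z C
      by (rule cov(1)[OF _ that])
    show "(\<lambda>N. \<Sum>k<N. \<integral>\<omega>. (if \<delta> < \<bar>I i (part_point t N (Suc k)) \<omega> - I i (part_point t N k) \<omega>\<bar>
        then (I i (part_point t N (Suc k)) \<omega> - I i (part_point t N k) \<omega>)\<^sup>2 else 0) \<partial>M) \<longlonglongrightarrow> 0"
      if "0 < t" "t \<le> T" "0 < \<delta>" for i t \<delta>
      unfolding part_point_def by (rule has_ito_integral_Lindeberg[OF ito that])
    show "integrable time_product (\<lambda>x. indicator {0..T} (fst x) * gen_int (\<phi> i) (fst x) (\<mu> (fst x) (snd x)))" for i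
      by (rule gen_int_integrable[OF \<phi>])
    show "integrable time_product (\<lambda>x. indicator {0..T} (fst x)
        * (diff_int (\<phi> i) (fst x) (\<mu> (fst x) (snd x)) \<bullet> diff_int (\<phi> j) (fst x) (\<mu> (fst x) (snd x))))" for i j
      \<comment> \<open>The claim does not involve \<open>u\<close>, \<open>v\<close> and
        \<open>Z\<close>, so any admissible values serve.\<close>
      by (rule cov(2)[where u=0 and v=0 and Z="\<lambda>_. 0" and C=0]) (use T_pos in auto)
    show "AE \<omega> in M. \<forall>t\<in>{0..T}. pairing (\<mu> t \<omega>) \<phi> $ i = pairing (\<mu> 0 \<omega>) \<phi> $ i
      + (\<integral>s. indicator {0..t} s * (indicator {0..T} (fst (s, \<omega>)) * gen_int (\<phi> i) (fst (s, \<omega>)) (\<mu> (fst (s, \<omega>)) (snd (s, \<omega>)))) \<partial>lborel) + I i t \<omega>" for i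
      using I[of i] by (simp add: solution_integral_def pairing_def)
  qed
qed

section \<open>Transfer from paths to laws\<close>

lemma section_kernel_measurable:
  fixes h :: "real \<Rightarrow> (real^'d) measure \<Rightarrow> 'c::topological_space"
  assumes h: "(\<lambda>y. h (clip 0 T (fst y)) (snd y)) \<in> borel_measurable (borel \<Otimes>\<^sub>M prob_borel)" and s: "s \<in> {0..T}"
  shows "h s \<in> borel_measurable prob_borel"
proof -
  have "(\<lambda>m. (s, m)) \<in> prob_borel \<rightarrow>\<^sub>M borel \<Otimes>\<^sub>M prob_borel" by simp
  from measurable_compose[OF this h] s show ?thesis by simp
qed

lemma pairing_measurable:
  fixes \<phi> :: "'k::finite \<Rightarrow> real^'d \<Rightarrow> real"
  assumes "\<And>i. \<phi> i \<in> Cc_infinity"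
  shows "(\<lambda>m. pairing m \<phi>) \<in> borel_measurable prob_borel"
proof (rule borel_measurable_vecI)
  fix i
  have "(\<lambda>m. \<integral>x. \<phi> i x \<partial>m) \<in> borel_measurable weak_borel"
    by (intro borel_measurable_integral_continuous Cc_infinityD[OF assms])
  moreover have "measurable (weak_borel :: (real^'d) measure measure) (borel :: real measure) = measurable prob_borel borel"
    by (rule measurable_cong_sets[OF sets_weak_borel_eq_prob_algebra refl])
  ultimately show "(\<lambda>m. pairing m \<phi> $ i) \<in> borel_measurable prob_borel" by (simp add: pairing_def)
qed

lemma fp_integrand_measurable:
  fixes \<phi> :: "'k::finite \<Rightarrow> real^'d \<Rightarrow> real"
  assumes \<phi>: "\<And>i. \<phi> i \<in> Cc_infinity" and f: "f \<in> Cc2" and s: "s \<in> {0..T}"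
  shows "fp_integrand b a \<gamma> f \<phi> s \<in> borel_measurable prob_borel"
proof -
  have [measurable]: "gen_int (\<phi> i) s \<in> borel_measurable prob_borel" "diff_int (\<phi> i) s \<in> borel_measurable prob_borel" for i
    using section_kernel_measurable[of "gen_int (\<phi> i)", OF integral_kernel_measurable[OF generator_measurable[OF \<phi>]] s]
      section_kernel_measurable[of "diff_int (\<phi> i)", OF integral_kernel_measurable[OF diffusion_measurable[OF \<phi>]] s] by auto
  have [measurable]: "partial i f \<in> borel_measurable borel" "partial i (partial j f) \<in> borel_measurable borel" for i j
    using Cc2D(4,5)[OF f] by (auto intro: borel_measurable_continuous_onI)
  note [measurable] = pairing_measurable[OF \<phi>]
  show ?thesis unfolding fp_integrand_def[abs_def] by measurable
qed

text \<open>At fixed \<open>s\<close> an integral against \<open>P s\<close> is an expectation, so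
  Fubini turns the right-hand side of the expected Ito formula into a time integral of integrals
  against the laws. The integrability claims for almost every \<open>s\<close> come from the same
  use of Fubini and from the almost everywhere finiteness of the coefficients along the
  path.\<close>

theorem fokker_planck:
  fixes \<phi> :: "'k::finite \<Rightarrow> real^'d \<Rightarrow> real" and f :: "real^'k \<Rightarrow> real"
  assumes P: "\<And>t. t \<in> {0..T} \<Longrightarrow> P t = distr M weak_borel (\<mu> t)"
    and t: "t \<in> {0..T}" and f: "f \<in> Cc2" and \<phi>: "\<And>i. \<phi> i \<in> Cc_infinity"
  shows "integrable (P t) (\<lambda>m. f (pairing m \<phi>))"
    and "AE s in lborel. s \<in> {0..t} \<longrightarrow>
      (AE m in P s. \<forall>i. integrable m (generator b a s m (\<phi> i)) \<and> integrable m (\<lambda>x. grad (\<phi> i) x v* \<gamma> s m x)) \<and>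
      integrable (P s) (fp_integrand b a \<gamma> f \<phi> s)"
    and "set_integrable lborel {0..t} (\<lambda>s. \<integral>m. fp_integrand b a \<gamma> f \<phi> s m \<partial>P s)"
    and "(\<integral>m. f (pairing m \<phi>) \<partial>P t) - (\<integral>m. f (pairing m \<phi>) \<partial>P 0)
      = (LINT s:{0..t}|lborel. (\<integral>m. fp_integrand b a \<gamma> f \<phi> s m \<partial>P s))"
proof -
  interpret pair_sigma_finite lborel M by (rule pair_sigma_finite_time_product)
  have P': "P s = distr M prob_borel (\<mu> s)" if "s \<in> {0..T}" for s
    unfolding P[OF that] by (intro distr_cong refl sets_weak_borel_eq_prob_algebra)
  have zero: "0 \<in> {0..T}" using T_pos by simp
  have fm: "f \<in> borel_measurable borel" using Cc2D(3)[OF f] by (rule borel_measurable_continuous_onI)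
  obtain K where K: "\<And>x. \<bar>f x\<bar> \<le> K" using Cc2D(6)[OF f] by blast
  have fp_meas: "(\<lambda>m. f (pairing m \<phi>)) \<in> borel_measurable prob_borel"
    by (rule measurable_compose[OF pairing_measurable[OF \<phi>] fm])
  have law: "(\<integral>m. g m \<partial>P s) = (\<integral>\<omega>. g (\<mu> s \<omega>) \<partial>M)" "integrable (P s) g \<longleftrightarrow> integrable M (\<lambda>\<omega>. g (\<mu> s \<omega>))"
    if "s \<in> {0..T}" "g \<in> borel_measurable prob_borel" for g :: "(real^'d) measure \<Rightarrow> real" and s
    using that \<mu>_measurable by (auto simp: P' integral_distr integrable_distr_eq)
  have "integrable M (\<lambda>\<omega>. f (pairing (\<mu> t \<omega>) \<phi>))"
    by (rule integrable_const_bound[of _ K]) (use K measurable_compose[OF \<mu>_measurable[OF t] fp_meas] in auto)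
  then show "integrable (P t) (\<lambda>m. f (pairing m \<phi>))" by (simp only: law(2)[OF t fp_meas])
  obtain I where I: "\<And>i. solution_integral (\<phi> i) (I i)" using solution_integral_exists[OF \<phi>] by metis
  interpret S: ito_system M G T B "\<lambda>t \<omega>. pairing (\<mu> t \<omega>) \<phi>" I
    "\<lambda>i x. indicator {0..T} (fst x) * gen_int (\<phi> i) (fst x) (\<mu> (fst x) (snd x))"
    "\<lambda>i j x. indicator {0..T} (fst x)
      * (diff_int (\<phi> i) (fst x) (\<mu> (fst x) (snd x)) \<bullet> diff_int (\<phi> j) (fst x) (\<mu> (fst x) (snd x)))"
    by (rule solution_ito_system[OF \<phi> I])
  \<comment> \<open>The partition intervals are open on the left, so the formula is obtained on
    \<open>{0<..t}\<close>; the time 0 is added at the end as a null set.\<close>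
  let ?h = "\<lambda>s \<omega>. indicator {0<..t} s * fp_integrand b a \<gamma> f \<phi> s (\<mu> s \<omega>)"
  let ?L = "\<lambda>x. (\<Sum>i\<in>UNIV. partial i f (pairing (\<mu> (clip 0 T (fst x)) (snd x)) \<phi>)
        * (indicator {0..T} (fst x) * gen_int (\<phi> i) (fst x) (\<mu> (fst x) (snd x))))
      + 1 / 2 * (\<Sum>i\<in>UNIV. \<Sum>j\<in>UNIV. partial i (partial j f) (pairing (\<mu> (clip 0 T (fst x)) (snd x)) \<phi>)
        * (indicator {0..T} (fst x) * (diff_int (\<phi> i) (fst x) (\<mu> (fst x) (snd x)) \<bullet> diff_int (\<phi> j) (fst x) (\<mu> (fst x) (snd x)))))"
  have L: "indicator {0<..t} (fst x) * ?L x = case_prod ?h x" for x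
  proof (cases "fst x \<in> {0<..t}")
    case True
    then have "fst x \<in> {0..T}" "clip 0 T (fst x) = fst x" using t by auto
    then show ?thesis by (simp add: fp_integrand_def case_prod_unfold)
  qed (simp add: case_prod_unfold)
  have h: "integrable time_product (case_prod ?h)"
    and formula: "(\<integral>\<omega>. f (pairing (\<mu> t \<omega>) \<phi>) \<partial>M) - (\<integral>\<omega>. f (pairing (\<mu> 0 \<omega>) \<phi>) \<partial>M) = (\<integral>x. case_prod ?h x \<partial>time_product)"
    using S.expected_ito_formula[OF t f] unfolding L by auto
  have fp_law: "indicator {0<..t} s * (\<integral>m. fp_integrand b a \<gamma> f \<phi> s m \<partial>P s) = (\<integral>\<omega>. ?h s \<omega> \<partial>M)" for s
  proof (cases "s \<in> {0<..t}")
    case True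
    then have "s \<in> {0..T}" using t by auto
    from law(1)[OF this fp_integrand_measurable[OF \<phi> f this]] True show ?thesis by simp
  qed simp
  have ae0: "AE s in lborel. s \<noteq> (0::real)" by (rule AE_lborel_singleton)
  show "AE s in lborel. s \<in> {0..t} \<longrightarrow>
      (AE m in P s. \<forall>i. integrable m (generator b a s m (\<phi> i)) \<and> integrable m (\<lambda>x. grad (\<phi> i) x v* \<gamma> s m x)) \<and>
      integrable (P s) (fp_integrand b a \<gamma> f \<phi> s)"
    using ae0 AE_pair[OF AE_finite_coefficients] AE_integrable_fst'[OF h]
  proof eventually_elim
    case (elim s)
    show ?case
    proof (intro impI conjI)
      assume "s \<in> {0..t}"
      then have s: "s \<in> {0<..t}" "s \<in> {0..T}" using elim(1) t by auto
      have [measurable]: "L1_norm b s \<in> borel_measurable prob_borel" "L1_norm a s \<in> borel_measurable prob_borel"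
        "L1_norm \<gamma> s \<in> borel_measurable prob_borel"
        using section_kernel_measurable[OF L1_norm_measurable[OF coefficients_clip_measurable(1)] s(2)]
          section_kernel_measurable[OF L1_norm_measurable[OF coefficients_clip_measurable(2)] s(2)]
          section_kernel_measurable[OF L1_norm_measurable[OF coefficients_clip_measurable(3)] s(2)] by auto
      have "{m \<in> space prob_borel. finite_coefficients s m} \<in> sets prob_borel"
        unfolding finite_coefficients_def by measurable
      then have "AE m in P s. finite_coefficients s m"
        unfolding P'[OF s(2)]
        using AE_distr_iff[OF \<mu>_measurable[OF s(2)], of "finite_coefficients s"] elim(2) s by simp
      moreover have "AE m in P s. m \<in> space prob_borel" using AE_space[of "P s"] by (simp add: P'[OF s(2)])
      ultimately show "AE m in P s. \<forall>i. integrable m (generator b a s m (\<phi> i)) \<and> integrable m (\<lambda>x. grad (\<phi> i) x v* \<gamma> s m x)"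
      proof eventually_elim
        case (elim m)
        then show ?case using finite_coefficients_integrable[OF s(2) elim(2,1) \<phi>] by simp
      qed
      show "integrable (P s) (fp_integrand b a \<gamma> f \<phi> s)"
        unfolding law(2)[OF s(2) fp_integrand_measurable[OF \<phi> f s(2)]] using elim(3) s by simp
    qed
  qed
  have int: "integrable lborel (\<lambda>s. indicator {0<..t} s * (\<integral>m. fp_integrand b a \<gamma> f \<phi> s m \<partial>P s))"
    unfolding fp_law using integrable_fst'[OF h] by simp
  have ind: "AE s in lborel. indicator {0<..t} s * (\<integral>m. fp_integrand b a \<gamma> f \<phi> s m \<partial>P s)
      = indicator {0..t} s *\<^sub>R (\<integral>m. fp_integrand b a \<gamma> f \<phi> s m \<partial>P s)"
    using ae0 by eventually_elim (auto simp: indicator_def)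
  \<comment> \<open>\<open>lborel\<close> is not complete, so equality almost everywhere does not
    transfer measurability. The two integrands differ by an explicit term at time 0.\<close>
  have "(\<lambda>s. indicator {0..t} s *\<^sub>R (\<integral>m. fp_integrand b a \<gamma> f \<phi> s m \<partial>P s)) \<in> borel_measurable lborel"
  proof -
    have "(\<lambda>s. indicator {0..t} s *\<^sub>R (\<integral>m. fp_integrand b a \<gamma> f \<phi> s m \<partial>P s))
      = (\<lambda>s. indicator {0<..t} s * (\<integral>m. fp_integrand b a \<gamma> f \<phi> s m \<partial>P s)
        + indicator {0} s * (\<integral>m. fp_integrand b a \<gamma> f \<phi> 0 m \<partial>P 0))"
      using t by (auto simp: fun_eq_iff indicator_def)
    then show ?thesis using borel_measurable_integrable[OF int] by simp
  qed
  note meas = borel_measurable_integrable[OF int] this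
  show "set_integrable lborel {0..t} (\<lambda>s. \<integral>m. fp_integrand b a \<gamma> f \<phi> s m \<partial>P s)"
    unfolding set_integrable_def using integrable_cong_AE[OF meas ind] int by simp
  have "(LINT s:{0..t}|lborel. (\<integral>m. fp_integrand b a \<gamma> f \<phi> s m \<partial>P s))
      = (\<integral>s. indicator {0<..t} s * (\<integral>m. fp_integrand b a \<gamma> f \<phi> s m \<partial>P s) \<partial>lborel)"
    unfolding set_lebesgue_integral_def by (rule integral_cong_AE[OF meas ind, symmetric])
  also have "\<dots> = (\<integral>x. case_prod ?h x \<partial>time_product)"
    unfolding fp_law using integral_fst'[OF h] by simp
  finally show "(\<integral>m. f (pairing m \<phi>) \<partial>P t) - (\<integral>m. f (pairing m \<phi>) \<partial>P 0)
      = (LINT s:{0..t}|lborel. (\<integral>m. fp_integrand b a \<gamma> f \<phi> s m \<partial>P s))"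
    using formula law(1)[OF t fp_meas] law(1)[OF zero fp_meas] by simp
qed

end

theorem proposition1p4:
  fixes T :: real
    and b :: "real \<Rightarrow> (real^'d::finite) measure \<Rightarrow> real^'d \<Rightarrow> real^'d"
    and a \<gamma> :: "real \<Rightarrow> (real^'d) measure \<Rightarrow> real^'d \<Rightarrow> real^'d^'d"
    and M :: "'w measure"
    and G :: "real \<Rightarrow> 'w measure"
    and B :: "real \<Rightarrow> 'w \<Rightarrow> real^'d"
    and \<mu> :: "real \<Rightarrow> 'w \<Rightarrow> (real^'d) measure"
    and P :: "real \<Rightarrow> (real^'d) measure measure"
  assumes "T > 0"
    and "(\<lambda>(t, m, x). b t m x) \<in>
      borel_measurable (restrict_space borel {0..T} \<Otimes>\<^sub>M weak_borel \<Otimes>\<^sub>M borel)"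
    and "(\<lambda>(t, m, x). a t m x) \<in>
      borel_measurable (restrict_space borel {0..T} \<Otimes>\<^sub>M weak_borel \<Otimes>\<^sub>M borel)"
    and "(\<lambda>(t, m, x). \<gamma> t m x) \<in>
      borel_measurable (restrict_space borel {0..T} \<Otimes>\<^sub>M weak_borel \<Otimes>\<^sub>M borel)"
    and "filtered_prob_space M G T"
    and "brownian_motion M G T B"
    and "continuous_adapted M G T \<mu>"
    and "solves_spde b a \<gamma> M G T B \<mu>"
    and "(\<integral>\<^sup>+ \<omega>. (\<integral>\<^sup>+ t\<in>{0..T}.
            ((\<integral>\<^sup>+ x. ennreal (norm (b t (\<mu> t \<omega>) x)) \<partial>\<mu> t \<omega>)
           + (\<integral>\<^sup>+ x. ennreal (norm (a t (\<mu> t \<omega>) x)) \<partial>\<mu> t \<omega>)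
           + (\<integral>\<^sup>+ x. ennreal (norm (\<gamma> t (\<mu> t \<omega>) x)) \<partial>\<mu> t \<omega>)\<^sup>2) \<partial>lborel) \<partial>M) < \<infinity>"
    and "\<And>t. t \<in> {0..T} \<Longrightarrow> P t = distr M weak_borel (\<mu> t)"
  shows "\<forall>t\<in>{0..T}. \<forall>f\<in>(Cc2 :: (real^'k::finite \<Rightarrow> real) set). \<forall>\<phi>. (\<forall>i. \<phi> i \<in> Cc_infinity) \<longrightarrow>
    \<comment> \<open>all integrals occurring in the equation are well defined\<close>
    integrable (P t) (\<lambda>m. f (pairing m \<phi>)) \<and>
    (AE s in lborel. s \<in> {0..t} \<longrightarrow>
      (AE m in P s. \<forall>i. integrable m (generator b a s m (\<phi> i)) \<and>
                        integrable m (\<lambda>x. grad (\<phi> i) x v* \<gamma> s m x)) \<and>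
      integrable (P s) (fp_integrand b a \<gamma> f \<phi> s)) \<and>
    set_integrable lborel {0..t} (\<lambda>s. \<integral>m. fp_integrand b a \<gamma> f \<phi> s m \<partial>P s) \<and>
    \<comment> \<open>the Fokker-Planck equation\<close>
    (\<integral>m. f (pairing m \<phi>) \<partial>P t) - (\<integral>m. f (pairing m \<phi>) \<partial>P 0)
      = (LINT s:{0..t}|lborel. (\<integral>m. fp_integrand b a \<gamma> f \<phi> s m \<partial>P s))"
proof -
  have "prob_space M" using assms(5) by (simp add: filtered_prob_space_def)
  then interpret spde_solution M G T B b a \<gamma> \<mu>
    using assms by (intro spde_solution.intro filtered_brownian.intro filtered_brownian_axioms.intro spde_solution_axioms.intro)
  show ?thesis
  proof (intro ballI allI impI conjI)
    fix t and f :: "real^'k \<Rightarrow> real" and \<phi> :: "'k \<Rightarrow> real^'d \<Rightarrow> real"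
    assume *: "t \<in> {0..T}" "f \<in> Cc2" "\<forall>i. \<phi> i \<in> Cc_infinity"
    note FP = fokker_planck[OF assms(10) *(1,2) *(3)[rule_format]]
    show "integrable (P t) (\<lambda>m. f (pairing m \<phi>))" by (rule FP(1))
    show "AE s in lborel. s \<in> {0..t} \<longrightarrow>
      (AE m in P s. \<forall>i. integrable m (generator b a s m (\<phi> i)) \<and> integrable m (\<lambda>x. grad (\<phi> i) x v* \<gamma> s m x)) \<and>
      integrable (P s) (fp_integrand b a \<gamma> f \<phi> s)" by (rule FP(2))
    show "set_integrable lborel {0..t} (\<lambda>s. \<integral>m. fp_integrand b a \<gamma> f \<phi> s m \<partial>P s)" by (rule FP(3))
    show "(\<integral>m. f (pairing m \<phi>) \<partial>P t) - (\<integral>m. f (pairing m \<phi>) \<partial>P 0)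
      = (LINT s:{0..t}|lborel. (\<integral>m. fp_integrand b a \<gamma> f \<phi> s m \<partial>P s))" by (rule FP(4))
  qed
qed

end
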